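(* Let $H$ be the Hopf algebra of non-nilpotent type associated to the group datum $(G,\chi,g,1)$, let $e\in H$ be the central idempotent $e=\frac1r\sum_{s=0}^{r-1}g^{sn}$, and let $\overline H$ be the Hopf algebra of nilpotent type associated to $(\overline G,\overline\chi,\overline g,0)$ (all as described in the context). Then: (1) $\overline H$ is isomorphic to $H/H(1-e)$ as a Hopf algebra. (2) $\overline H$ is isomorphic to $He$ as an algebra.
   Context: $\Bbbk$ is an algebraically closed field of characteristic zero. Fix a finite group $G$, a $\Bbbk$-linear character $\chi$ of $G$ and a central element $g\in G$; let $n\ge 2$ be the order of $q=\chi(g)$, and assume $\chi^n=1$ and $g^n\neq 1$ (a group datum $(G,\chi,g,1)$ of non-nilpotent type). $H$ is the Hopf algebra generated as an algebra by $y$ and $G$, with $\Bbbk G$ as a subalgebra and relations $y^n=g^n-1$, $yh=\chi(h)hy$ for $h\in G$; its structure maps are $\Delta(y)=y\otimes g+1\otimes y$, $\varepsilon(y)=0$, $S(y)=-yg^{-1}$, $\Delta(h)=h\otimes h$, $\varepsilon(h)=1$, $S(h)=h^{-1}$ for $h\in G$. It has $\Bbbk$-basis $\{y^ih\mid h\in G,\ 0\le i\le n-1\}$. The order of $g$ in $G$ is $nr$ with $r>1$. Put $N=\{1,g^n,g^{2n},\dots,g^{(r-1)n}\}$, a normal subgroup of $G$, $\overline G=G/N$, and $\overline h$ the image of $h\in G$ in $\overline G$. The character $\chi$ induces a character $\overline\chi$ of $\overline G$ with $\overline\chi(\overline h)=\chi(h)$. $\overline H$ is the Hopf algebra generated as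 an algebra by $z$ and $\overline G$, with $\Bbbk\overline G$ as a subalgebra and relations $z^n=0$, $z\overline h=\overline\chi(\overline h)\overline h z$; its structure maps are $\Delta(z)=z\otimes\overline g+1\otimes z$, $\varepsilon(z)=0$, $S(z)=-z\overline g^{-1}$, with the elements of $\overline G$ group-like; it has $\Bbbk$-basis $\{z^i\overline h\mid \overline h\in\overline G,\ 0\le i\le n-1\}$. The element $e$ is a central idempotent of $H$, $H(1-e)$ is a Hopf ideal of $H$, and $He$ is regarded as an algebra with unit $e$. *)

theory Defs
  imports "HOL-Algebra.Algebra"
begin

section \<open>Associative algebras\<close>

text \<open>
  The library's locale \<open>algebra\<close> requires the algebra to be commutative; here
  multiplication need not commute.
\<close>

locale assoc_algebra = K?: field K + module K A + A: ring A for K (structure) and A (structure) +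
  assumes smult_mult_left:
      "\<lbrakk>c \<in> carrier K; x \<in> carrier A; y \<in> carrier A\<rbrakk>
        \<Longrightarrow> (c \<odot>\<^bsub>A\<^esub> x) \<otimes>\<^bsub>A\<^esub> y = c \<odot>\<^bsub>A\<^esub> (x \<otimes>\<^bsub>A\<^esub> y)"
    and smult_mult_right:
      "\<lbrakk>c \<in> carrier K; x \<in> carrier A; y \<in> carrier A\<rbrakk>
        \<Longrightarrow> x \<otimes>\<^bsub>A\<^esub> (c \<odot>\<^bsub>A\<^esub> y) = c \<odot>\<^bsub>A\<^esub> (x \<otimes>\<^bsub>A\<^esub> y)"

definition alg_hom ::
  "('k, 'l) ring_scheme \<Rightarrow> ('k, 'a, 'm) module_scheme \<Rightarrow> ('k, 'b, 'n) module_scheme \<Rightarrow> ('a \<Rightarrow> 'b) set"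
where
  "alg_hom K A B =
    {\<phi> \<in> ring_hom A B. \<forall>c\<in>carrier K. \<forall>x\<in>carrier A. \<phi> (c \<odot>\<^bsub>A\<^esub> x) = c \<odot>\<^bsub>B\<^esub> \<phi> x}"

definition alg_iso ::
  "('k, 'l) ring_scheme \<Rightarrow> ('k, 'a, 'm) module_scheme \<Rightarrow> ('k, 'b, 'n) module_scheme \<Rightarrow> ('a \<Rightarrow> 'b) set"
where
  "alg_iso K A B = {\<phi> \<in> alg_hom K A B. bij_betw \<phi> (carrier A) (carrier B)}"

definition alg_Quot :: "('k, 'a, 'm) module_scheme \<Rightarrow> 'a set \<Rightarrow> ('k, 'a set) module" where
  "alg_Quot A I =
    \<lparr>carrier = carrier (A Quot I), monoid.mult = monoid.mult (A Quot I), one = one (A Quot I),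
     ring.zero = ring.zero (A Quot I), ring.add = ring.add (A Quot I),
     smult = (\<lambda>c C. the_elem ((\<lambda>x. I +>\<^bsub>A\<^esub> (c \<odot>\<^bsub>A\<^esub> x)) ` C))\<rparr>"

text \<open>For a central idempotent \<open>e\<close>, this is the algebra \<open>Ae\<close> with unit \<open>e\<close>.\<close>

definition corner_alg :: "('k, 'a, 'm) module_scheme \<Rightarrow> 'a \<Rightarrow> ('k, 'a, 'm) module_scheme" where
  "corner_alg A e = A\<lparr>carrier := (\<lambda>x. x \<otimes>\<^bsub>A\<^esub> e) ` carrier A, one := e\<rparr>"


section \<open>Monoid algebras and presentations\<close>

definition monoid_algebra ::
  "('k, 'l) ring_scheme \<Rightarrow> ('w, 'm) monoid_scheme \<Rightarrow> ('k, 'w \<Rightarrow> 'k) module"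
where
  "monoid_algebra K M =
    \<lparr>carrier = {f. (\<forall>w. f w \<in> carrier K) \<and> (\<forall>w. w \<notin> carrier M \<longrightarrow> f w = \<zero>\<^bsub>K\<^esub>)
                  \<and> finite {w. f w \<noteq> \<zero>\<^bsub>K\<^esub>}},
     monoid.mult = (\<lambda>f h w. finsum K (\<lambda>(u, v). f u \<otimes>\<^bsub>K\<^esub> h v)
               {(u, v). f u \<noteq> \<zero>\<^bsub>K\<^esub> \<and> h v \<noteq> \<zero>\<^bsub>K\<^esub> \<and> u \<otimes>\<^bsub>M\<^esub> v = w}),
     one = (\<lambda>w. if w = \<one>\<^bsub>M\<^esub> then \<one>\<^bsub>K\<^esub> else \<zero>\<^bsub>K\<^esub>),
     ring.zero = (\<lambda>w. \<zero>\<^bsub>K\<^esub>),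
     ring.add = (\<lambda>f h w. f w \<oplus>\<^bsub>K\<^esub> h w),
     smult = (\<lambda>c f w. c \<otimes>\<^bsub>K\<^esub> f w)\<rparr>"

definition basis_elem :: "('k, 'l) ring_scheme \<Rightarrow> 'w \<Rightarrow> 'w \<Rightarrow> 'k" where
  "basis_elem K w = (\<lambda>v. if v = w then \<one>\<^bsub>K\<^esub> else \<zero>\<^bsub>K\<^esub>)"

text \<open>
  The value on a finitely supported \<open>f\<close>, regarded as a formal linear combination, of the
  linear map into \<open>V\<close> that sends each basis element \<open>w\<close> to \<open>\<beta> w\<close>.
\<close>

definition lin_ext ::
  "('k, 'l) ring_scheme \<Rightarrow> ('k, 'a, 'm) module_scheme \<Rightarrow> ('w \<Rightarrow> 'a) \<Rightarrow> ('w \<Rightarrow> 'k) \<Rightarrow> 'a"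
where
  "lin_ext K V \<beta> f = finsum V (\<lambda>w. f w \<odot>\<^bsub>V\<^esub> \<beta> w) {w. f w \<noteq> \<zero>\<^bsub>K\<^esub>}"

definition free_monoid :: "'x set \<Rightarrow> 'x list monoid" where
  "free_monoid L = \<lparr>carrier = lists L, monoid.mult = (@), one = []\<rparr>"

abbreviation free_algebra :: "('k, 'l) ring_scheme \<Rightarrow> 'x set \<Rightarrow> ('k, 'x list \<Rightarrow> 'k) module" where
  "free_algebra K L \<equiv> monoid_algebra K (free_monoid L)"

definition free_eval ::
  "('k, 'l) ring_scheme \<Rightarrow> ('k, 'a, 'm) module_scheme \<Rightarrow> ('x \<Rightarrow> 'a) \<Rightarrow> ('x list \<Rightarrow> 'k) \<Rightarrow> 'a"
where
  "free_eval K A \<gamma> = lin_ext K A (\<lambda>w. foldr (\<lambda>x a. \<gamma> x \<otimes>\<^bsub>A\<^esub> a) w \<one>\<^bsub>A\<^esub>)"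

definition presented_by ::
  "('k, 'l) ring_scheme \<Rightarrow> ('k, 'a, 'm) module_scheme \<Rightarrow> 'x set \<Rightarrow> ('x list \<Rightarrow> 'k) set \<Rightarrow> ('x \<Rightarrow> 'a) \<Rightarrow> bool"
where
  "presented_by K A L rels \<gamma> \<longleftrightarrow>
    \<gamma> \<in> L \<rightarrow> carrier A \<and>
    free_eval K A \<gamma> ` carrier (free_algebra K L) = carrier A \<and>
    a_kernel (free_algebra K L) A (free_eval K A \<gamma>) = genideal (free_algebra K L) rels"


section \<open>Tensor products of algebras\<close>

text \<open>
  The monoid algebra on \<open>carrier A \<times> carrier B\<close> is the free vector space on the symbols
  \<open>(a, b)\<close> with the multiplication \<open>(a, b)(a', b') = (aa', bb')\<close>. Products of the relations
  below with such symbols are again relations of the same form, so the ideal they generate is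
  their linear span, and the quotient is the usual tensor product of vector spaces together
  with its usual multiplication.
\<close>

definition bilinear_relations ::
  "('k, 'l) ring_scheme \<Rightarrow> ('k, 'a, 'm) module_scheme \<Rightarrow> ('k, 'b, 'n) module_scheme \<Rightarrow> ('a \<times> 'b \<Rightarrow> 'k) set"
where
  "bilinear_relations K A B =
    (let F = monoid_algebra K (A \<times>\<times> B); d = (\<lambda>a b. basis_elem K (a, b)) in
      {d (a \<oplus>\<^bsub>A\<^esub> a') b \<ominus>\<^bsub>F\<^esub> (d a b \<oplus>\<^bsub>F\<^esub> d a' b) | a a' b.
          a \<in> carrier A \<and> a' \<in> carrier A \<and> b \<in> carrier B} \<union>
      {d a (b \<oplus>\<^bsub>B\<^esub> b') \<ominus>\<^bsub>F\<^esub> (d a b \<oplus>\<^bsub>F\<^esub> d a b') | a b b'.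
          a \<in> carrier A \<and> b \<in> carrier B \<and> b' \<in> carrier B} \<union>
      {d (c \<odot>\<^bsub>A\<^esub> a) b \<ominus>\<^bsub>F\<^esub> (c \<odot>\<^bsub>F\<^esub> d a b) | c a b.
          c \<in> carrier K \<and> a \<in> carrier A \<and> b \<in> carrier B} \<union>
      {d a (c \<odot>\<^bsub>B\<^esub> b) \<ominus>\<^bsub>F\<^esub> (c \<odot>\<^bsub>F\<^esub> d a b) | c a b.
          c \<in> carrier K \<and> a \<in> carrier A \<and> b \<in> carrier B})"

definition tensor_ideal ::
  "('k, 'l) ring_scheme \<Rightarrow> ('k, 'a, 'm) module_scheme \<Rightarrow> ('k, 'b, 'n) module_scheme \<Rightarrow> ('a \<times> 'b \<Rightarrow> 'k) set"
where
  "tensor_ideal K A B = genideal (monoid_algebra K (A \<times>\<times> B)) (bilinear_relations K A B)"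

definition tensor ::
  "('k, 'l) ring_scheme \<Rightarrow> ('k, 'a, 'm) module_scheme \<Rightarrow> ('k, 'b, 'n) module_scheme
    \<Rightarrow> ('k, ('a \<times> 'b \<Rightarrow> 'k) set) module"
where
  "tensor K A B = alg_Quot (monoid_algebra K (A \<times>\<times> B)) (tensor_ideal K A B)"

definition pure_tensor ::
  "('k, 'l) ring_scheme \<Rightarrow> ('k, 'a, 'm) module_scheme \<Rightarrow> ('k, 'b, 'n) module_scheme
    \<Rightarrow> 'a \<Rightarrow> 'b \<Rightarrow> ('a \<times> 'b \<Rightarrow> 'k) set"
where
  "pure_tensor K A B a b =
    tensor_ideal K A B +>\<^bsub>monoid_algebra K (A \<times>\<times> B)\<^esub> basis_elem K (a, b)"

text \<open>
  The linear map out of the tensor product induced by a bilinear map \<open>\<beta>\<close>; for bilinear \<open>\<beta>\<close>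
  the linear extension of \<open>\<beta>\<close> is constant on the cosets that are the elements of the tensor
  product.
\<close>

definition tensor_lift ::
  "('k, 'l) ring_scheme \<Rightarrow> ('k, 'c, 'm) module_scheme \<Rightarrow> ('a \<Rightarrow> 'b \<Rightarrow> 'c) \<Rightarrow> ('a \<times> 'b \<Rightarrow> 'k) set \<Rightarrow> 'c"
where
  "tensor_lift K V \<beta> T = the_elem (lin_ext K V (\<lambda>(a, b). \<beta> a b) ` T)"

text \<open>Here \<open>A\<close> and \<open>B\<close> are the targets of \<open>\<phi>\<close> and \<open>\<psi>\<close>.\<close>

definition tensor_map ::
  "('k, 'l) ring_scheme \<Rightarrow> ('k, 'a, 'm) module_scheme \<Rightarrow> ('k, 'b, 'n) module_scheme
    \<Rightarrow> ('c \<Rightarrow> 'a) \<Rightarrow> ('d \<Rightarrow> 'b) \<Rightarrow> ('c \<times> 'd \<Rightarrow> 'k) set \<Rightarrow> ('a \<times> 'b \<Rightarrow> 'k) set"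
where
  "tensor_map K A B \<phi> \<psi> = tensor_lift K (tensor K A B) (\<lambda>a b. pure_tensor K A B (\<phi> a) (\<psi> b))"

text \<open>The canonical map \<open>(A \<otimes> B) \<otimes> C \<rightarrow> A \<otimes> (B \<otimes> C)\<close>.\<close>

definition tensor_assoc ::
  "('k, 'l) ring_scheme \<Rightarrow> ('k, 'a, 'm) module_scheme \<Rightarrow> ('k, 'b, 'n) module_scheme
    \<Rightarrow> ('k, 'c, 'p) module_scheme
    \<Rightarrow> (('a \<times> 'b \<Rightarrow> 'k) set \<times> 'c \<Rightarrow> 'k) set \<Rightarrow> ('a \<times> ('b \<times> 'c \<Rightarrow> 'k) set \<Rightarrow> 'k) set"
where
  "tensor_assoc K A B C =
    (let BC = tensor K B C; ABC = tensor K A BC in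
      tensor_lift K ABC
        (\<lambda>t c. tensor_lift K ABC (\<lambda>a b. pure_tensor K A BC a (pure_tensor K B C b c)) t))"


section \<open>Hopf algebras\<close>

record ('k, 'a) hopf = "('k, 'a) module" +
  comult :: "'a \<Rightarrow> ('a \<times> 'a \<Rightarrow> 'k) set"
  counit :: "'a \<Rightarrow> 'k"
  antipode :: "'a \<Rightarrow> 'a"

locale hopf_algebra = assoc_algebra K H
  for K (structure) and H :: "('k, 'a, 'm) hopf_scheme" (structure) +
  assumes comult_hom: "comult H \<in> alg_hom K H (tensor K H H)"
    and counit_hom: "counit H \<in> ring_hom H K"
    and counit_smult:
      "\<lbrakk>c \<in> carrier K; x \<in> carrier H\<rbrakk> \<Longrightarrow> counit H (c \<odot>\<^bsub>H\<^esub> x) = c \<otimes>\<^bsub>K\<^esub> counit H x"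
    and coassoc:
      "x \<in> carrier H \<Longrightarrow>
        tensor_assoc K H H H (tensor_map K (tensor K H H) H (comult H) id (comult H x))
        = tensor_map K H (tensor K H H) id (comult H) (comult H x)"
    and counit_left:
      "x \<in> carrier H \<Longrightarrow> tensor_lift K H (\<lambda>a b. counit H a \<odot>\<^bsub>H\<^esub> b) (comult H x) = x"
    and counit_right:
      "x \<in> carrier H \<Longrightarrow> tensor_lift K H (\<lambda>a b. counit H b \<odot>\<^bsub>H\<^esub> a) (comult H x) = x"
    and antipode_closed: "x \<in> carrier H \<Longrightarrow> antipode H x \<in> carrier H"
    and antipode_add:
      "\<lbrakk>x \<in> carrier H; y \<in> carrier H\<rbrakk>
        \<Longrightarrow> antipode H (x \<oplus>\<^bsub>H\<^esub> y) = antipode H x \<oplus>\<^bsub>H\<^esub> antipode H y"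
    and antipode_smult:
      "\<lbrakk>c \<in> carrier K; x \<in> carrier H\<rbrakk> \<Longrightarrow> antipode H (c \<odot>\<^bsub>H\<^esub> x) = c \<odot>\<^bsub>H\<^esub> antipode H x"
    and antipode_left:
      "x \<in> carrier H \<Longrightarrow>
        tensor_lift K H (\<lambda>a b. antipode H a \<otimes>\<^bsub>H\<^esub> b) (comult H x) = counit H x \<odot>\<^bsub>H\<^esub> \<one>\<^bsub>H\<^esub>"
    and antipode_right:
      "x \<in> carrier H \<Longrightarrow>
        tensor_lift K H (\<lambda>a b. a \<otimes>\<^bsub>H\<^esub> antipode H b) (comult H x) = counit H x \<odot>\<^bsub>H\<^esub> \<one>\<^bsub>H\<^esub>"

definition hopf_iso ::
  "('k, 'l) ring_scheme \<Rightarrow> ('k, 'a, 'm) hopf_scheme \<Rightarrow> ('k, 'b, 'n) hopf_scheme \<Rightarrow> ('a \<Rightarrow> 'b) set"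
where
  "hopf_iso K A B =
    {\<phi> \<in> alg_iso K A B. \<forall>x\<in>carrier A.
        comult B (\<phi> x) = tensor_map K B B \<phi> \<phi> (comult A x) \<and>
        counit B (\<phi> x) = counit A x \<and>
        antipode B (\<phi> x) = \<phi> (antipode A x)}"

text \<open>
  The quotient by a Hopf ideal \<open>I\<close>: on the coset of \<open>x\<close> the structure maps are the images of
  \<open>\<Delta>(x)\<close>, \<open>\<epsilon>(x)\<close>, \<open>S(x)\<close> under the canonical projection, independently of the choice
  of \<open>x\<close> in the coset.
\<close>

definition hopf_Quot ::
  "('k, 'l) ring_scheme \<Rightarrow> ('k, 'a, 'm) hopf_scheme \<Rightarrow> 'a set \<Rightarrow> ('k, 'a set) hopf"
where
  "hopf_Quot K H I =
    (let Q = alg_Quot H I; \<pi> = (\<lambda>x. I +>\<^bsub>H\<^esub> x) in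
      \<lparr>carrier = carrier Q, monoid.mult = monoid.mult Q, one = one Q,
       ring.zero = ring.zero Q, ring.add = ring.add Q, smult = smult Q,
       comult = (\<lambda>C. the_elem ((\<lambda>x. tensor_map K Q Q \<pi> \<pi> (comult H x)) ` C)),
       counit = (\<lambda>C. the_elem (counit H ` C)),
       antipode = (\<lambda>C. the_elem ((\<lambda>x. \<pi> (antipode H x)) ` C))\<rparr>)"


section \<open>The Hopf algebra of a group datum\<close>

datatype 'g gen = Skew | Elt 'g

text \<open>
  Relations for \<open>(G, \<chi>, g, \<mu>)\<close>, with \<open>n\<close> the order of \<open>\<chi>(g)\<close>: those making the letters
  \<open>Elt h\<close> multiply as in the group algebra of \<open>G\<close>, then
  \<open>y\<^sup>n = \<mu>(g\<^sup>n - 1)\<close> and \<open>yh = \<chi>(h)hy\<close>, where \<open>y\<close> is the letter \<open>Skew\<close>.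
\<close>

definition datum_relations ::
  "('k, 'l) ring_scheme \<Rightarrow> ('g, 'm) monoid_scheme \<Rightarrow> ('g \<Rightarrow> 'k) \<Rightarrow> 'g \<Rightarrow> 'k
    \<Rightarrow> ('g gen list \<Rightarrow> 'k) set"
where
  "datum_relations K G \<chi> g \<mu> =
    (let F = free_algebra K (insert Skew (Elt ` carrier G)); w = basis_elem K;
         n = group.ord (units_of K) (\<chi> g) in
      {w [Elt h, Elt h'] \<ominus>\<^bsub>F\<^esub> w [Elt (h \<otimes>\<^bsub>G\<^esub> h')] | h h'. h \<in> carrier G \<and> h' \<in> carrier G} \<union>
      {w [Elt \<one>\<^bsub>G\<^esub>] \<ominus>\<^bsub>F\<^esub> \<one>\<^bsub>F\<^esub>} \<union>
      {w (replicate n Skew) \<ominus>\<^bsub>F\<^esub> (\<mu> \<odot>\<^bsub>F\<^esub> (w [Elt (g [^]\<^bsub>G\<^esub> n)] \<ominus>\<^bsub>F\<^esub> \<one>\<^bsub>F\<^esub>))} \<union>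
      {w [Skew, Elt h] \<ominus>\<^bsub>F\<^esub> (\<chi> h \<odot>\<^bsub>F\<^esub> w [Elt h, Skew]) | h. h \<in> carrier G})"

text \<open>
  \<open>H\<close>, with the images \<open>\<iota> h\<close> of the group elements and the element \<open>y\<close>, is the Hopf algebra of
  \<open>(G, \<chi>, g, \<mu>)\<close>. That \<open>\<iota>\<close> embeds the group algebra, and that the elements \<open>y\<^sup>ih\<close> with
  \<open>i < n\<close> form a basis, is a consequence of the presentation and not imposed.
\<close>

definition datum_hopf_algebra ::
  "('k, 'l) ring_scheme \<Rightarrow> ('g, 'm) monoid_scheme \<Rightarrow> ('g \<Rightarrow> 'k) \<Rightarrow> 'g \<Rightarrow> 'k
    \<Rightarrow> ('k, 'a, 'n) hopf_scheme \<Rightarrow> ('g \<Rightarrow> 'a) \<Rightarrow> 'a \<Rightarrow> bool"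
where
  "datum_hopf_algebra K G \<chi> g \<mu> H \<iota> y \<longleftrightarrow>
    hopf_algebra K H \<and>
    presented_by K H (insert Skew (Elt ` carrier G)) (datum_relations K G \<chi> g \<mu>) (case_gen y \<iota>) \<and>
    comult H y = pure_tensor K H H y (\<iota> g) \<oplus>\<^bsub>tensor K H H\<^esub> pure_tensor K H H \<one>\<^bsub>H\<^esub> y \<and>
    counit H y = \<zero>\<^bsub>K\<^esub> \<and>
    antipode H y = \<ominus>\<^bsub>H\<^esub> (y \<otimes>\<^bsub>H\<^esub> \<iota> (inv\<^bsub>G\<^esub> g)) \<and>
    (\<forall>h\<in>carrier G.
      comult H (\<iota> h) = pure_tensor K H H (\<iota> h) (\<iota> h) \<and>
      counit H (\<iota> h) = \<one>\<^bsub>K\<^esub> \<and>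
      antipode H (\<iota> h) = \<iota> (inv\<^bsub>G\<^esub> h))"

text \<open>The character of \<open>G Mod N\<close> induced by a character \<open>\<chi>\<close> of \<open>G\<close> that is trivial on \<open>N\<close>.\<close>

definition induced_char :: "('g \<Rightarrow> 'k) \<Rightarrow> 'g set \<Rightarrow> 'k" where
  "induced_char \<chi> C = the_elem (\<chi> ` C)"

end

theory Submission
  imports Defs
begin

text \<open>
  Sending \<open>y\<close> to \<open>z\<close> and \<open>h\<close> to its class respects the relations of \<open>H\<close>, because \<open>g\<^sup>n\<close> lies in \<open>N\<close>;
  this gives a surjective bialgebra map \<open>\<psi>\<close> from \<open>H\<close> to \<open>Hbar\<close>. Conversely \<open>g\<^sup>ne = e\<close>, so \<open>ye\<close> and the
  elements \<open>he\<close> satisfy the relations of \<open>Hbar\<close>, which gives an algebra map \<open>\<theta>\<close> from \<open>Hbar\<close> to \<open>He\<close>.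
  On generators, hence everywhere, \<open>\<psi> \<circ> \<theta>\<close> is the identity and \<open>\<theta> \<circ> \<psi>\<close> is multiplication by \<open>e\<close>.
  Thus \<open>\<theta>\<close> is an isomorphism onto \<open>He\<close> and the kernel of \<open>\<psi>\<close> is \<open>H(1 - e)\<close>. No basis of \<open>H\<close> is
  needed. A bialgebra map between Hopf algebras commutes with the antipodes, by uniqueness of
  convolution inverses, so the structure maps of \<open>H\<close> descend to the quotient by the kernel of \<open>\<psi>\<close>.
\<close>

text \<open>The element \<open>e\<close> is the average over \<open>N\<close>. Multiplication by an
  element of \<open>N\<close> permutes the summands, so \<open>N\<close> acts trivially on
  \<open>e\<close> and \<open>He\<close> only sees the quotient group; and \<psi> sends
  \<open>e\<close> to 1, being r copies of 1 divided by r. Both facts rest on r being invertible in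
  \<open>K\<close>. The map \<theta> has to land in the corner: only after multiplication by
  \<open>e\<close> does \<open>y^n = g^n - 1\<close> turn into \<open>z^n = 0\<close>, and the unit
  there is \<open>e\<close>.

  Comparison on generators works for the coproducts because both \<Delta> \<psi> and (\<psi>
  \<otimes> \<psi>) \<Delta> are algebra maps. It does not work for the antipode, which is only
  assumed to be linear; hence the detour through convolution.

  The other obstacle is well-definedness. Scalars on a quotient, lifts to a tensor product and the
  structure maps of a quotient Hopf algebra are all given by \<open>the_elem\<close> of the image of
  a coset, which has a meaning only once a map is shown to be constant on that coset. For tensor
  products this means that bilinear maps kill the ideal generated by the bilinear relations; for the
  Hopf quotient it means that the structure maps followed by the projection depend on \<psi> x
  only.\<close>

section \<open>Linear maps and algebra homomorphisms\<close>

text \<open>Linearity is kept apart from \<open>alg_hom\<close> because antipodes, lifts to tensor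
  products and the partial maps of a bilinear map are linear without having to be
  multiplicative.\<close>

definition lin_maps ::
  "('k, 'l) ring_scheme \<Rightarrow> ('k, 'a, 'm) module_scheme \<Rightarrow> ('k, 'b, 'n) module_scheme \<Rightarrow> ('a \<Rightarrow> 'b) set"
where
  "lin_maps K V W =
    {f \<in> carrier V \<rightarrow> carrier W.
      (\<forall>x\<in>carrier V. \<forall>y\<in>carrier V. f (x \<oplus>\<^bsub>V\<^esub> y) = f x \<oplus>\<^bsub>W\<^esub> f y) \<and>
      (\<forall>c\<in>carrier K. \<forall>x\<in>carrier V. f (c \<odot>\<^bsub>V\<^esub> x) = c \<odot>\<^bsub>W\<^esub> f x)}"

lemma lin_mapsI:
  assumes "\<And>x. x \<in> carrier V \<Longrightarrow> f x \<in> carrier W"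
    and "\<And>x y. \<lbrakk>x \<in> carrier V; y \<in> carrier V\<rbrakk> \<Longrightarrow> f (x \<oplus>\<^bsub>V\<^esub> y) = f x \<oplus>\<^bsub>W\<^esub> f y"
    and "\<And>c x. \<lbrakk>c \<in> carrier K; x \<in> carrier V\<rbrakk> \<Longrightarrow> f (c \<odot>\<^bsub>V\<^esub> x) = c \<odot>\<^bsub>W\<^esub> f x"
  shows "f \<in> lin_maps K V W"
  using assms by (auto simp: lin_maps_def)

lemma lin_maps_closed: "\<lbrakk>f \<in> lin_maps K V W; x \<in> carrier V\<rbrakk> \<Longrightarrow> f x \<in> carrier W"
  and lin_maps_add:
    "\<lbrakk>f \<in> lin_maps K V W; x \<in> carrier V; y \<in> carrier V\<rbrakk> \<Longrightarrow> f (x \<oplus>\<^bsub>V\<^esub> y) = f x \<oplus>\<^bsub>W\<^esub> f y"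
  and lin_maps_smult:
    "\<lbrakk>f \<in> lin_maps K V W; c \<in> carrier K; x \<in> carrier V\<rbrakk> \<Longrightarrow> f (c \<odot>\<^bsub>V\<^esub> x) = c \<odot>\<^bsub>W\<^esub> f x"
  by (auto simp: lin_maps_def)

lemma lin_maps_comp:
  "\<lbrakk>f \<in> lin_maps K U V; h \<in> lin_maps K V W\<rbrakk> \<Longrightarrow> (\<lambda>x. h (f x)) \<in> lin_maps K U W"
  by (auto simp: lin_maps_def Pi_iff)

lemma lin_maps_id: "id \<in> lin_maps K V V" "(\<lambda>x. x) \<in> lin_maps K V V"
  by (auto simp: lin_maps_def)

lemma lin_maps_zero:
  assumes "f \<in> lin_maps K V W" "module K V" "module K W"
  shows "f \<zero>\<^bsub>V\<^esub> = \<zero>\<^bsub>W\<^esub>"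
proof -
  interpret V: module K V by fact
  interpret W: module K W by fact
  have "f (\<zero>\<^bsub>K\<^esub> \<odot>\<^bsub>V\<^esub> \<zero>\<^bsub>V\<^esub>) = \<zero>\<^bsub>K\<^esub> \<odot>\<^bsub>W\<^esub> f \<zero>\<^bsub>V\<^esub>"
    by (rule lin_maps_smult[OF assms(1)]) simp_all
  then show ?thesis
    using lin_maps_closed[OF assms(1)] by simp
qed

lemma lin_maps_minus:
  assumes f: "f \<in> lin_maps K V W" and "module K V" "module K W"
    and x: "x \<in> carrier V" and y: "y \<in> carrier V"
  shows "f (x \<ominus>\<^bsub>V\<^esub> y) = f x \<ominus>\<^bsub>W\<^esub> f y"
proof -
  interpret V: module K V by fact
  interpret W: module K W by fact
  have neg: "\<ominus>\<^bsub>V\<^esub> y = (\<ominus>\<^bsub>K\<^esub> \<one>\<^bsub>K\<^esub>) \<odot>\<^bsub>V\<^esub> y" "\<ominus>\<^bsub>W\<^esub> f y = (\<ominus>\<^bsub>K\<^esub> \<one>\<^bsub>K\<^esub>) \<odot>\<^bsub>W\<^esub> f y"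
    using y lin_maps_closed[OF f y] by (simp_all add: V.smult_l_minus W.smult_l_minus)
  show ?thesis
    unfolding V.minus_eq W.minus_eq neg
    using x y by (simp add: lin_maps_add[OF f] lin_maps_smult[OF f])
qed

lemma lin_maps_finsum:
  assumes f: "f \<in> lin_maps K V W" and "module K V" "module K W"
    and "finite S" and "\<And>i. i \<in> S \<Longrightarrow> x i \<in> carrier V"
  shows "f (\<Oplus>\<^bsub>V\<^esub>i\<in>S. x i) = (\<Oplus>\<^bsub>W\<^esub>i\<in>S. f (x i))"
proof -
  interpret V: module K V by fact
  interpret W: module K W by fact
  show ?thesis
    using assms(4,5)
  proof (induction S rule: finite_induct)
    case empty
    then show ?case by (simp add: lin_maps_zero[OF assms(1-3)])
  next
    case (insert i S)
    then have "x \<in> S \<rightarrow> carrier V" "(\<lambda>i. f (x i)) \<in> S \<rightarrow> carrier W" "x i \<in> carrier V"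
      using lin_maps_closed[OF f] by auto
    with insert show ?case
      using lin_maps_closed[OF f] by (simp add: V.finsum_insert W.finsum_insert lin_maps_add[OF f])
  qed
qed

text \<open>Turns r equal summands into the scalar r, which then cancels against the inverse of r in
  \<open>e\<close>; this is used for the idempotence of \<open>e\<close> and for its image in
  \<open>Hbar\<close>.\<close>

lemma (in module) finsum_const_smult:
  "x \<in> carrier M \<Longrightarrow> (\<Oplus>\<^bsub>M\<^esub>i\<in>{..<k::nat}. x) = ([k] \<cdot>\<^bsub>R\<^esub> \<one>\<^bsub>R\<^esub>) \<odot>\<^bsub>M\<^esub> x"
proof (induction k)
  case (Suc k)
  then show ?case
    by (simp add: lessThan_Suc M.finsum_insert smult_l_distr M.a_comm)
qed simp

lemma assoc_algebra_module: "assoc_algebra K A \<Longrightarrow> module K A"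
  by (simp add: assoc_algebra_def)

lemma (in assoc_algebra) smult_one_mult:
  "\<lbrakk>c \<in> carrier K; x \<in> carrier A\<rbrakk> \<Longrightarrow> c \<odot>\<^bsub>A\<^esub> x = (c \<odot>\<^bsub>A\<^esub> \<one>\<^bsub>A\<^esub>) \<otimes>\<^bsub>A\<^esub> x"
  by (simp add: smult_mult_left)

lemma alg_hom_lin_maps: "f \<in> alg_hom K A B \<Longrightarrow> f \<in> lin_maps K A B"
  by (auto simp: alg_hom_def lin_maps_def ring_hom_def)

lemma alg_homI:
  assumes "f \<in> lin_maps K A B"
    and "\<And>x y. \<lbrakk>x \<in> carrier A; y \<in> carrier A\<rbrakk> \<Longrightarrow> f (x \<otimes>\<^bsub>A\<^esub> y) = f x \<otimes>\<^bsub>B\<^esub> f y"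
    and "f \<one>\<^bsub>A\<^esub> = \<one>\<^bsub>B\<^esub>"
  shows "f \<in> alg_hom K A B"
  using assms by (auto simp: alg_hom_def lin_maps_def ring_hom_def)

lemma alg_hom_mult:
    "\<lbrakk>f \<in> alg_hom K A B; x \<in> carrier A; y \<in> carrier A\<rbrakk> \<Longrightarrow> f (x \<otimes>\<^bsub>A\<^esub> y) = f x \<otimes>\<^bsub>B\<^esub> f y"
  and alg_hom_one: "f \<in> alg_hom K A B \<Longrightarrow> f \<one>\<^bsub>A\<^esub> = \<one>\<^bsub>B\<^esub>"
  by (auto simp: alg_hom_def ring_hom_def)

lemmas alg_hom_closed = lin_maps_closed[OF alg_hom_lin_maps]
  and alg_hom_add = lin_maps_add[OF alg_hom_lin_maps]
  and alg_hom_smult = lin_maps_smult[OF alg_hom_lin_maps]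

lemma alg_hom_comp:
  "\<lbrakk>f \<in> alg_hom K A B; h \<in> alg_hom K B C\<rbrakk> \<Longrightarrow> (\<lambda>x. h (f x)) \<in> alg_hom K A C"
  by (auto simp: alg_hom_def ring_hom_def Pi_iff)

lemma alg_hom_id: "id \<in> alg_hom K A A"
  by (auto simp: alg_hom_def ring_hom_def)

lemma alg_hom_zero:
  "\<lbrakk>f \<in> alg_hom K A B; assoc_algebra K A; assoc_algebra K B\<rbrakk> \<Longrightarrow> f \<zero>\<^bsub>A\<^esub> = \<zero>\<^bsub>B\<^esub>"
  by (meson alg_hom_lin_maps assoc_algebra_module lin_maps_zero)

lemma alg_hom_a_kernel_ideal:
  assumes f: "f \<in> alg_hom K A B" and "assoc_algebra K A" "assoc_algebra K B"
  shows "ideal (a_kernel A B f) A"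
proof -
  interpret A: assoc_algebra K A by fact
  interpret B: assoc_algebra K B by fact
  have "ring_hom_ring A B f"
    using f A.A.ring_axioms B.A.ring_axioms
    by (simp add: ring_hom_ring_def ring_hom_ring_axioms_def alg_hom_def)
  then show ?thesis
    by (rule ring_hom_ring.kernel_is_ideal)
qed

section \<open>Monoid algebras\<close>

locale monoid_alg = K?: field K + M: monoid M for K (structure) and M (structure)
begin

abbreviation F where "F \<equiv> monoid_algebra K M"

section \<open>The vector space of finitely supported functions\<close>

lemma F_simps:
  "carrier F = {f. (\<forall>w. f w \<in> carrier K) \<and> (\<forall>w. w \<notin> carrier M \<longrightarrow> f w = \<zero>)
                  \<and> finite {w. f w \<noteq> \<zero>}}"
  "f \<oplus>\<^bsub>F\<^esub> h = (\<lambda>w. f w \<oplus> h w)"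
  "\<zero>\<^bsub>F\<^esub> = (\<lambda>w. \<zero>)"
  "c \<odot>\<^bsub>F\<^esub> f = (\<lambda>w. c \<otimes> f w)"
  by (simp_all add: monoid_algebra_def)

lemma F_one: "\<one>\<^bsub>F\<^esub> = basis_elem K \<one>\<^bsub>M\<^esub>"
  by (simp add: monoid_algebra_def basis_elem_def)

lemma F_val: "f \<in> carrier F \<Longrightarrow> f w \<in> carrier K"
  and F_supp: "\<lbrakk>f \<in> carrier F; f w \<noteq> \<zero>\<rbrakk> \<Longrightarrow> w \<in> carrier M"
  and F_finite: "f \<in> carrier F \<Longrightarrow> finite {w. f w \<noteq> \<zero>}"
  by (auto simp: F_simps)

lemma F_add_closed: "\<lbrakk>f \<in> carrier F; h \<in> carrier F\<rbrakk> \<Longrightarrow> f \<oplus>\<^bsub>F\<^esub> h \<in> carrier F"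
  unfolding F_simps
  by (auto intro: finite_subset[of _ "{w. f w \<noteq> \<zero>} \<union> {w. h w \<noteq> \<zero>}"])

lemma F_smult_closed: "\<lbrakk>c \<in> carrier K; f \<in> carrier F\<rbrakk> \<Longrightarrow> c \<odot>\<^bsub>F\<^esub> f \<in> carrier F"
  unfolding F_simps
  by (auto intro: finite_subset[of _ "{w. f w \<noteq> \<zero>}"])

lemma F_zero_closed: "\<zero>\<^bsub>F\<^esub> \<in> carrier F"
  by (simp add: F_simps)

lemma basis_closed: "w \<in> carrier M \<Longrightarrow> basis_elem K w \<in> carrier F"
  unfolding F_simps basis_elem_def by (auto intro: finite_subset[of _ "{w}"])

lemma F_module: "module K F"
proof (rule moduleI)
  show "cring K" by (rule K.cring_axioms)
  show "abelian_group F"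
  proof (rule abelian_groupI)
    fix f assume f: "f \<in> carrier F"
    have "(\<lambda>w. \<ominus> f w) \<in> carrier F"
      using f unfolding F_simps by (auto intro: finite_subset[of _ "{w. f w \<noteq> \<zero>}"])
    moreover have "(\<lambda>w. \<ominus> f w) \<oplus>\<^bsub>F\<^esub> f = \<zero>\<^bsub>F\<^esub>"
      using f by (auto simp: F_simps K.l_neg)
    ultimately show "\<exists>h\<in>carrier F. h \<oplus>\<^bsub>F\<^esub> f = \<zero>\<^bsub>F\<^esub>"
      by blast
  qed (simp_all only: F_add_closed F_zero_closed,
       auto simp: F_simps K.a_ac)
qed (simp_all only: F_smult_closed, auto simp: F_simps K.l_distr K.r_distr K.m_assoc)

sublocale F: module K F by (rule F_module)

text \<open>The index set in the definition of the product depends on \<open>f\<close>,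
  \<open>h\<close> and \<open>w\<close>. Over a fixed rectangle containing both supports, padded
  with zeros, sums for different functions can be compared term by term, as the distributive laws
  require.\<close>

lemma F_mult:
  assumes f: "f \<in> carrier F" and h: "h \<in> carrier F"
    and S: "finite S" "{w. f w \<noteq> \<zero>} \<subseteq> S" and T: "finite T" "{w. h w \<noteq> \<zero>} \<subseteq> T"
  shows "(f \<otimes>\<^bsub>F\<^esub> h) w = finsum K (\<lambda>(u, v). if u \<otimes>\<^bsub>M\<^esub> v = w then f u \<otimes> h v else \<zero>) (S \<times> T)"
  unfolding monoid_algebra_def monoid.simps
  by (rule K.add.finprod_mono_neutral_cong_left)
     (use assms in \<open>auto simp: F_val split: if_splits\<close>)

lemma F_mult_closed:
  assumes f: "f \<in> carrier F" and h: "h \<in> carrier F"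
  shows "f \<otimes>\<^bsub>F\<^esub> h \<in> carrier F"
proof -
  let ?S = "{w. f w \<noteq> \<zero>}" and ?T = "{w. h w \<noteq> \<zero>}"
  note m = F_mult[OF f h F_finite[OF f] subset_refl F_finite[OF h] subset_refl]
  have val: "(f \<otimes>\<^bsub>F\<^esub> h) w \<in> carrier K" for w
    unfolding m by (rule K.finsum_closed) (auto simp: F_val[OF f] F_val[OF h])
  have z: "(f \<otimes>\<^bsub>F\<^esub> h) w = \<zero>" if "w \<notin> (\<lambda>(u, v). u \<otimes>\<^bsub>M\<^esub> v) ` (?S \<times> ?T)" for w
    unfolding m by (rule K.add.finprod_one_eqI) (use that in auto)
  have sub: "(\<lambda>(u, v). u \<otimes>\<^bsub>M\<^esub> v) ` (?S \<times> ?T) \<subseteq> carrier M"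
    using F_supp[OF f] F_supp[OF h] by auto
  have "finite {w. (f \<otimes>\<^bsub>F\<^esub> h) w \<noteq> \<zero>}"
  proof (rule finite_subset)
    show "{w. (f \<otimes>\<^bsub>F\<^esub> h) w \<noteq> \<zero>} \<subseteq> (\<lambda>(u, v). u \<otimes>\<^bsub>M\<^esub> v) ` (?S \<times> ?T)"
      using z by (intro subsetI, unfold mem_Collect_eq) metis
    show "finite ((\<lambda>(u, v). u \<otimes>\<^bsub>M\<^esub> v) ` (?S \<times> ?T))"
      by (intro finite_imageI finite_cartesian_product F_finite f h)
  qed
  moreover have "(f \<otimes>\<^bsub>F\<^esub> h) w = \<zero>" if "w \<notin> carrier M" for w
    by (rule z) (use that sub in blast)
  ultimately show ?thesis
    using val unfolding F_simps(1) mem_Collect_eq by (intro conjI allI impI)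
qed

lemma basis_mult:
  assumes "u \<in> carrier M" "v \<in> carrier M"
  shows "basis_elem K u \<otimes>\<^bsub>F\<^esub> basis_elem K v = basis_elem K (u \<otimes>\<^bsub>M\<^esub> v)"
proof
  fix w
  have "(basis_elem K u \<otimes>\<^bsub>F\<^esub> basis_elem K v) w =
      finsum K (\<lambda>(u', v'). if u' \<otimes>\<^bsub>M\<^esub> v' = w
          then basis_elem K u u' \<otimes> basis_elem K v v' else \<zero>) ({u} \<times> {v})"
    by (rule F_mult) (auto simp: basis_closed assms, auto simp: basis_elem_def split: if_splits)
  also have "\<dots> = basis_elem K (u \<otimes>\<^bsub>M\<^esub> v) w"
    by (auto simp: basis_elem_def K.finsum_insert)
  finally show "(basis_elem K u \<otimes>\<^bsub>F\<^esub> basis_elem K v) w = basis_elem K (u \<otimes>\<^bsub>M\<^esub> v) w" .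
qed

lemma F_l_distr:
  assumes f: "f \<in> carrier F" and f': "f' \<in> carrier F" and h: "h \<in> carrier F"
  shows "(f \<oplus>\<^bsub>F\<^esub> f') \<otimes>\<^bsub>F\<^esub> h = f \<otimes>\<^bsub>F\<^esub> h \<oplus>\<^bsub>F\<^esub> f' \<otimes>\<^bsub>F\<^esub> h"
proof
  fix w
  let ?S = "{w. f w \<noteq> \<zero>} \<union> {w. f' w \<noteq> \<zero>}" and ?T = "{w. h w \<noteq> \<zero>}"
  have S: "finite ?S" "{w. f w \<noteq> \<zero>} \<subseteq> ?S" "{w. f' w \<noteq> \<zero>} \<subseteq> ?S"
    "{w. (f \<oplus>\<^bsub>F\<^esub> f') w \<noteq> \<zero>} \<subseteq> ?S"
    using F_finite[OF f] F_finite[OF f'] by (auto simp: F_simps)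
  note T = F_finite[OF h] subset_refl
  let ?c = "\<lambda>f (u, v). if u \<otimes>\<^bsub>M\<^esub> v = w then f u \<otimes> h v else \<zero>"
  have "((f \<oplus>\<^bsub>F\<^esub> f') \<otimes>\<^bsub>F\<^esub> h) w = (\<Oplus>p\<in>?S \<times> ?T. ?c (f \<oplus>\<^bsub>F\<^esub> f') p)"
    by (rule F_mult[OF F_add_closed[OF f f'] h S(1,4) T])
  also have "\<dots> = (\<Oplus>p\<in>?S \<times> ?T. ?c f p \<oplus> ?c f' p)"
    by (rule K.finsum_cong')
       (auto simp: F_simps(2) K.l_distr F_val[OF f] F_val[OF f'] F_val[OF h])
  also have "\<dots> = (\<Oplus>p\<in>?S \<times> ?T. ?c f p) \<oplus> (\<Oplus>p\<in>?S \<times> ?T. ?c f' p)"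
    by (rule K.finsum_addf) (auto simp: F_val[OF f] F_val[OF f'] F_val[OF h])
  also have "\<dots> = (f \<otimes>\<^bsub>F\<^esub> h \<oplus>\<^bsub>F\<^esub> f' \<otimes>\<^bsub>F\<^esub> h) w"
    using F_mult[OF f h S(1,2) T, of w] F_mult[OF f' h S(1,3) T, of w]
    by (simp add: F_simps(2))
  finally show "((f \<oplus>\<^bsub>F\<^esub> f') \<otimes>\<^bsub>F\<^esub> h) w = (f \<otimes>\<^bsub>F\<^esub> h \<oplus>\<^bsub>F\<^esub> f' \<otimes>\<^bsub>F\<^esub> h) w" .
qed

lemma F_r_distr:
  assumes f: "f \<in> carrier F" and f': "f' \<in> carrier F" and h: "h \<in> carrier F"
  shows "h \<otimes>\<^bsub>F\<^esub> (f \<oplus>\<^bsub>F\<^esub> f') = h \<otimes>\<^bsub>F\<^esub> f \<oplus>\<^bsub>F\<^esub> h \<otimes>\<^bsub>F\<^esub> f'"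
proof
  fix w
  let ?S = "{w. f w \<noteq> \<zero>} \<union> {w. f' w \<noteq> \<zero>}" and ?T = "{w. h w \<noteq> \<zero>}"
  have S: "finite ?S" "{w. f w \<noteq> \<zero>} \<subseteq> ?S" "{w. f' w \<noteq> \<zero>} \<subseteq> ?S"
    "{w. (f \<oplus>\<^bsub>F\<^esub> f') w \<noteq> \<zero>} \<subseteq> ?S"
    using F_finite[OF f] F_finite[OF f'] by (auto simp: F_simps)
  note T = F_finite[OF h] subset_refl
  let ?c = "\<lambda>f (u, v). if u \<otimes>\<^bsub>M\<^esub> v = w then h u \<otimes> f v else \<zero>"
  have "(h \<otimes>\<^bsub>F\<^esub> (f \<oplus>\<^bsub>F\<^esub> f')) w = (\<Oplus>p\<in>?T \<times> ?S. ?c (f \<oplus>\<^bsub>F\<^esub> f') p)"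
    by (rule F_mult[OF h F_add_closed[OF f f'] T S(1,4)])
  also have "\<dots> = (\<Oplus>p\<in>?T \<times> ?S. ?c f p \<oplus> ?c f' p)"
    by (rule K.finsum_cong')
       (auto simp: F_simps(2) K.r_distr F_val[OF f] F_val[OF f'] F_val[OF h])
  also have "\<dots> = (\<Oplus>p\<in>?T \<times> ?S. ?c f p) \<oplus> (\<Oplus>p\<in>?T \<times> ?S. ?c f' p)"
    by (rule K.finsum_addf) (auto simp: F_val[OF f] F_val[OF f'] F_val[OF h])
  also have "\<dots> = (h \<otimes>\<^bsub>F\<^esub> f \<oplus>\<^bsub>F\<^esub> h \<otimes>\<^bsub>F\<^esub> f') w"
    using F_mult[OF h f T S(1,2), of w] F_mult[OF h f' T S(1,3), of w]
    by (simp add: F_simps(2))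
  finally show "(h \<otimes>\<^bsub>F\<^esub> (f \<oplus>\<^bsub>F\<^esub> f')) w = (h \<otimes>\<^bsub>F\<^esub> f \<oplus>\<^bsub>F\<^esub> h \<otimes>\<^bsub>F\<^esub> f') w" .
qed

lemma F_smult_mult:
  assumes c: "c \<in> carrier K" and f: "f \<in> carrier F" and h: "h \<in> carrier F"
  shows "(c \<odot>\<^bsub>F\<^esub> f) \<otimes>\<^bsub>F\<^esub> h = c \<odot>\<^bsub>F\<^esub> (f \<otimes>\<^bsub>F\<^esub> h)"
    and "f \<otimes>\<^bsub>F\<^esub> (c \<odot>\<^bsub>F\<^esub> h) = c \<odot>\<^bsub>F\<^esub> (f \<otimes>\<^bsub>F\<^esub> h)"
proof -
  note S = F_finite[OF f] and T = F_finite[OF h]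
  let ?S = "{w. f w \<noteq> \<zero>}" and ?T = "{w. h w \<noteq> \<zero>}"
  have sub: "{w. (c \<odot>\<^bsub>F\<^esub> f) w \<noteq> \<zero>} \<subseteq> ?S" "{w. (c \<odot>\<^bsub>F\<^esub> h) w \<noteq> \<zero>} \<subseteq> ?T"
    using c by (auto simp: F_simps)
  let ?c = "\<lambda>f h w (u, v). if u \<otimes>\<^bsub>M\<^esub> v = w then f u \<otimes> h v else \<zero>"
  have *: "(c \<odot>\<^bsub>F\<^esub> (f \<otimes>\<^bsub>F\<^esub> h)) w = (\<Oplus>p\<in>?S \<times> ?T. c \<otimes> ?c f h w p)" for w
    unfolding F_simps(4) F_mult[OF f h S subset_refl T subset_refl]
    by (rule K.finsum_rdistr) (auto simp: c S T F_val[OF f] F_val[OF h])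
  show "(c \<odot>\<^bsub>F\<^esub> f) \<otimes>\<^bsub>F\<^esub> h = c \<odot>\<^bsub>F\<^esub> (f \<otimes>\<^bsub>F\<^esub> h)"
    unfolding fun_eq_iff * F_mult[OF F_smult_closed[OF c f] h S sub(1) T subset_refl]
    by (intro allI K.finsum_cong') (auto simp: F_simps(4) c F_val[OF f] F_val[OF h] K.m_assoc)
  show "f \<otimes>\<^bsub>F\<^esub> (c \<odot>\<^bsub>F\<^esub> h) = c \<odot>\<^bsub>F\<^esub> (f \<otimes>\<^bsub>F\<^esub> h)"
    unfolding fun_eq_iff * F_mult[OF f F_smult_closed[OF c h] S subset_refl T sub(2)]
    by (intro allI K.finsum_cong') (auto simp: F_simps(4) c F_val[OF f] F_val[OF h] K.m_lcomm)
qed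

text \<open>Setting one nonzero value of \<open>f\<close> to zero shrinks the support strictly and
  splits off a multiple of a basis element. An identity linear in \<open>f\<close> therefore only
  has to be checked on basis elements.\<close>

lemma F_induct [consumes 1, case_names zero basis add smult]:
  assumes f: "f \<in> carrier F"
    and zero: "P \<zero>\<^bsub>F\<^esub>"
    and basis: "\<And>w. w \<in> carrier M \<Longrightarrow> P (basis_elem K w)"
    and add: "\<And>f h. \<lbrakk>f \<in> carrier F; h \<in> carrier F; P f; P h\<rbrakk> \<Longrightarrow> P (f \<oplus>\<^bsub>F\<^esub> h)"
    and smult: "\<And>c f. \<lbrakk>c \<in> carrier K; f \<in> carrier F; P f\<rbrakk> \<Longrightarrow> P (c \<odot>\<^bsub>F\<^esub> f)"
  shows "P f"
proof -
  have "finite {w. f w \<noteq> \<zero>}"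
    by (rule F_finite[OF f])
  then show ?thesis
    using f
  proof (induction "{w. f w \<noteq> \<zero>}" arbitrary: f rule: finite_psubset_induct)
    case (psubset f)
    show ?case
    proof (cases "\<exists>w. f w \<noteq> \<zero>")
      case False
      then have "f = \<zero>\<^bsub>F\<^esub>" by (auto simp: F_simps)
      then show ?thesis using zero by simp
    next
      case True
      then obtain w where w: "f w \<noteq> \<zero>" by blast
      let ?h = "f(w := \<zero>)"
      have h: "?h \<in> carrier F"
        using psubset.prems unfolding F_simps
        by (auto intro: finite_subset[of _ "{w. f w \<noteq> \<zero>}"])
      have "P ?h"
        by (rule psubset.hyps(2)[OF _ h]) (use w in auto)
      moreover have "P (f w \<odot>\<^bsub>F\<^esub> basis_elem K w)"
        using F_supp[OF psubset.prems w] F_val[OF psubset.prems]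
        by (intro smult basis basis_closed)
      moreover have "f = (f w \<odot>\<^bsub>F\<^esub> basis_elem K w) \<oplus>\<^bsub>F\<^esub> ?h"
        using F_val[OF psubset.prems] by (auto simp: F_simps basis_elem_def)
      ultimately show ?thesis
        using add h F_smult_closed basis_closed F_supp[OF psubset.prems w] F_val[OF psubset.prems]
        by metis
    qed
  qed
qed

text \<open>The ring laws are still to be proved at this point, so the zero products are obtained
  from compatibility with the scalar 0.\<close>

lemma F_l_null: "h \<in> carrier F \<Longrightarrow> \<zero>\<^bsub>F\<^esub> \<otimes>\<^bsub>F\<^esub> h = \<zero>\<^bsub>F\<^esub>"
  and F_r_null: "h \<in> carrier F \<Longrightarrow> h \<otimes>\<^bsub>F\<^esub> \<zero>\<^bsub>F\<^esub> = \<zero>\<^bsub>F\<^esub>"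
  using F_smult_mult[of \<zero> "\<zero>\<^bsub>F\<^esub>" h] F_smult_mult[of \<zero> h "\<zero>\<^bsub>F\<^esub>"]
  by (simp_all add: F_mult_closed)

text \<open>Both sides are linear in each of the three factors, so three nested inductions reduce
  the claim to associativity in \<open>M\<close>.\<close>

lemma F_assoc:
  assumes f: "f \<in> carrier F" and h: "h \<in> carrier F" and k: "k \<in> carrier F"
  shows "(f \<otimes>\<^bsub>F\<^esub> h) \<otimes>\<^bsub>F\<^esub> k = f \<otimes>\<^bsub>F\<^esub> (h \<otimes>\<^bsub>F\<^esub> k)"
  using f
proof (induction f rule: F_induct)
  case (basis u)
  note u = basis_closed[OF basis]
  show ?case
    using h
  proof (induction h rule: F_induct)
    case (basis v)
    note v = basis_closed[OF basis]
    show ?case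
      using k
    proof (induction k rule: F_induct)
      case (basis w)
      with \<open>u \<in> carrier M\<close> \<open>v \<in> carrier M\<close> show ?case
        by (simp add: basis_mult M.m_assoc)
    qed (simp_all add: F_mult_closed u v F_r_null F_r_distr F_smult_mult)
  qed (simp_all add: F_mult_closed u k F_l_null F_r_null F_l_distr F_r_distr F_smult_mult)
qed (simp_all add: F_mult_closed h k F_l_null F_l_distr F_smult_mult)

lemma F_l_one: "f \<in> carrier F \<Longrightarrow> \<one>\<^bsub>F\<^esub> \<otimes>\<^bsub>F\<^esub> f = f"
  unfolding F_one
  by (induction f rule: F_induct)
     (simp_all add: basis_mult basis_closed F_r_null F_r_distr F_smult_mult)

lemma F_r_one: "f \<in> carrier F \<Longrightarrow> f \<otimes>\<^bsub>F\<^esub> \<one>\<^bsub>F\<^esub> = f"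
  unfolding F_one
  by (induction f rule: F_induct)
     (simp_all add: basis_mult basis_closed F_l_null F_l_distr F_smult_mult)

lemma F_assoc_algebra: "assoc_algebra K F"
proof -
  have "ring F"
    by (rule ringI[OF F.M.abelian_group_axioms])
       (auto intro!: monoidI simp: F_mult_closed F_assoc F_l_one F_r_one F_l_distr F_r_distr
          F_one basis_closed F_l_one[unfolded F_one] F_r_one[unfolded F_one])
  then show ?thesis
    by (simp add: assoc_algebra_def assoc_algebra_axioms_def K.field_axioms F_module F_smult_mult)
qed

sublocale F: assoc_algebra K F by (rule F_assoc_algebra)

section \<open>Linear extension of maps defined on the monoid\<close>

lemma lin_ext_superset:
  assumes "module K V" and \<beta>: "\<And>w. w \<in> carrier M \<Longrightarrow> \<beta> w \<in> carrier V" and f: "f \<in> carrier F"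
    and S: "finite S" "{w. f w \<noteq> \<zero>} \<subseteq> S" "S \<subseteq> carrier M"
  shows "lin_ext K V \<beta> f = (\<Oplus>\<^bsub>V\<^esub>w\<in>S. f w \<odot>\<^bsub>V\<^esub> \<beta> w)"
proof -
  interpret V: module K V by fact
  show ?thesis
    unfolding lin_ext_def
    by (rule V.add.finprod_mono_neutral_cong_left[OF S(1,2)])
       (use S(3) \<beta> F_val[OF f] in \<open>auto intro!: V.smult_closed V.smult_l_null\<close>)
qed

lemma lin_ext_lin_maps:
  assumes "module K V" and \<beta>: "\<And>w. w \<in> carrier M \<Longrightarrow> \<beta> w \<in> carrier V"
  shows "lin_ext K V \<beta> \<in> lin_maps K F V"
proof -
  interpret V: module K V by fact
  have cl: "f w \<odot>\<^bsub>V\<^esub> \<beta> w \<in> carrier V" if "f \<in> carrier F" "w \<in> carrier M" for f w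
    using that \<beta> F_val by simp
  have sup: "lin_ext K V \<beta> f = (\<Oplus>\<^bsub>V\<^esub>w\<in>S. f w \<odot>\<^bsub>V\<^esub> \<beta> w)"
    if "f \<in> carrier F" "finite S" "{w. f w \<noteq> \<zero>} \<subseteq> S" "S \<subseteq> carrier M" for f S
    by (rule lin_ext_superset[OF assms(1) \<beta> that])
  show ?thesis
  proof (rule lin_mapsI)
    fix f assume f: "f \<in> carrier F"
    show "lin_ext K V \<beta> f \<in> carrier V"
      unfolding lin_ext_def by (rule V.finsum_closed) (use cl[OF f] F_supp[OF f] in auto)
    fix h assume h: "h \<in> carrier F"
    \<comment> \<open>The sums for \<open>f\<close>, \<open>h\<close> and their sum need a common
      index set; the support of the sum can be smaller than the union, where values cancel.\<close>
    let ?S = "{w. f w \<noteq> \<zero>} \<union> {w. h w \<noteq> \<zero>}"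
    have S: "finite ?S" "{w. f w \<noteq> \<zero>} \<subseteq> ?S" "{w. h w \<noteq> \<zero>} \<subseteq> ?S" "?S \<subseteq> carrier M"
      "{w. (f \<oplus>\<^bsub>F\<^esub> h) w \<noteq> \<zero>} \<subseteq> ?S"
      using F_finite[OF f] F_finite[OF h] F_supp[OF f] F_supp[OF h] by (auto simp: F_simps)
    have "(\<Oplus>\<^bsub>V\<^esub>w\<in>?S. (f \<oplus>\<^bsub>F\<^esub> h) w \<odot>\<^bsub>V\<^esub> \<beta> w) =
        (\<Oplus>\<^bsub>V\<^esub>w\<in>?S. f w \<odot>\<^bsub>V\<^esub> \<beta> w \<oplus>\<^bsub>V\<^esub> h w \<odot>\<^bsub>V\<^esub> \<beta> w)"
      by (rule V.finsum_cong')
         (use S(4) cl[OF f] cl[OF h] \<beta> F_val[OF f] F_val[OF h]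
          in \<open>auto simp: F_simps(2) intro!: V.smult_l_distr\<close>)
    also have "\<dots> = (\<Oplus>\<^bsub>V\<^esub>w\<in>?S. f w \<odot>\<^bsub>V\<^esub> \<beta> w) \<oplus>\<^bsub>V\<^esub> (\<Oplus>\<^bsub>V\<^esub>w\<in>?S. h w \<odot>\<^bsub>V\<^esub> \<beta> w)"
      by (rule V.finsum_addf) (use S(4) cl[OF f] cl[OF h] in auto)
    finally show "lin_ext K V \<beta> (f \<oplus>\<^bsub>F\<^esub> h) = lin_ext K V \<beta> f \<oplus>\<^bsub>V\<^esub> lin_ext K V \<beta> h"
      using sup[OF f S(1,2,4)] sup[OF h S(1,3,4)] sup[OF F_add_closed[OF f h] S(1,5,4)]
      by simp
  next
    fix c f assume c: "c \<in> carrier K" and f: "f \<in> carrier F"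
    let ?S = "{w. f w \<noteq> \<zero>}"
    have S: "finite ?S" "?S \<subseteq> carrier M" "{w. (c \<odot>\<^bsub>F\<^esub> f) w \<noteq> \<zero>} \<subseteq> ?S"
      using F_finite[OF f] F_supp[OF f] c by (auto simp: F_simps)
    have "(\<Oplus>\<^bsub>V\<^esub>w\<in>?S. (c \<odot>\<^bsub>F\<^esub> f) w \<odot>\<^bsub>V\<^esub> \<beta> w) = (\<Oplus>\<^bsub>V\<^esub>w\<in>?S. c \<odot>\<^bsub>V\<^esub> (f w \<odot>\<^bsub>V\<^esub> \<beta> w))"
      by (rule V.finsum_cong')
         (use S(2) cl[OF f] c \<beta> F_val[OF f] in \<open>auto simp: F_simps(4) intro!: V.smult_assoc1\<close>)
    also have "\<dots> = c \<odot>\<^bsub>V\<^esub> (\<Oplus>\<^bsub>V\<^esub>w\<in>?S. f w \<odot>\<^bsub>V\<^esub> \<beta> w)"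
      by (rule V.finsum_smult_ldistr[symmetric]) (use S c cl[OF f] in auto)
    finally show "lin_ext K V \<beta> (c \<odot>\<^bsub>F\<^esub> f) = c \<odot>\<^bsub>V\<^esub> lin_ext K V \<beta> f"
      using sup[OF f S(1) subset_refl S(2)] sup[OF F_smult_closed[OF c f] S(1,3,2)] by simp
  qed
qed

lemma lin_ext_basis:
  assumes "module K V" and \<beta>: "\<And>w. w \<in> carrier M \<Longrightarrow> \<beta> w \<in> carrier V" and w: "w \<in> carrier M"
  shows "lin_ext K V \<beta> (basis_elem K w) = \<beta> w"
proof -
  interpret V: module K V by fact
  have "lin_ext K V \<beta> (basis_elem K w) = (\<Oplus>\<^bsub>V\<^esub>v\<in>{w}. basis_elem K w v \<odot>\<^bsub>V\<^esub> \<beta> v)"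
    by (rule lin_ext_superset[OF assms(1,2)]) (use w basis_closed in \<open>auto simp: basis_elem_def\<close>)
  then show ?thesis
    using \<beta>[OF w] by (simp add: basis_elem_def V.finsum_insert)
qed

lemma F_lin_maps_eqI:
  assumes "module K V" and p: "p \<in> lin_maps K F V" and q: "q \<in> lin_maps K F V"
    and eq: "\<And>w. w \<in> carrier M \<Longrightarrow> p (basis_elem K w) = q (basis_elem K w)"
    and f: "f \<in> carrier F"
  shows "p f = q f"
  using f
proof (induction f rule: F_induct)
  case zero
  then show ?case
    using lin_maps_zero[OF p F_module assms(1)] lin_maps_zero[OF q F_module assms(1)] by simp
qed (simp_all add: eq lin_maps_add[OF p] lin_maps_smult[OF p] lin_maps_add[OF q]
       lin_maps_smult[OF q])

text \<open>Universal property of the monoid algebra. Multiplicativity equates two bilinear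
  expressions, so it suffices to have it on pairs of basis elements, where it is the assumption on
  \<beta>.\<close>

lemma lin_ext_alg_hom:
  assumes A: "assoc_algebra K A" and \<beta>: "\<And>w. w \<in> carrier M \<Longrightarrow> \<beta> w \<in> carrier A"
    and mult: "\<And>u v. \<lbrakk>u \<in> carrier M; v \<in> carrier M\<rbrakk> \<Longrightarrow> \<beta> (u \<otimes>\<^bsub>M\<^esub> v) = \<beta> u \<otimes>\<^bsub>A\<^esub> \<beta> v"
    and one: "\<beta> \<one>\<^bsub>M\<^esub> = \<one>\<^bsub>A\<^esub>"
  shows "lin_ext K A \<beta> \<in> alg_hom K F A"
proof (rule alg_homI)
  interpret A: assoc_algebra K A by fact
  note m = assoc_algebra_module[OF A]
  have lin: "lin_ext K A \<beta> \<in> lin_maps K F A"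
    by (rule lin_ext_lin_maps[OF m \<beta>])
  have bas: "lin_ext K A \<beta> (basis_elem K w) = \<beta> w" if "w \<in> carrier M" for w
    by (rule lin_ext_basis[OF m \<beta> that])
  note cl = lin_maps_closed[OF lin]
  note z = lin_maps_zero[OF lin F_module m]
  show "lin_ext K A \<beta> \<in> lin_maps K F A" by (rule lin)
  show "lin_ext K A \<beta> \<one>\<^bsub>F\<^esub> = \<one>\<^bsub>A\<^esub>"
    unfolding F_one by (simp add: bas one)
  fix f h assume f: "f \<in> carrier F" and h: "h \<in> carrier F"
  show "lin_ext K A \<beta> (f \<otimes>\<^bsub>F\<^esub> h) = lin_ext K A \<beta> f \<otimes>\<^bsub>A\<^esub> lin_ext K A \<beta> h"
    using f
  proof (induction f rule: F_induct)
    case (basis u)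
    note u = basis_closed[OF basis]
    show ?case
      using h
    proof (induction h rule: F_induct)
      case (basis v)
      with \<open>u \<in> carrier M\<close> show ?case
        by (simp add: basis_mult bas mult)
    qed (simp_all add: F_mult_closed u z cl F_r_null F_r_distr F_smult_mult lin_maps_add[OF lin]
          lin_maps_smult[OF lin] A.A.r_distr A.smult_mult_right)
  qed (simp_all add: F_mult_closed h z cl F_l_null F_l_distr F_smult_mult lin_maps_add[OF lin]
          lin_maps_smult[OF lin] A.A.l_distr A.smult_mult_left)
qed

end

section \<open>Quotient algebras\<close>

locale alg_ideal = assoc_algebra K A + I: ideal I A
  for K (structure) and A (structure) and I
begin

abbreviation Q where "Q \<equiv> alg_Quot A I"
abbreviation proj where "proj \<equiv> (\<lambda>x. I +>\<^bsub>A\<^esub> x)"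

lemma proj_eq_iff:
  "\<lbrakk>x \<in> carrier A; y \<in> carrier A\<rbrakk> \<Longrightarrow> proj x = proj y \<longleftrightarrow> x \<ominus>\<^bsub>A\<^esub> y \<in> I"
  using A.quotient_eq_iff_same_a_r_cos[OF I.is_ideal] by auto

lemma proj_memD:
  assumes "x \<in> carrier A" "u \<in> proj x"
  shows "u \<in> carrier A" "proj u = proj x"
proof -
  show "u \<in> carrier A"
    using M.a_r_coset_subset_G[of I x] I.a_subset assms by blast
  show "proj u = proj x"
    using M.a_repr_independence[OF assms(2,1)] I.is_additive_subgroup
    by (simp add: additive_subgroup.a_subgroup)
qed

text \<open>This evaluates every \<open>the_elem\<close> in the definitions: a map constant on the
  coset has a singleton image, which is nonempty because \<open>x\<close> lies in its own
  coset.\<close>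

lemma the_elem_image_proj:
  assumes x: "x \<in> carrier A"
    and f: "\<And>u. \<lbrakk>u \<in> carrier A; proj u = proj x\<rbrakk> \<Longrightarrow> f u = f x"
  shows "the_elem (f ` proj x) = f x"
proof -
  have "x \<in> proj x"
    using M.a_rcosI[OF I.zero_closed _ x] I.a_subset x by simp
  then have "f ` proj x = {f x}"
    using f proj_memD[OF x] by blast
  then show ?thesis by simp
qed

lemma Q_carrier: "carrier Q = proj ` carrier A"
  by (auto simp: alg_Quot_def FactRing_simps)

text \<open>A ring ideal is automatically a subspace, because scaling by \<open>c\<close> is
  multiplication by \<open>c\<close> times the unit.\<close>

lemma smult_I: "\<lbrakk>c \<in> carrier K; x \<in> I\<rbrakk> \<Longrightarrow> c \<odot>\<^bsub>A\<^esub> x \<in> I"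
  using smult_one_mult[of c x] I.I_l_closed[of x "c \<odot>\<^bsub>A\<^esub> \<one>\<^bsub>A\<^esub>"] I.Icarr by simp

lemma Q_smult:
  assumes c: "c \<in> carrier K" and x: "x \<in> carrier A"
  shows "c \<odot>\<^bsub>Q\<^esub> proj x = proj (c \<odot>\<^bsub>A\<^esub> x)"
proof -
  have "proj (c \<odot>\<^bsub>A\<^esub> u) = proj (c \<odot>\<^bsub>A\<^esub> x)" if "u \<in> carrier A" "proj u = proj x" for u
  proof -
    have "c \<odot>\<^bsub>A\<^esub> u \<ominus>\<^bsub>A\<^esub> c \<odot>\<^bsub>A\<^esub> x = c \<odot>\<^bsub>A\<^esub> (u \<ominus>\<^bsub>A\<^esub> x)"
      using that(1) x c by (simp add: M.minus_eq smult_r_distr smult_r_minus)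
    then show ?thesis
      using that x c smult_I by (simp add: proj_eq_iff)
  qed
  then show ?thesis
    by (simp add: alg_Quot_def the_elem_image_proj[OF x, of "\<lambda>u. proj (c \<odot>\<^bsub>A\<^esub> u)"])
qed

lemma Q_ops:
  "x \<in> carrier A \<Longrightarrow> y \<in> carrier A \<Longrightarrow> proj x \<otimes>\<^bsub>Q\<^esub> proj y = proj (x \<otimes>\<^bsub>A\<^esub> y)"
  "x \<in> carrier A \<Longrightarrow> y \<in> carrier A \<Longrightarrow> proj x \<oplus>\<^bsub>Q\<^esub> proj y = proj (x \<oplus>\<^bsub>A\<^esub> y)"
  "\<one>\<^bsub>Q\<^esub> = proj \<one>\<^bsub>A\<^esub>"
  "\<zero>\<^bsub>Q\<^esub> = proj \<zero>\<^bsub>A\<^esub>"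
  using I.rcos_ring_hom
  by (simp_all add: alg_Quot_def ring_hom_def FactRing_def I.a_subset)

text \<open>\<open>alg_Quot\<close> copies the operations of \<open>A Quot I\<close> into a record
  that also carries scalars, so the ring axioms have to be transported from one record to the
  other.\<close>

lemma Q_ring: "ring Q"
proof -
  interpret QR: ring "A Quot I" by (rule I.quotient_is_ring)
  have eqs: "carrier Q = carrier (A Quot I)" "monoid.mult Q = monoid.mult (A Quot I)"
    "one Q = one (A Quot I)" "ring.zero Q = ring.zero (A Quot I)"
    "ring.add Q = ring.add (A Quot I)"
    by (simp_all add: alg_Quot_def)
  have "abelian_group Q"
  proof (rule abelian_groupI)
    show "\<exists>y\<in>carrier Q. y \<oplus>\<^bsub>Q\<^esub> x = \<zero>\<^bsub>Q\<^esub>" if "x \<in> carrier Q" for x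
      using that QR.l_neg unfolding eqs by blast
  qed (simp_all add: eqs QR.a_assoc, simp add: QR.a_comm)
  moreover have "monoid Q"
    by (rule monoidI) (simp_all add: eqs QR.m_assoc)
  ultimately show ?thesis
    by (rule ringI) (simp_all add: eqs QR.l_distr QR.r_distr)
qed

lemma Q_assoc_algebra: "assoc_algebra K Q"
proof -
  interpret QR: ring Q by (rule Q_ring)
  have "module K Q"
    by (rule moduleI[OF K.cring_axioms QR.abelian_group_axioms])
       (auto simp: Q_carrier Q_smult Q_ops smult_l_distr smult_r_distr smult_assoc1)
  moreover have "assoc_algebra_axioms K Q"
    by unfold_locales (auto simp: Q_carrier Q_smult Q_ops smult_mult_left smult_mult_right)
  ultimately show ?thesis
    by (simp add: assoc_algebra_def Q_ring K.field_axioms)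
qed

lemma proj_alg_hom: "proj \<in> alg_hom K A Q"
  by (rule alg_homI[OF lin_mapsI]) (auto simp: Q_carrier Q_smult Q_ops)

end

section \<open>Algebras given by generators and relations\<close>

lemma free_monoid_monoid: "monoid (free_monoid L)"
  by (rule monoidI) (auto simp: free_monoid_def)

lemma free_monoid_alg: "field K \<Longrightarrow> monoid_alg K (free_monoid L)"
  by (simp add: monoid_alg_def free_monoid_monoid)

lemma (in monoid) foldr_mult_closed:
  "\<lbrakk>\<gamma> \<in> L \<rightarrow> carrier G; set w \<subseteq> L\<rbrakk> \<Longrightarrow> foldr (\<lambda>x a. \<gamma> x \<otimes> a) w \<one> \<in> carrier G"
  by (induction w) auto

lemma (in monoid) foldr_mult_append:
  "\<lbrakk>\<gamma> \<in> L \<rightarrow> carrier G; set u \<subseteq> L; set v \<subseteq> L\<rbrakk> \<Longrightarrow>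
    foldr (\<lambda>x a. \<gamma> x \<otimes> a) (u @ v) \<one> = foldr (\<lambda>x a. \<gamma> x \<otimes> a) u \<one> \<otimes> foldr (\<lambda>x a. \<gamma> x \<otimes> a) v \<one>"
  by (induction u) (auto simp: m_assoc foldr_mult_closed Pi_iff simp del: foldr_append)

lemma (in monoid) foldr_mult_replicate:
  "\<gamma> x \<in> carrier G \<Longrightarrow> foldr (\<lambda>x a. \<gamma> x \<otimes> a) (replicate k x) \<one> = \<gamma> x [^] k"
proof (induction k)
  case (Suc k)
  then show ?case
    \<comment> \<open>\<open>foldr\<close> attaches the new factor on the left, whereas a successor
      power is defined with the new factor on the right.\<close>
    using nat_pow_Suc2[of "\<gamma> x" k] by simp
qed simp

lemma free_eval_alg_hom:
  assumes A: "assoc_algebra K A" and \<gamma>: "\<gamma> \<in> L \<rightarrow> carrier A"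
  shows "free_eval K A \<gamma> \<in> alg_hom K (free_algebra K L) A"
proof -
  interpret A: assoc_algebra K A by fact
  interpret F: monoid_alg K "free_monoid L"
    by (rule free_monoid_alg) unfold_locales
  show ?thesis
    unfolding free_eval_def
    by (rule F.lin_ext_alg_hom[OF A])
       (auto simp: free_monoid_def subset_iff A.A.foldr_mult_append[OF \<gamma>]
         intro!: A.A.foldr_mult_closed[OF \<gamma>] simp del: foldr_append)
qed

lemma free_eval_basis:
  assumes A: "assoc_algebra K A" and \<gamma>: "\<gamma> \<in> L \<rightarrow> carrier A" and w: "w \<in> lists L"
  shows "free_eval K A \<gamma> (basis_elem K w) = foldr (\<lambda>x a. \<gamma> x \<otimes>\<^bsub>A\<^esub> a) w \<one>\<^bsub>A\<^esub>"
proof -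
  interpret A: assoc_algebra K A by fact
  interpret F: monoid_alg K "free_monoid L"
    by (rule free_monoid_alg) unfold_locales
  show ?thesis
    unfolding free_eval_def
    by (rule F.lin_ext_basis[OF assoc_algebra_module[OF A]])
       (use w in \<open>auto simp: free_monoid_def intro!: A.A.foldr_mult_closed[OF \<gamma>]\<close>)
qed

lemma presented_by_relation:
  assumes A: "assoc_algebra K A" and p: "presented_by K A L rels \<gamma>"
    and rels: "rels \<subseteq> carrier (free_algebra K L)" and r: "r \<in> rels"
  shows "free_eval K A \<gamma> r = \<zero>\<^bsub>A\<^esub>"
proof -
  interpret A: assoc_algebra K A by fact
  interpret F: monoid_alg K "free_monoid L"
    by (rule free_monoid_alg) unfold_locales
  have "r \<in> a_kernel (free_algebra K L) A (free_eval K A \<gamma>)"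
    using p r F.F.A.genideal_self[OF rels] by (auto simp: presented_by_def)
  then show ?thesis
    by (simp add: a_kernel_def')
qed

text \<open>The kernel of evaluation at \<gamma> is the ideal generated by the relations. Evaluation
  at \<delta> has an ideal as its kernel and kills the relations, hence kills that ideal, and so it
  factors through \<open>A\<close>.\<close>

lemma presented_by_hom:
  assumes A: "assoc_algebra K A" and p: "presented_by K A L rels \<gamma>"
    and rels: "rels \<subseteq> carrier (free_algebra K L)"
    and B: "assoc_algebra K B" and \<delta>: "\<delta> \<in> L \<rightarrow> carrier B"
    and rels0: "\<And>r. r \<in> rels \<Longrightarrow> free_eval K B \<delta> r = \<zero>\<^bsub>B\<^esub>"
  obtains \<theta> where "\<theta> \<in> alg_hom K A B" "\<And>x. x \<in> L \<Longrightarrow> \<theta> (\<gamma> x) = \<delta> x"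
proof -
  interpret A: assoc_algebra K A by fact
  interpret B: assoc_algebra K B by fact
  interpret F: monoid_alg K "free_monoid L"
    by (rule free_monoid_alg) unfold_locales
  let ?F = "free_algebra K L"
  have \<gamma>: "\<gamma> \<in> L \<rightarrow> carrier A" using p by (simp add: presented_by_def)
  let ?g = "free_eval K A \<gamma>" and ?d = "free_eval K B \<delta>"
  note g = free_eval_alg_hom[OF A \<gamma>] and d = free_eval_alg_hom[OF B \<delta>]
  have surj: "?g ` carrier ?F = carrier A" using p by (simp add: presented_by_def)
  have ker: "?d f = \<zero>\<^bsub>B\<^esub>" if "f \<in> carrier ?F" "?g f = \<zero>\<^bsub>A\<^esub>" for f
  proof -
    have "genideal ?F rels \<subseteq> a_kernel ?F B ?d"
      by (rule F.F.A.genideal_minimal[OF alg_hom_a_kernel_ideal[OF d F.F_assoc_algebra B]])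
         (use rels rels0 in \<open>auto simp: a_kernel_def'\<close>)
    moreover have "f \<in> a_kernel ?F A ?g"
      using that by (simp add: a_kernel_def')
    ultimately show ?thesis
      using p by (auto simp: presented_by_def a_kernel_def')
  qed
  have wd: "?d f = ?d h" if "f \<in> carrier ?F" "h \<in> carrier ?F" "?g f = ?g h" for f h
  proof -
    have "?g (f \<ominus>\<^bsub>?F\<^esub> h) = \<zero>\<^bsub>A\<^esub>"
      using that alg_hom_closed[OF g]
      by (simp add: lin_maps_minus[OF alg_hom_lin_maps[OF g] F.F_module A.module_axioms] A.A.r_right_minus_eq)
    then have "?d f \<ominus>\<^bsub>B\<^esub> ?d h = \<zero>\<^bsub>B\<^esub>"
      using ker[of "f \<ominus>\<^bsub>?F\<^esub> h"] that
      by (simp add: lin_maps_minus[OF alg_hom_lin_maps[OF d] F.F_module B.module_axioms])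
    then show ?thesis
      using that alg_hom_closed[OF d] by simp
  qed
  \<comment> \<open>An arbitrary preimage in the free algebra is chosen; by \<open>wd\<close> the
    value does not depend on the choice.\<close>
  define \<theta> where "\<theta> a = ?d (SOME f. f \<in> carrier ?F \<and> ?g f = a)" for a
  have \<theta>: "\<theta> (?g f) = ?d f" if "f \<in> carrier ?F" for f
  proof -
    let ?h = "SOME h. h \<in> carrier ?F \<and> ?g h = ?g f"
    have "?h \<in> carrier ?F \<and> ?g ?h = ?g f"
      by (rule someI[where x = f]) (simp add: that)
    then show ?thesis
      unfolding \<theta>_def using wd that by blast
  qed
  have "\<theta> \<in> alg_hom K A B"
  proof (rule alg_homI[OF lin_mapsI])
    show "\<theta> x \<in> carrier B" if "x \<in> carrier A" for x
      using that alg_hom_closed[OF d] by (auto simp: surj[symmetric] \<theta>)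
    show "\<theta> (x \<oplus>\<^bsub>A\<^esub> y) = \<theta> x \<oplus>\<^bsub>B\<^esub> \<theta> y" if "x \<in> carrier A" "y \<in> carrier A" for x y
      using that
      by (auto simp: surj[symmetric] \<theta> alg_hom_add[OF g, symmetric] alg_hom_add[OF d])
    show "\<theta> (x \<otimes>\<^bsub>A\<^esub> y) = \<theta> x \<otimes>\<^bsub>B\<^esub> \<theta> y" if "x \<in> carrier A" "y \<in> carrier A" for x y
      using that
      by (auto simp: surj[symmetric] \<theta> alg_hom_mult[OF g, symmetric] alg_hom_mult[OF d])
    show "\<theta> (c \<odot>\<^bsub>A\<^esub> x) = c \<odot>\<^bsub>B\<^esub> \<theta> x" if "c \<in> carrier K" "x \<in> carrier A" for c x
      using that
      by (auto simp: surj[symmetric] \<theta> alg_hom_smult[OF g, symmetric] alg_hom_smult[OF d])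
    show "\<theta> \<one>\<^bsub>A\<^esub> = \<one>\<^bsub>B\<^esub>"
      using \<theta>[of "\<one>\<^bsub>?F\<^esub>"] by (simp add: alg_hom_one[OF g] alg_hom_one[OF d])
  qed
  moreover have "\<theta> (\<gamma> x) = \<delta> x" if "x \<in> L" for x
  proof -
    have "basis_elem K [x] \<in> carrier ?F"
      using that by (intro F.basis_closed) (simp add: free_monoid_def)
    moreover have "?g (basis_elem K [x]) = \<gamma> x" "?d (basis_elem K [x]) = \<delta> x"
      using that \<gamma> \<delta> free_eval_basis[OF A \<gamma>, of "[x]"] free_eval_basis[OF B \<delta>, of "[x]"]
      by (auto simp: Pi_iff)
    ultimately show ?thesis
      using \<theta> by metis
  qed
  ultimately show thesis
    by (rule that)
qed

text \<open>\<open>A\<close> is spanned by the values of words, and \<open>foldr\<close> builds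
  these from the unit by left multiplication with generators. Zero is covered as the scalar 0 times
  the unit.\<close>

lemma presented_by_induct [consumes 3, case_names one gen add smult]:
  assumes A: "assoc_algebra K A" and p: "presented_by K A L rels \<gamma>" and x: "x \<in> carrier A"
    and one: "P \<one>\<^bsub>A\<^esub>"
    and gen: "\<And>l x. \<lbrakk>l \<in> L; \<gamma> l \<in> carrier A; x \<in> carrier A; P x\<rbrakk> \<Longrightarrow> P (\<gamma> l \<otimes>\<^bsub>A\<^esub> x)"
    and add: "\<And>x y. \<lbrakk>x \<in> carrier A; y \<in> carrier A; P x; P y\<rbrakk> \<Longrightarrow> P (x \<oplus>\<^bsub>A\<^esub> y)"
    and smult: "\<And>c x. \<lbrakk>c \<in> carrier K; x \<in> carrier A; P x\<rbrakk> \<Longrightarrow> P (c \<odot>\<^bsub>A\<^esub> x)"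
  shows "P x"
proof -
  interpret A: assoc_algebra K A by fact
  interpret F: monoid_alg K "free_monoid L"
    by (rule free_monoid_alg) unfold_locales
  have \<gamma>: "\<gamma> \<in> L \<rightarrow> carrier A" using p by (simp add: presented_by_def)
  note g = free_eval_alg_hom[OF A \<gamma>]
  obtain f where f: "f \<in> carrier (free_algebra K L)" and x: "x = free_eval K A \<gamma> f"
    using p x unfolding presented_by_def by blast
  show ?thesis
    unfolding x using f
  proof (induction f rule: F.F_induct)
    case zero
    have "P (\<zero>\<^bsub>K\<^esub> \<odot>\<^bsub>A\<^esub> \<one>\<^bsub>A\<^esub>)"
      by (rule smult) (auto intro: one)
    then show ?case
      by (simp add: alg_hom_zero[OF g F.F_assoc_algebra A])
  next
    case (basis w)
    then have w: "w \<in> lists L" by (simp add: free_monoid_def)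
    then have "P (foldr (\<lambda>x a. \<gamma> x \<otimes>\<^bsub>A\<^esub> a) w \<one>\<^bsub>A\<^esub>)"
      by (induction w) (use \<gamma> in \<open>auto intro!: one gen A.A.foldr_mult_closed[OF \<gamma>]\<close>)
    then show ?case
      by (simp add: free_eval_basis[OF A \<gamma> w])
  qed (simp_all add: alg_hom_add[OF g] alg_hom_smult[OF g] add smult alg_hom_closed[OF g])
qed

lemma presented_by_hom_eqI:
  assumes A: "assoc_algebra K A" and p: "presented_by K A L rels \<gamma>"
    and B: "assoc_algebra K B"
    and f: "f \<in> alg_hom K A B" and h: "h \<in> alg_hom K A B"
    and eq: "\<And>l. l \<in> L \<Longrightarrow> f (\<gamma> l) = h (\<gamma> l)"
    and x: "x \<in> carrier A"
  shows "f x = h x"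
  using A p x
  by (induction x rule: presented_by_induct)
     (simp_all add: alg_hom_one[OF f] alg_hom_one[OF h] alg_hom_mult[OF f] alg_hom_mult[OF h]
       alg_hom_add[OF f] alg_hom_add[OF h] alg_hom_smult[OF f] alg_hom_smult[OF h] eq)

section \<open>Corner algebras\<close>

locale central_idempotent = assoc_algebra K A for K (structure) and A (structure) and e +
  assumes e_closed: "e \<in> carrier A"
    and e_idem: "e \<otimes>\<^bsub>A\<^esub> e = e"
    and e_central: "x \<in> carrier A \<Longrightarrow> e \<otimes>\<^bsub>A\<^esub> x = x \<otimes>\<^bsub>A\<^esub> e"
begin

abbreviation C where "C \<equiv> corner_alg A e"

text \<open>By idempotence, right multiplication by \<open>e\<close> fixes exactly the elements of
  \<open>Ae\<close>. This turns membership in the corner into an equation that simplification can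
  use.\<close>

lemma C_carrier: "carrier C = {x \<in> carrier A. x \<otimes>\<^bsub>A\<^esub> e = x}"
proof -
  have "x \<otimes>\<^bsub>A\<^esub> e \<otimes>\<^bsub>A\<^esub> e = x \<otimes>\<^bsub>A\<^esub> e" if "x \<in> carrier A" for x
    using that e_closed by (simp add: A.m_assoc e_idem)
  then show ?thesis
    using e_closed by (auto simp: corner_alg_def image_iff) (metis)
qed

lemma C_simps:
  "x \<oplus>\<^bsub>C\<^esub> y = x \<oplus>\<^bsub>A\<^esub> y" "x \<otimes>\<^bsub>C\<^esub> y = x \<otimes>\<^bsub>A\<^esub> y" "\<zero>\<^bsub>C\<^esub> = \<zero>\<^bsub>A\<^esub>" "\<one>\<^bsub>C\<^esub> = e"
  "c \<odot>\<^bsub>C\<^esub> x = c \<odot>\<^bsub>A\<^esub> x"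
  by (simp_all add: corner_alg_def)

lemma mult_e_closed: "x \<in> carrier A \<Longrightarrow> x \<otimes>\<^bsub>A\<^esub> e \<in> carrier C"
  by (simp add: corner_alg_def)

lemma mult_e_mult_e:
  "\<lbrakk>x \<in> carrier A; y \<in> carrier A\<rbrakk> \<Longrightarrow> (x \<otimes>\<^bsub>A\<^esub> e) \<otimes>\<^bsub>A\<^esub> (y \<otimes>\<^bsub>A\<^esub> e) = (x \<otimes>\<^bsub>A\<^esub> y) \<otimes>\<^bsub>A\<^esub> e"
  using e_closed e_central[of y] by (metis A.m_assoc A.m_closed e_idem)

lemma C_assoc_algebra: "assoc_algebra K C"
proof -
  have "abelian_group C"
  proof (rule abelian_groupI)
    fix x assume x: "x \<in> carrier C"
    then have "(\<ominus>\<^bsub>A\<^esub> x) \<otimes>\<^bsub>A\<^esub> e = \<ominus>\<^bsub>A\<^esub> x" "x \<in> carrier A"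
      using e_closed by (auto simp: C_carrier A.l_minus)
    then show "\<exists>y\<in>carrier C. y \<oplus>\<^bsub>C\<^esub> x = \<zero>\<^bsub>C\<^esub>"
      by (intro bexI[of _ "\<ominus>\<^bsub>A\<^esub> x"]) (auto simp: C_carrier C_simps M.l_neg)
  qed (use e_closed in \<open>auto simp: C_carrier C_simps A.l_distr M.a_ac\<close>)
  moreover have "monoid C"
    by (rule monoidI)
       (use e_closed in \<open>auto simp: C_carrier C_simps A.m_assoc e_idem e_central\<close>)
  ultimately have "ring C"
    by (rule ringI) (auto simp: C_carrier C_simps A.l_distr A.r_distr)
  moreover have "module K C"
    by (rule moduleI[OF K.cring_axioms \<open>abelian_group C\<close>])
       (use e_closed in \<open>auto simp: C_carrier C_simps smult_l_distr smult_r_distr smult_assoc1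
         smult_mult_left\<close>)
  moreover have "assoc_algebra_axioms K C"
    by unfold_locales (auto simp: C_carrier C_simps smult_mult_left smult_mult_right)
  ultimately show ?thesis
    by (simp add: assoc_algebra_def K.field_axioms)
qed

text \<open>Since \<open>e\<close> is a central idempotent, (x e)(y e) = (x y) e. The map preserves
  units because the corner has unit \<open>e\<close>.\<close>

lemma mult_e_alg_hom: "(\<lambda>x. x \<otimes>\<^bsub>A\<^esub> e) \<in> alg_hom K A C"
  by (rule alg_homI[OF lin_mapsI])
     (auto simp: mult_e_closed C_simps A.l_distr e_closed smult_mult_left mult_e_mult_e)

lemma C_nat_pow:
  assumes "x \<in> carrier A"
  shows "(x \<otimes>\<^bsub>A\<^esub> e) [^]\<^bsub>C\<^esub> (k::nat) = (x [^]\<^bsub>A\<^esub> k) \<otimes>\<^bsub>A\<^esub> e"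
proof (induction k)
  \<comment> \<open>In the corner the zeroth power is \<open>e\<close>, which matches the factor
    \<open>e\<close> on the right-hand side.\<close>
  case 0
  then show ?case using e_closed by (simp add: C_simps)
next
  case (Suc k)
  have "(x \<otimes>\<^bsub>A\<^esub> e) [^]\<^bsub>C\<^esub> Suc k = (x \<otimes>\<^bsub>A\<^esub> e) [^]\<^bsub>C\<^esub> k \<otimes>\<^bsub>A\<^esub> (x \<otimes>\<^bsub>A\<^esub> e)"
    by (simp add: C_simps)
  then show ?case
    using assms by (simp add: Suc mult_e_mult_e)
qed

text \<open>From (1 - e) e = 0 one inclusion follows; conversely x e = 0 gives x = x (1 - e). In
  this form the ideal is the kernel of multiplication by \<open>e\<close>, ready to be compared with
  the kernel of \<psi>.\<close>

lemma annihilator_eq: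
  "(\<lambda>x. x \<otimes>\<^bsub>A\<^esub> (\<one>\<^bsub>A\<^esub> \<ominus>\<^bsub>A\<^esub> e)) ` carrier A = {x \<in> carrier A. x \<otimes>\<^bsub>A\<^esub> e = \<zero>\<^bsub>A\<^esub>}" (is "?L = ?R")
proof
  have [simp]: "(\<one>\<^bsub>A\<^esub> \<ominus>\<^bsub>A\<^esub> e) \<otimes>\<^bsub>A\<^esub> e = \<zero>\<^bsub>A\<^esub>"
    using e_closed e_idem by (simp add: M.minus_eq A.l_distr A.l_minus M.r_neg)
  show "?L \<subseteq> ?R"
    using e_closed by (auto simp: A.m_assoc)
  show "?R \<subseteq> ?L"
  proof
    fix x assume "x \<in> ?R"
    then have "x \<in> carrier A" "x = x \<otimes>\<^bsub>A\<^esub> (\<one>\<^bsub>A\<^esub> \<ominus>\<^bsub>A\<^esub> e)"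
      using e_closed by (auto simp: M.minus_eq A.r_distr A.r_minus)
    then show "x \<in> ?L" by blast
  qed
qed

end

section \<open>Bilinear maps and tensor products\<close>

definition bilin_maps ::
  "('k, 'l) ring_scheme \<Rightarrow> ('k, 'a, 'm) module_scheme \<Rightarrow> ('k, 'b, 'n) module_scheme
    \<Rightarrow> ('k, 'c, 'p) module_scheme \<Rightarrow> ('a \<Rightarrow> 'b \<Rightarrow> 'c) set"
where
  "bilin_maps K A B V =
    {\<beta>. (\<forall>a\<in>carrier A. (\<lambda>b. \<beta> a b) \<in> lin_maps K B V) \<and>
         (\<forall>b\<in>carrier B. (\<lambda>a. \<beta> a b) \<in> lin_maps K A V)}"

lemma bilin_mapsI:
  assumes "\<And>a. a \<in> carrier A \<Longrightarrow> (\<lambda>b. \<beta> a b) \<in> lin_maps K B V"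
    and "\<And>b. b \<in> carrier B \<Longrightarrow> (\<lambda>a. \<beta> a b) \<in> lin_maps K A V"
  shows "\<beta> \<in> bilin_maps K A B V"
  using assms by (simp add: bilin_maps_def)

lemma bilin_maps_lin1: "\<lbrakk>\<beta> \<in> bilin_maps K A B V; b \<in> carrier B\<rbrakk> \<Longrightarrow> (\<lambda>a. \<beta> a b) \<in> lin_maps K A V"
  and bilin_maps_lin2: "\<lbrakk>\<beta> \<in> bilin_maps K A B V; a \<in> carrier A\<rbrakk> \<Longrightarrow> (\<lambda>b. \<beta> a b) \<in> lin_maps K B V"
  by (simp_all add: bilin_maps_def)

lemma bilin_maps_closed:
  "\<lbrakk>\<beta> \<in> bilin_maps K A B V; a \<in> carrier A; b \<in> carrier B\<rbrakk> \<Longrightarrow> \<beta> a b \<in> carrier V"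
  by (rule lin_maps_closed[OF bilin_maps_lin2])

lemma bilin_maps_add1:
    "\<lbrakk>\<beta> \<in> bilin_maps K A B V; a \<in> carrier A; a' \<in> carrier A; b \<in> carrier B\<rbrakk>
      \<Longrightarrow> \<beta> (a \<oplus>\<^bsub>A\<^esub> a') b = \<beta> a b \<oplus>\<^bsub>V\<^esub> \<beta> a' b"
  and bilin_maps_add2:
    "\<lbrakk>\<beta> \<in> bilin_maps K A B V; a \<in> carrier A; b \<in> carrier B; b' \<in> carrier B\<rbrakk>
      \<Longrightarrow> \<beta> a (b \<oplus>\<^bsub>B\<^esub> b') = \<beta> a b \<oplus>\<^bsub>V\<^esub> \<beta> a b'"
  and bilin_maps_smult1:
    "\<lbrakk>\<beta> \<in> bilin_maps K A B V; c \<in> carrier K; a \<in> carrier A; b \<in> carrier B\<rbrakk>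
      \<Longrightarrow> \<beta> (c \<odot>\<^bsub>A\<^esub> a) b = c \<odot>\<^bsub>V\<^esub> \<beta> a b"
  and bilin_maps_smult2:
    "\<lbrakk>\<beta> \<in> bilin_maps K A B V; c \<in> carrier K; a \<in> carrier A; b \<in> carrier B\<rbrakk>
      \<Longrightarrow> \<beta> a (c \<odot>\<^bsub>B\<^esub> b) = c \<odot>\<^bsub>V\<^esub> \<beta> a b"
  by (auto simp: bilin_maps_def lin_maps_def)

lemma bilin_maps_comp:
  assumes "\<beta> \<in> bilin_maps K A B V" "p \<in> lin_maps K A' A" "q \<in> lin_maps K B' B"
  shows "(\<lambda>a b. \<beta> (p a) (q b)) \<in> bilin_maps K A' B' V"
  using assms by (auto simp: bilin_maps_def lin_maps_def Pi_iff)

lemma bilin_maps_flip: "\<beta> \<in> bilin_maps K A B V \<Longrightarrow> (\<lambda>b a. \<beta> a b) \<in> bilin_maps K B A V"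
  by (simp add: bilin_maps_def)

lemma (in assoc_algebra) mult_bilin: "(\<lambda>a b. a \<otimes>\<^bsub>A\<^esub> b) \<in> bilin_maps K A A A"
  by (intro bilin_mapsI lin_mapsI)
     (simp_all add: A.l_distr A.r_distr smult_mult_left smult_mult_right)

locale alg_pair = A: assoc_algebra K A + B: assoc_algebra K B
  for K (structure) and A :: "('k, 'a, 'm) module_scheme" and B :: "('k, 'b, 'n) module_scheme"

sublocale alg_pair \<subseteq> P: monoid_alg K "A \<times>\<times> B"
  by (simp add: monoid_alg_def A.K.field_axioms DirProd_monoid A.A.monoid_axioms B.A.monoid_axioms)

context alg_pair
begin

abbreviation FP where "FP \<equiv> monoid_algebra K (A \<times>\<times> B)"
abbreviation d where "d a b \<equiv> basis_elem K (a, b)"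
abbreviation lext where "lext V \<beta> \<equiv> lin_ext K V (\<lambda>(a, b). \<beta> a b)"

lemma d_closed: "\<lbrakk>a \<in> carrier A; b \<in> carrier B\<rbrakk> \<Longrightarrow> d a b \<in> carrier FP"
  by (rule P.basis_closed) simp

lemma bilinear_relations_closed: "bilinear_relations K A B \<subseteq> carrier FP"
  by (auto simp: bilinear_relations_def Let_def d_closed)

lemma lext_lin_maps: "\<lbrakk>module K V; \<beta> \<in> bilin_maps K A B V\<rbrakk> \<Longrightarrow> lext V \<beta> \<in> lin_maps K FP V"
  by (rule P.lin_ext_lin_maps) (auto simp: bilin_maps_closed)

lemma lext_d:
  "\<lbrakk>module K V; \<beta> \<in> bilin_maps K A B V; a \<in> carrier A; b \<in> carrier B\<rbrakk> \<Longrightarrow> lext V \<beta> (d a b) = \<beta> a b"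
  by (subst P.lin_ext_basis) (auto simp: bilin_maps_closed)

lemma lext_relation:
  assumes V: "module K V" and \<beta>: "\<beta> \<in> bilin_maps K A B V" and r: "r \<in> bilinear_relations K A B"
  shows "lext V \<beta> r = \<zero>\<^bsub>V\<^esub>"
proof -
  interpret V: module K V by fact
  have *: "x \<ominus>\<^bsub>V\<^esub> x = \<zero>\<^bsub>V\<^esub>" if "x \<in> carrier V" for x
    using that by (simp add: V.minus_eq V.M.r_neg)
  note lin = lext_lin_maps[OF V \<beta>]
  show ?thesis
    using r
    by (auto simp: bilinear_relations_def Let_def d_closed lin_maps_minus[OF lin P.F_module V]
          lin_maps_add[OF lin] lin_maps_smult[OF lin] lext_d[OF V \<beta>] bilin_maps_closed[OF \<beta>]
          bilin_maps_add1[OF \<beta>] bilin_maps_add2[OF \<beta>] bilin_maps_smult1[OF \<beta>] bilin_maps_smult2[OF \<beta>] *)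
qed

text \<open>
  The elements annihilated by all bilinear maps into \<open>V\<close> form an ideal, because composing a
  bilinear map with translations in \<open>A\<close> and \<open>B\<close> gives a bilinear map.
\<close>

lemma lext_tensor_ideal:
  assumes V: "module K V" and \<beta>: "\<beta> \<in> bilin_maps K A B V" and f: "f \<in> tensor_ideal K A B"
  shows "lext V \<beta> f = \<zero>\<^bsub>V\<^esub>"
proof -
  interpret V: module K V by fact
  note lin = lext_lin_maps[OF V]
  define I where "I = {f \<in> carrier FP. \<forall>\<beta>\<in>bilin_maps K A B V. lext V \<beta> f = \<zero>\<^bsub>V\<^esub>}"
  have add: "f \<oplus>\<^bsub>FP\<^esub> h \<in> I" if "f \<in> I" "h \<in> I" for f h
    using that unfolding I_def by (auto simp: lin_maps_add[OF lin])
  have smult: "c \<odot>\<^bsub>FP\<^esub> f \<in> I" if "c \<in> carrier K" "f \<in> I" for c f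
    using that unfolding I_def by (auto simp: lin_maps_smult[OF lin])
  have zero: "\<zero>\<^bsub>FP\<^esub> \<in> I"
    unfolding I_def by (auto simp: lin_maps_zero[OF lin P.F_module V])
  have I_sub: "I \<subseteq> carrier FP" by (auto simp: I_def)
  have translate: "d a b \<otimes>\<^bsub>FP\<^esub> f \<in> I \<and> f \<otimes>\<^bsub>FP\<^esub> d a b \<in> I"
    if a: "a \<in> carrier A" and b: "b \<in> carrier B" and f: "f \<in> I" for a b f
  proof -
    have "lext V \<beta> (d a b \<otimes>\<^bsub>FP\<^esub> f) = \<zero>\<^bsub>V\<^esub> \<and> lext V \<beta> (f \<otimes>\<^bsub>FP\<^esub> d a b) = \<zero>\<^bsub>V\<^esub>"
      if \<beta>: "\<beta> \<in> bilin_maps K A B V" for \<beta>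
    proof
      have l: "(\<lambda>x y. \<beta> (a \<otimes>\<^bsub>A\<^esub> x) (b \<otimes>\<^bsub>B\<^esub> y)) \<in> bilin_maps K A B V"
        by (rule bilin_maps_comp[OF \<beta> bilin_maps_lin2[OF A.mult_bilin a] bilin_maps_lin2[OF B.mult_bilin b]])
      have r: "(\<lambda>x y. \<beta> (x \<otimes>\<^bsub>A\<^esub> a) (y \<otimes>\<^bsub>B\<^esub> b)) \<in> bilin_maps K A B V"
        by (rule bilin_maps_comp[OF \<beta> bilin_maps_lin1[OF A.mult_bilin a] bilin_maps_lin1[OF B.mult_bilin b]])
      have "lext V \<beta> (d a b \<otimes>\<^bsub>FP\<^esub> f) = lext V (\<lambda>x y. \<beta> (a \<otimes>\<^bsub>A\<^esub> x) (b \<otimes>\<^bsub>B\<^esub> y)) f"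
        by (rule P.F_lin_maps_eqI[OF V lin_maps_comp[OF bilin_maps_lin2[OF P.F.mult_bilin d_closed] lin[OF \<beta>]] lin[OF l]])
           (use a b f I_sub in \<open>auto simp: P.basis_mult lext_d[OF V] \<beta> l\<close>)
      then show "lext V \<beta> (d a b \<otimes>\<^bsub>FP\<^esub> f) = \<zero>\<^bsub>V\<^esub>"
        using l f by (simp add: I_def)
      have "lext V \<beta> (f \<otimes>\<^bsub>FP\<^esub> d a b) = lext V (\<lambda>x y. \<beta> (x \<otimes>\<^bsub>A\<^esub> a) (y \<otimes>\<^bsub>B\<^esub> b)) f"
        by (rule P.F_lin_maps_eqI[OF V lin_maps_comp[OF bilin_maps_lin1[OF P.F.mult_bilin d_closed] lin[OF \<beta>]] lin[OF r]])
           (use a b f I_sub in \<open>auto simp: P.basis_mult lext_d[OF V] \<beta> r\<close>)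
      then show "lext V \<beta> (f \<otimes>\<^bsub>FP\<^esub> d a b) = \<zero>\<^bsub>V\<^esub>"
        using r f by (simp add: I_def)
    qed
    then show ?thesis
      using a b f I_sub by (auto simp: I_def d_closed)
  qed
  have mult: "x \<otimes>\<^bsub>FP\<^esub> f \<in> I \<and> f \<otimes>\<^bsub>FP\<^esub> x \<in> I" if x: "x \<in> carrier FP" and f: "f \<in> I" for x f
  proof -
    have fc: "f \<in> carrier FP" using f I_sub by blast
    show ?thesis
      using x
    proof (induction x rule: P.F_induct)
      case (basis w)
      then show ?case using translate f by (cases w) auto
    qed (simp_all add: fc zero add smult P.F_l_null P.F_r_null P.F_l_distr P.F_r_distr P.F_smult_mult)
  qed
  have "ideal I FP"
  proof (rule idealI)
    show "ring FP" by (rule P.F.A.ring_axioms)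
    show "subgroup I (add_monoid FP)"
    proof (rule group.subgroupI[OF P.F.a_group])
      show "inv\<^bsub>add_monoid FP\<^esub> f \<in> I" if "f \<in> I" for f
      proof -
        have "\<ominus>\<^bsub>FP\<^esub> f = (\<ominus> \<one>) \<odot>\<^bsub>FP\<^esub> f"
          using that I_sub by (auto simp: P.F.smult_l_minus)
        then show ?thesis
          using smult[OF _ that] by (simp add: a_inv_def)
      qed
    qed (use I_sub zero add in auto)
  qed (use mult in auto)
  moreover have "bilinear_relations K A B \<subseteq> I"
    using bilinear_relations_closed lext_relation[OF V] by (auto simp: I_def)
  ultimately have "tensor_ideal K A B \<subseteq> I"
    unfolding tensor_ideal_def by (rule P.F.A.genideal_minimal)
  then show ?thesis
    using f \<beta> by (auto simp: I_def)
qed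

lemma tensor_ideal_ideal: "ideal (tensor_ideal K A B) FP"
  unfolding tensor_ideal_def by (rule P.F.A.genideal_ideal[OF bilinear_relations_closed])

end

sublocale alg_pair \<subseteq> TI: alg_ideal K "monoid_algebra K (A \<times>\<times> B)" "tensor_ideal K A B"
  by (simp add: alg_ideal_def P.F_assoc_algebra tensor_ideal_ideal)

section \<open>The tensor product algebra and its universal property\<close>

context alg_pair
begin

abbreviation T where "T \<equiv> tensor K A B"
abbreviation pure where "pure \<equiv> pure_tensor K A B"

lemma tensor_assoc_algebra: "assoc_algebra K T"
  unfolding tensor_def by (rule TI.Q_assoc_algebra)

sublocale T: assoc_algebra K T by (rule tensor_assoc_algebra)

lemma proj_alg_hom: "TI.proj \<in> alg_hom K FP T"
  unfolding tensor_def by (rule TI.proj_alg_hom)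

lemma pure_closed: "\<lbrakk>a \<in> carrier A; b \<in> carrier B\<rbrakk> \<Longrightarrow> pure a b \<in> carrier T"
  unfolding pure_tensor_def by (intro alg_hom_closed[OF proj_alg_hom] d_closed)

text \<open>Each of the four families of relations consists of the differences of the two sides of
  one bilinearity law, so each law holds between cosets.\<close>

lemma pure_bilin: "pure \<in> bilin_maps K A B T"
proof -
  note p = proj_alg_hom
  have rel: "TI.proj x = TI.proj y"
    if "x \<ominus>\<^bsub>FP\<^esub> y \<in> bilinear_relations K A B" "x \<in> carrier FP" "y \<in> carrier FP" for x y
    using that(1) P.F.A.genideal_self[OF bilinear_relations_closed]
    unfolding TI.proj_eq_iff[OF that(2,3)] by (auto simp: tensor_ideal_def)
  show ?thesis
  proof (intro bilin_mapsI lin_mapsI)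
    fix a b assume a: "a \<in> carrier A" and b: "b \<in> carrier B"
    show "pure a b \<in> carrier T" "pure a b \<in> carrier T" by (rule pure_closed[OF a b])+
    show "pure a (b \<oplus>\<^bsub>B\<^esub> b') = pure a b \<oplus>\<^bsub>T\<^esub> pure a b'" if b': "b' \<in> carrier B" for b'
      unfolding pure_tensor_def alg_hom_add[OF p d_closed[OF a b] d_closed[OF a b'], symmetric]
      by (rule rel) (use a b b' in \<open>auto simp: bilinear_relations_def Let_def d_closed\<close>)
    show "pure (a \<oplus>\<^bsub>A\<^esub> a') b = pure a b \<oplus>\<^bsub>T\<^esub> pure a' b" if a': "a' \<in> carrier A" for a'
      unfolding pure_tensor_def alg_hom_add[OF p d_closed[OF a b] d_closed[OF a' b], symmetric]
      by (rule rel) (use a b a' in \<open>auto simp: bilinear_relations_def Let_def d_closed\<close>)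
    fix c assume c: "c \<in> carrier K"
    show "pure a (c \<odot>\<^bsub>B\<^esub> b) = c \<odot>\<^bsub>T\<^esub> pure a b"
      unfolding pure_tensor_def alg_hom_smult[OF p c d_closed[OF a b], symmetric]
      by (rule rel) (use a b c in \<open>auto simp: bilinear_relations_def Let_def d_closed\<close>)
    show "pure (c \<odot>\<^bsub>A\<^esub> a) b = c \<odot>\<^bsub>T\<^esub> pure a b"
      unfolding pure_tensor_def alg_hom_smult[OF p c d_closed[OF a b], symmetric]
      by (rule rel) (use a b c in \<open>auto simp: bilinear_relations_def Let_def d_closed\<close>)
  qed
qed

lemma pure_mult:
  "\<lbrakk>a \<in> carrier A; b \<in> carrier B; a' \<in> carrier A; b' \<in> carrier B\<rbrakk> \<Longrightarrow>
    pure a b \<otimes>\<^bsub>T\<^esub> pure a' b' = pure (a \<otimes>\<^bsub>A\<^esub> a') (b \<otimes>\<^bsub>B\<^esub> b')"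
  unfolding pure_tensor_def
  by (simp add: alg_hom_mult[OF proj_alg_hom, symmetric] d_closed P.basis_mult)

lemma tensor_one: "\<one>\<^bsub>T\<^esub> = pure \<one>\<^bsub>A\<^esub> \<one>\<^bsub>B\<^esub>"
  unfolding pure_tensor_def alg_hom_one[OF proj_alg_hom, symmetric] P.F_one by simp

text \<open>Pure tensors span, being the cosets of the basis elements of the monoid algebra; zero is
  the scalar 0 times a pure tensor.\<close>

lemma tensor_induct [consumes 1, case_names pure add smult]:
  assumes t: "t \<in> carrier T"
    and pure: "\<And>a b. \<lbrakk>a \<in> carrier A; b \<in> carrier B\<rbrakk> \<Longrightarrow> P (pure a b)"
    and add: "\<And>t u. \<lbrakk>t \<in> carrier T; u \<in> carrier T; P t; P u\<rbrakk> \<Longrightarrow> P (t \<oplus>\<^bsub>T\<^esub> u)"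
    and smult: "\<And>c t. \<lbrakk>c \<in> carrier K; t \<in> carrier T; P t\<rbrakk> \<Longrightarrow> P (c \<odot>\<^bsub>T\<^esub> t)"
  shows "P t"
proof -
  note p = proj_alg_hom
  obtain f where f: "f \<in> carrier FP" and t: "t = TI.proj f"
    using t by (auto simp: tensor_def TI.Q_carrier)
  show ?thesis
    unfolding t using f
  proof (induction f rule: P.F_induct)
    case zero
    have "P (\<zero> \<odot>\<^bsub>T\<^esub> pure \<one>\<^bsub>A\<^esub> \<one>\<^bsub>B\<^esub>)"
      by (intro smult pure pure_closed) auto
    then show ?case
      by (simp add: pure_closed alg_hom_zero[OF p P.F_assoc_algebra tensor_assoc_algebra])
  next
    case (basis w)
    then show ?case
      using pure[of "fst w" "snd w"] by (auto simp: pure_tensor_def)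
  qed (simp_all add: alg_hom_add[OF p] alg_hom_smult[OF p] add smult alg_hom_closed[OF p])
qed

lemma tensor_lin_maps_eqI:
  assumes p: "p \<in> lin_maps K T V" and q: "q \<in> lin_maps K T V"
    and eq: "\<And>a b. \<lbrakk>a \<in> carrier A; b \<in> carrier B\<rbrakk> \<Longrightarrow> p (pure a b) = q (pure a b)"
    and t: "t \<in> carrier T"
  shows "p t = q t"
  using t
  by (induction t rule: tensor_induct)
     (simp_all add: eq lin_maps_add[OF p] lin_maps_smult[OF p] lin_maps_add[OF q] lin_maps_smult[OF q])

text \<open>Two representatives of a coset differ by an element of the tensor ideal, on which the
  linear extension vanishes by \<open>lext_tensor_ideal\<close>. This makes the
  \<open>the_elem\<close> in \<open>tensor_lift\<close> meaningful.\<close>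

lemma tensor_lift_proj:
  assumes V: "module K V" and \<beta>: "\<beta> \<in> bilin_maps K A B V" and f: "f \<in> carrier FP"
  shows "tensor_lift K V \<beta> (TI.proj f) = lext V \<beta> f"
proof -
  interpret V: module K V by fact
  note lin = lext_lin_maps[OF V \<beta>]
  have "lext V \<beta> u = lext V \<beta> f" if "u \<in> carrier FP" "TI.proj u = TI.proj f" for u
  proof -
    have "lext V \<beta> u \<oplus>\<^bsub>V\<^esub> (\<ominus>\<^bsub>V\<^esub> lext V \<beta> f) = \<zero>\<^bsub>V\<^esub>"
      using that f lext_tensor_ideal[OF V \<beta>, of "u \<ominus>\<^bsub>FP\<^esub> f"]
      by (simp add: TI.proj_eq_iff lin_maps_minus[OF lin P.F_module V] V.minus_eq)
    then show ?thesis
      using that(1) f lin_maps_closed[OF lin] V.minus_equality V.minus_minus by (metis V.a_inv_closed)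
  qed
  then show ?thesis
    unfolding tensor_lift_def by (rule TI.the_elem_image_proj[OF f])
qed

lemma tensor_lift_pure:
  "\<lbrakk>module K V; \<beta> \<in> bilin_maps K A B V; a \<in> carrier A; b \<in> carrier B\<rbrakk>
    \<Longrightarrow> tensor_lift K V \<beta> (pure a b) = \<beta> a b"
  by (simp add: pure_tensor_def tensor_lift_proj d_closed lext_d)

lemma tensor_lift_lin_maps:
  assumes V: "module K V" and \<beta>: "\<beta> \<in> bilin_maps K A B V"
  shows "tensor_lift K V \<beta> \<in> lin_maps K T V"
proof -
  note lin = lext_lin_maps[OF V \<beta>] and p = proj_alg_hom and tl = tensor_lift_proj[OF V \<beta>]
  have T: "carrier T = TI.proj ` carrier FP"
    by (simp add: tensor_def TI.Q_carrier)
  show ?thesis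
    by (rule lin_mapsI)
       (auto simp: T tl lin_maps_closed[OF lin] lin_maps_add[OF lin] lin_maps_smult[OF lin]
         alg_hom_add[OF p, symmetric] alg_hom_smult[OF p, symmetric])
qed

text \<open>Multiplicativity is bilinear in the two tensors, so pure tensors suffice. It is needed
  to see that \<psi> \<otimes> \<psi> is an algebra map, which allows coproducts to be compared on
  generators.\<close>

lemma tensor_lift_alg_hom:
  assumes C: "assoc_algebra K C" and \<beta>: "\<beta> \<in> bilin_maps K A B C"
    and mult: "\<And>a b a' b'. \<lbrakk>a \<in> carrier A; b \<in> carrier B; a' \<in> carrier A; b' \<in> carrier B\<rbrakk>
      \<Longrightarrow> \<beta> (a \<otimes>\<^bsub>A\<^esub> a') (b \<otimes>\<^bsub>B\<^esub> b') = \<beta> a b \<otimes>\<^bsub>C\<^esub> \<beta> a' b'"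
    and one: "\<beta> \<one>\<^bsub>A\<^esub> \<one>\<^bsub>B\<^esub> = \<one>\<^bsub>C\<^esub>"
  shows "tensor_lift K C \<beta> \<in> alg_hom K T C"
proof -
  interpret C: assoc_algebra K C by fact
  note m = assoc_algebra_module[OF C]
  note lin = tensor_lift_lin_maps[OF m \<beta>] and pu = tensor_lift_pure[OF m \<beta>]
  let ?l = "tensor_lift K C \<beta>"
  note cl = lin_maps_closed[OF lin]
  show ?thesis
  proof (rule alg_homI[OF lin])
    fix t u assume t: "t \<in> carrier T" and u: "u \<in> carrier T"
    show "?l (t \<otimes>\<^bsub>T\<^esub> u) = ?l t \<otimes>\<^bsub>C\<^esub> ?l u"
      using t
    proof (induction t rule: tensor_induct)
      case (pure a b)
      note ab = pure
      show ?case
        using u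
      proof (induction u rule: tensor_induct)
        case (pure a' b')
        then show ?case using ab by (simp add: pure_mult pu mult)
      qed (simp_all add: ab pure_closed cl T.A.r_distr C.A.r_distr T.smult_mult_right C.smult_mult_right
             lin_maps_add[OF lin] lin_maps_smult[OF lin])
    qed (simp_all add: u cl T.A.l_distr C.A.l_distr T.smult_mult_left C.smult_mult_left
             lin_maps_add[OF lin] lin_maps_smult[OF lin])
  qed (simp add: tensor_one pu one)
qed

text \<open>The associator is a lift whose values are themselves lifts. The outer lift makes sense
  only if the inner one is bilinear in the tensor and the remaining argument, which is what a
  trilinear \<beta> provides here.\<close>

lemma tensor_lift_bilin:
  assumes V: "module K V"
    and \<beta>: "\<And>c. c \<in> carrier C \<Longrightarrow> \<beta> c \<in> bilin_maps K A B V"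
    and lin: "\<And>a b. \<lbrakk>a \<in> carrier A; b \<in> carrier B\<rbrakk> \<Longrightarrow> (\<lambda>c. \<beta> c a b) \<in> lin_maps K C V"
    and C: "module K C"
  shows "(\<lambda>t c. tensor_lift K V (\<beta> c) t) \<in> bilin_maps K T C V"
proof (rule bilin_mapsI)
  interpret V: module K V by fact
  interpret C: module K C by fact
  note tl = tensor_lift_lin_maps[OF V \<beta>] and pu = tensor_lift_pure[OF V \<beta>]
  show "(\<lambda>t. tensor_lift K V (\<beta> c) t) \<in> lin_maps K T V" if "c \<in> carrier C" for c
    using tl[OF that] .
  show "(\<lambda>c. tensor_lift K V (\<beta> c) t) \<in> lin_maps K C V" if t: "t \<in> carrier T" for t
  proof (rule lin_mapsI)
    fix c assume c: "c \<in> carrier C"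
    show "tensor_lift K V (\<beta> c) t \<in> carrier V"
      by (rule lin_maps_closed[OF tl[OF c] t])
    show "tensor_lift K V (\<beta> (c \<oplus>\<^bsub>C\<^esub> c')) t = tensor_lift K V (\<beta> c) t \<oplus>\<^bsub>V\<^esub> tensor_lift K V (\<beta> c') t"
      if c': "c' \<in> carrier C" for c'
      using t
    proof (induction t rule: tensor_induct)
      case (pure a b)
      then show ?case
        using c c' lin_maps_add[OF lin[OF pure]] by (simp add: pu)
    qed (simp_all add: c c' lin_maps_add[OF tl] lin_maps_smult[OF tl] lin_maps_closed[OF tl]
           V.smult_r_distr V.M.a_ac)
    show "tensor_lift K V (\<beta> (k \<odot>\<^bsub>C\<^esub> c)) t = k \<odot>\<^bsub>V\<^esub> tensor_lift K V (\<beta> c) t"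
      if k: "k \<in> carrier K" for k
      using t
    proof (induction t rule: tensor_induct)
      case (pure a b)
      then show ?case
        using c k lin_maps_smult[OF lin[OF pure]] by (simp add: pu)
    next
      \<comment> \<open>Two scalars have to change places here, by commutativity of
        \<open>K\<close>.\<close>
      case (smult k' t)
      then show ?case
        using c k by (simp add: lin_maps_smult[OF tl] lin_maps_closed[OF tl]
          V.smult_assoc1[symmetric] A.K.m_comm)
    qed (simp_all add: c k lin_maps_add[OF tl] lin_maps_closed[OF tl] V.smult_r_distr)
  qed
qed

lemma pure_comp_bilin:
  assumes "\<phi> \<in> lin_maps K A' A" "\<psi> \<in> lin_maps K B' B"
  shows "(\<lambda>a b. pure (\<phi> a) (\<psi> b)) \<in> bilin_maps K A' B' T"
  by (rule bilin_maps_comp[OF pure_bilin assms])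

end

lemma alg_pairI: "\<lbrakk>assoc_algebra K A; assoc_algebra K B\<rbrakk> \<Longrightarrow> alg_pair K A B"
  by (simp add: alg_pair_def)

lemma tensor_algebra: "alg_pair K A B \<Longrightarrow> assoc_algebra K (tensor K A B)"
  by (rule alg_pair.tensor_assoc_algebra)

lemma tensor_module: "alg_pair K A B \<Longrightarrow> module K (tensor K A B)"
  by (rule assoc_algebra_module[OF tensor_algebra])

section \<open>Functoriality of the tensor product\<close>

context
  fixes K A' B' A B
  assumes pairs: "alg_pair K A' B'" "alg_pair K A B"
begin

lemma tensor_map_lin_maps:
  assumes "\<phi> \<in> lin_maps K A' A" "\<psi> \<in> lin_maps K B' B"
  shows "tensor_map K A B \<phi> \<psi> \<in> lin_maps K (tensor K A' B') (tensor K A B)"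
  unfolding tensor_map_def
  by (rule alg_pair.tensor_lift_lin_maps[OF pairs(1) tensor_module[OF pairs(2)]
        alg_pair.pure_comp_bilin[OF pairs(2) assms]])

lemma tensor_map_pure:
  assumes "\<phi> \<in> lin_maps K A' A" "\<psi> \<in> lin_maps K B' B"
    and "a \<in> carrier A'" "b \<in> carrier B'"
  shows "tensor_map K A B \<phi> \<psi> (pure_tensor K A' B' a b) = pure_tensor K A B (\<phi> a) (\<psi> b)"
  unfolding tensor_map_def
  by (rule alg_pair.tensor_lift_pure[OF pairs(1) tensor_module[OF pairs(2)]
        alg_pair.pure_comp_bilin[OF pairs(2) assms(1,2)] assms(3,4)])

lemma tensor_map_alg_hom:
  assumes \<phi>: "\<phi> \<in> alg_hom K A' A" and \<psi>: "\<psi> \<in> alg_hom K B' B"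
  shows "tensor_map K A B \<phi> \<psi> \<in> alg_hom K (tensor K A' B') (tensor K A B)"
  unfolding tensor_map_def
  by (rule alg_pair.tensor_lift_alg_hom[OF pairs(1) tensor_algebra[OF pairs(2)]
        alg_pair.pure_comp_bilin[OF pairs(2) alg_hom_lin_maps[OF \<phi>] alg_hom_lin_maps[OF \<psi>]]])
     (simp_all add: alg_hom_mult[OF \<phi>] alg_hom_mult[OF \<psi>] alg_hom_one[OF \<phi>] alg_hom_one[OF \<psi>]
       alg_pair.pure_mult[OF pairs(2)] alg_hom_closed[OF \<phi>] alg_hom_closed[OF \<psi>]
       alg_pair.tensor_one[OF pairs(2)])

end

section \<open>The associator\<close>

context
  fixes K A B C
  assumes AB: "alg_pair K A B" and C: "assoc_algebra K C"
begin

lemma tensor_triple_pairs: "alg_pair K (tensor K A B) C" "alg_pair K B C" "alg_pair K A (tensor K B C)"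
proof -
  have A: "assoc_algebra K A" and B: "assoc_algebra K B"
    using AB by (simp_all add: alg_pair_def)
  show "alg_pair K (tensor K A B) C"
    by (rule alg_pairI[OF tensor_algebra[OF AB] C])
  show BC: "alg_pair K B C"
    by (rule alg_pairI[OF B C])
  show "alg_pair K A (tensor K B C)"
    by (rule alg_pairI[OF A tensor_algebra[OF BC]])
qed

lemma tensor_triple_bilin:
  "c \<in> carrier C \<Longrightarrow> (\<lambda>a b. pure_tensor K A (tensor K B C) a (pure_tensor K B C b c))
    \<in> bilin_maps K A B (tensor K A (tensor K B C))"
  by (rule bilin_maps_comp[OF alg_pair.pure_bilin[OF tensor_triple_pairs(3)] lin_maps_id(2)
        bilin_maps_lin1[OF alg_pair.pure_bilin[OF tensor_triple_pairs(2)]]])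

lemma tensor_assoc_bilin:
  "(\<lambda>t c. tensor_lift K (tensor K A (tensor K B C))
      (\<lambda>a b. pure_tensor K A (tensor K B C) a (pure_tensor K B C b c)) t)
    \<in> bilin_maps K (tensor K A B) C (tensor K A (tensor K B C))"
  by (rule alg_pair.tensor_lift_bilin[OF AB tensor_module[OF tensor_triple_pairs(3)] tensor_triple_bilin
        lin_maps_comp[OF bilin_maps_lin2[OF alg_pair.pure_bilin[OF tensor_triple_pairs(2)]]
          bilin_maps_lin2[OF alg_pair.pure_bilin[OF tensor_triple_pairs(3)]]] assoc_algebra_module[OF C]])

lemma tensor_assoc_lin_maps:
  "tensor_assoc K A B C \<in> lin_maps K (tensor K (tensor K A B) C) (tensor K A (tensor K B C))"
  unfolding tensor_assoc_def Let_def
  by (rule alg_pair.tensor_lift_lin_maps[OF tensor_triple_pairs(1) tensor_module[OF tensor_triple_pairs(3)] tensor_assoc_bilin])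

lemma tensor_assoc_pure:
  assumes "a \<in> carrier A" "b \<in> carrier B" "c \<in> carrier C"
  shows "tensor_assoc K A B C (pure_tensor K (tensor K A B) C (pure_tensor K A B a b) c) =
    pure_tensor K A (tensor K B C) a (pure_tensor K B C b c)"
  unfolding tensor_assoc_def Let_def
    alg_pair.tensor_lift_pure[OF tensor_triple_pairs(1) tensor_module[OF tensor_triple_pairs(3)] tensor_assoc_bilin
      alg_pair.pure_closed[OF AB assms(1,2)] assms(3)]
  by (rule alg_pair.tensor_lift_pure[OF AB tensor_module[OF tensor_triple_pairs(3)] tensor_triple_bilin[OF assms(3)]
        assms(1,2)])

end

section \<open>Hopf algebras\<close>

lemma hopf_assoc_algebra: "hopf_algebra K H \<Longrightarrow> assoc_algebra K H"
  by (simp add: hopf_algebra_def)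

lemma hopf_alg_pair: "\<lbrakk>hopf_algebra K H; hopf_algebra K H'\<rbrakk> \<Longrightarrow> alg_pair K H H'"
  by (simp add: alg_pairI hopf_assoc_algebra)

lemma (in hopf_algebra) antipode_lin_maps: "antipode H \<in> lin_maps K H H"
  by (intro lin_mapsI antipode_closed antipode_add antipode_smult)

lemma (in hopf_algebra) counit_ops:
  "x \<in> carrier H \<Longrightarrow> counit H x \<in> carrier K"
  "\<lbrakk>x \<in> carrier H; y \<in> carrier H\<rbrakk> \<Longrightarrow> counit H (x \<otimes>\<^bsub>H\<^esub> y) = counit H x \<otimes> counit H y"
  "\<lbrakk>x \<in> carrier H; y \<in> carrier H\<rbrakk> \<Longrightarrow> counit H (x \<oplus>\<^bsub>H\<^esub> y) = counit H x \<oplus> counit H y"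
  "counit H \<one>\<^bsub>H\<^esub> = \<one>"
  using counit_hom by (auto simp: ring_hom_def)

lemma (in hopf_algebra) counit_bilin: "(\<lambda>a b. counit H a \<odot>\<^bsub>H\<^esub> b) \<in> bilin_maps K H H H"
  by (intro bilin_mapsI lin_mapsI)
     (simp_all add: counit_ops counit_smult smult_l_distr smult_r_distr smult_assoc1[symmetric] K.m_comm)

text \<open>The left and the right inverse of \<open>p\<close> in the convolution algebra coincide.\<close>

lemma (in hopf_algebra) convolution_inverse_unique:
  assumes B: "assoc_algebra K B"
    and f: "f \<in> lin_maps K H B" and p: "p \<in> lin_maps K H B" and h: "h \<in> lin_maps K H B"
    and fp: "\<And>x. x \<in> carrier H \<Longrightarrow>
      tensor_lift K B (\<lambda>a b. f a \<otimes>\<^bsub>B\<^esub> p b) (comult H x) = counit H x \<odot>\<^bsub>B\<^esub> \<one>\<^bsub>B\<^esub>"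
    and ph: "\<And>x. x \<in> carrier H \<Longrightarrow>
      tensor_lift K B (\<lambda>a b. p a \<otimes>\<^bsub>B\<^esub> h b) (comult H x) = counit H x \<odot>\<^bsub>B\<^esub> \<one>\<^bsub>B\<^esub>"
    and x: "x \<in> carrier H"
  shows "f x = h x"
proof -
  interpret B: assoc_algebra K B by fact
  note Bm = B.module_axioms and Hm = module_axioms
  let ?HH = "tensor K H H" and ?\<Delta> = "comult H"
  let ?P = "pure_tensor K H H"
  have HH: "alg_pair K H H" by (rule alg_pairI) unfold_locales
  have HHa: "assoc_algebra K ?HH" by (rule tensor_algebra[OF HH])
  have LHH: "alg_pair K ?HH H" by (rule alg_pairI[OF HHa]) unfold_locales
  have HHR: "alg_pair K H ?HH" by (rule alg_pairI[OF _ HHa]) unfold_locales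
  have \<Delta>: "?\<Delta> \<in> lin_maps K H ?HH" by (rule alg_hom_lin_maps[OF comult_hom])
  have fpb: "(\<lambda>a b. f a \<otimes>\<^bsub>B\<^esub> p b) \<in> bilin_maps K H H B"
    by (rule bilin_maps_comp[OF B.mult_bilin f p])
  have phb: "(\<lambda>a b. p a \<otimes>\<^bsub>B\<^esub> h b) \<in> bilin_maps K H H B"
    by (rule bilin_maps_comp[OF B.mult_bilin p h])
  \<comment> \<open>\<open>M1\<close> and \<open>M2\<close> after the comultiplication are the
    convolution products f * p and p * h.\<close>
  define M1 where "M1 = tensor_lift K B (\<lambda>a b. f a \<otimes>\<^bsub>B\<^esub> p b)"
  define M2 where "M2 = tensor_lift K B (\<lambda>a b. p a \<otimes>\<^bsub>B\<^esub> h b)"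
  have M1: "M1 \<in> lin_maps K ?HH B" and M2: "M2 \<in> lin_maps K ?HH B"
    unfolding M1_def M2_def
    by (rule alg_pair.tensor_lift_lin_maps[OF HH Bm fpb] alg_pair.tensor_lift_lin_maps[OF HH Bm phb])+
  have Lb: "(\<lambda>a t. f a \<otimes>\<^bsub>B\<^esub> M2 t) \<in> bilin_maps K H ?HH B"
    by (rule bilin_maps_comp[OF B.mult_bilin f M2])
  \<comment> \<open>\<open>L\<close> is the linear map a \<otimes> (b \<otimes> c) \<mapsto> f(a)
    p(b) h(c). Applied to the two sides of coassociativity at \<open>x\<close>, it yields
    \<open>h x\<close> and \<open>f x\<close>.\<close>
  define L where "L = tensor_lift K B (\<lambda>a t. f a \<otimes>\<^bsub>B\<^esub> M2 t)"
  have L: "L \<in> lin_maps K (tensor K H ?HH) B"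
    unfolding L_def by (rule alg_pair.tensor_lift_lin_maps[OF HHR Bm Lb])
  have L_pure: "L (pure_tensor K H ?HH a t) = f a \<otimes>\<^bsub>B\<^esub> M2 t"
    if "a \<in> carrier H" "t \<in> carrier ?HH" for a t
    unfolding L_def by (rule alg_pair.tensor_lift_pure[OF HHR Bm Lb that])
  have M2_pure: "M2 (?P a b) = p a \<otimes>\<^bsub>B\<^esub> h b" if "a \<in> carrier H" "b \<in> carrier H" for a b
    unfolding M2_def by (rule alg_pair.tensor_lift_pure[OF HH Bm phb that])
  have M1_pure: "M1 (?P a b) = f a \<otimes>\<^bsub>B\<^esub> p b" if "a \<in> carrier H" "b \<in> carrier H" for a b
    unfolding M1_def by (rule alg_pair.tensor_lift_pure[OF HH Bm fpb that])
  note cl = lin_maps_closed[OF f] lin_maps_closed[OF p] lin_maps_closed[OF h]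
    lin_maps_closed[OF M1] lin_maps_closed[OF M2] lin_maps_closed[OF \<Delta>] alg_pair.pure_closed[OF HH]
  have La: "(\<lambda>t. L (tensor_assoc K H H H t)) \<in> lin_maps K (tensor K ?HH H) B"
    by (rule lin_maps_comp[OF tensor_assoc_lin_maps[OF HH] L]) unfold_locales
  \<comment> \<open>Associativity in \<open>B\<close> regroups f(a) (p(b) h(c)) so that the first
    two factors form \<open>M1\<close>.\<close>
  have La_pure: "L (tensor_assoc K H H H (pure_tensor K ?HH H t c)) = M1 t \<otimes>\<^bsub>B\<^esub> h c"
    if t: "t \<in> carrier ?HH" and c: "c \<in> carrier H" for t c
  proof (rule alg_pair.tensor_lin_maps_eqI[OF HH _ _ _ t])
    show "(\<lambda>t. L (tensor_assoc K H H H (pure_tensor K ?HH H t c))) \<in> lin_maps K ?HH B"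
      by (rule lin_maps_comp[OF bilin_maps_lin1[OF alg_pair.pure_bilin[OF LHH] c] La])
    show "(\<lambda>t. M1 t \<otimes>\<^bsub>B\<^esub> h c) \<in> lin_maps K ?HH B"
      by (rule lin_maps_comp[OF M1 bilin_maps_lin1[OF B.mult_bilin cl(3)[OF c]]])
    fix a b assume "a \<in> carrier H" "b \<in> carrier H"
    then show "L (tensor_assoc K H H H (pure_tensor K ?HH H (?P a b) c)) = M1 (?P a b) \<otimes>\<^bsub>B\<^esub> h c"
      using c by (simp add: tensor_assoc_pure[OF HH assoc_algebra_axioms] L_pure M2_pure M1_pure cl B.A.m_assoc)
  qed
  note id = lin_maps_id(1)[of K H]
  \<comment> \<open>With the left tensor factor comultiplied, f * p collapses to the counit, and the
    counit law leaves only \<open>h\<close>.\<close>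
  have "L (tensor_assoc K H H H (tensor_map K ?HH H ?\<Delta> id t)) =
      h (tensor_lift K H (\<lambda>a b. counit H a \<odot>\<^bsub>H\<^esub> b) t)" if t: "t \<in> carrier ?HH" for t
  proof (rule alg_pair.tensor_lin_maps_eqI[OF HH _ _ _ t])
    show "(\<lambda>t. L (tensor_assoc K H H H (tensor_map K ?HH H ?\<Delta> id t))) \<in> lin_maps K ?HH B"
      by (rule lin_maps_comp[OF tensor_map_lin_maps[OF HH LHH \<Delta> id] La])
    show "(\<lambda>t. h (tensor_lift K H (\<lambda>a b. counit H a \<odot>\<^bsub>H\<^esub> b) t)) \<in> lin_maps K ?HH B"
      by (rule lin_maps_comp[OF alg_pair.tensor_lift_lin_maps[OF HH Hm counit_bilin] h])
    fix a b assume a: "a \<in> carrier H" and b: "b \<in> carrier H"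
    have "L (tensor_assoc K H H H (tensor_map K ?HH H ?\<Delta> id (?P a b))) = M1 (?\<Delta> a) \<otimes>\<^bsub>B\<^esub> h b"
      using a b by (simp add: tensor_map_pure[OF HH LHH \<Delta> id] La_pure cl)
    then show "L (tensor_assoc K H H H (tensor_map K ?HH H ?\<Delta> id (?P a b))) =
        h (tensor_lift K H (\<lambda>a b. counit H a \<odot>\<^bsub>H\<^esub> b) (?P a b))"
      using a b by (simp add: alg_pair.tensor_lift_pure[OF HH Hm counit_bilin] fp[folded M1_def] cl
        counit_ops B.smult_mult_left lin_maps_smult[OF h])
  qed
  then have "L (tensor_assoc K H H H (tensor_map K ?HH H ?\<Delta> id (?\<Delta> x))) = h x"
    using x by (simp add: cl counit_left)
  \<comment> \<open>With the right tensor factor comultiplied, p * h collapses to the counit, and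
    the counit law leaves only \<open>f\<close>.\<close>
  moreover have "L (tensor_map K H ?HH id ?\<Delta> t) =
      f (tensor_lift K H (\<lambda>a b. counit H b \<odot>\<^bsub>H\<^esub> a) t)" if t: "t \<in> carrier ?HH" for t
  proof (rule alg_pair.tensor_lin_maps_eqI[OF HH _ _ _ t])
    note cb = bilin_maps_flip[OF counit_bilin]
    show "(\<lambda>t. L (tensor_map K H ?HH id ?\<Delta> t)) \<in> lin_maps K ?HH B"
      by (rule lin_maps_comp[OF tensor_map_lin_maps[OF HH HHR id \<Delta>] L])
    show "(\<lambda>t. f (tensor_lift K H (\<lambda>a b. counit H b \<odot>\<^bsub>H\<^esub> a) t)) \<in> lin_maps K ?HH B"
      by (rule lin_maps_comp[OF alg_pair.tensor_lift_lin_maps[OF HH Hm cb] f])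
    fix a b assume a: "a \<in> carrier H" and b: "b \<in> carrier H"
    have "L (tensor_map K H ?HH id ?\<Delta> (?P a b)) = f a \<otimes>\<^bsub>B\<^esub> M2 (?\<Delta> b)"
      using a b by (simp add: tensor_map_pure[OF HH HHR id \<Delta>] L_pure cl)
    then show "L (tensor_map K H ?HH id ?\<Delta> (?P a b)) =
        f (tensor_lift K H (\<lambda>a b. counit H b \<odot>\<^bsub>H\<^esub> a) (?P a b))"
      using a b by (simp add: alg_pair.tensor_lift_pure[OF HH Hm cb] ph[folded M2_def] cl
        counit_ops B.smult_mult_right lin_maps_smult[OF f])
  qed
  then have "L (tensor_map K H ?HH id ?\<Delta> (?\<Delta> x)) = f x"
    using x by (simp add: cl counit_right)
  ultimately show ?thesis
    using coassoc[OF x] by simp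
qed

section \<open>Bialgebra maps and antipodes\<close>

definition bialg_hom ::
  "('k, 'l) ring_scheme \<Rightarrow> ('k, 'a, 'm) hopf_scheme \<Rightarrow> ('k, 'b, 'n) hopf_scheme \<Rightarrow> ('a \<Rightarrow> 'b) set"
where
  "bialg_hom K A B =
    {\<phi> \<in> alg_hom K A B. \<forall>x\<in>carrier A.
        comult B (\<phi> x) = tensor_map K B B \<phi> \<phi> (comult A x) \<and> counit B (\<phi> x) = counit A x}"

text \<open>With respect to convolution, \<psi> S is a left inverse of \<psi>, because \<psi> is
  multiplicative and S is the antipode of \<open>H\<close>; S' \<psi> is a right inverse, because
  \<psi> preserves coproduct and counit and S' is the antipode of \<open>H'\<close>. So the two
  agree.\<close>

lemma bialg_hom_antipode:
  assumes H: "hopf_algebra K H" and H': "hopf_algebra K H'"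
    and \<psi>: "\<psi> \<in> bialg_hom K H H'" and x: "x \<in> carrier H"
  shows "\<psi> (antipode H x) = antipode H' (\<psi> x)"
proof -
  interpret H: hopf_algebra K H by fact
  interpret H': hopf_algebra K H' by fact
  have hom: "\<psi> \<in> alg_hom K H H'"
    and \<Delta>: "\<And>x. x \<in> carrier H \<Longrightarrow> tensor_map K H' H' \<psi> \<psi> (comult H x) = comult H' (\<psi> x)"
    and \<epsilon>: "\<And>x. x \<in> carrier H \<Longrightarrow> counit H' (\<psi> x) = counit H x"
    using \<psi> by (auto simp: bialg_hom_def)
  note lin = alg_hom_lin_maps[OF hom]
  note HH = hopf_alg_pair[OF H H] and HH' = hopf_alg_pair[OF H' H']
  note S = H.antipode_lin_maps and S' = H'.antipode_lin_maps
  note m = H.module_axioms and m' = H'.module_axioms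
  have Hb: "(\<lambda>a b. antipode H a \<otimes>\<^bsub>H\<^esub> b) \<in> bilin_maps K H H H"
    by (rule bilin_maps_comp[OF H.mult_bilin S lin_maps_id(2)])
  have Hb': "(\<lambda>a b. a \<otimes>\<^bsub>H'\<^esub> antipode H' b) \<in> bilin_maps K H' H' H'"
    by (rule bilin_maps_comp[OF H'.mult_bilin lin_maps_id(2) S'])
  have b1: "(\<lambda>a b. \<psi> (antipode H a) \<otimes>\<^bsub>H'\<^esub> \<psi> b) \<in> bilin_maps K H H H'"
    by (rule bilin_maps_comp[OF H'.mult_bilin lin_maps_comp[OF S lin] lin])
  have b2: "(\<lambda>a b. \<psi> a \<otimes>\<^bsub>H'\<^esub> antipode H' (\<psi> b)) \<in> bilin_maps K H H H'"
    by (rule bilin_maps_comp[OF H'.mult_bilin lin lin_maps_comp[OF lin S']])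
  have \<Delta>cl: "comult H x \<in> carrier (tensor K H H)" if "x \<in> carrier H" for x
    by (rule alg_hom_closed[OF H.comult_hom that])
  show ?thesis
  proof (rule H.convolution_inverse_unique[OF _ lin_maps_comp[OF S lin] lin lin_maps_comp[OF lin S'] _ _ x])
    show "assoc_algebra K H'" by unfold_locales
    fix x assume x: "x \<in> carrier H"
    have "tensor_lift K H' (\<lambda>a b. \<psi> (antipode H a) \<otimes>\<^bsub>H'\<^esub> \<psi> b) t =
        \<psi> (tensor_lift K H (\<lambda>a b. antipode H a \<otimes>\<^bsub>H\<^esub> b) t)" if t: "t \<in> carrier (tensor K H H)" for t
      by (rule alg_pair.tensor_lin_maps_eqI[OF HH alg_pair.tensor_lift_lin_maps[OF HH m' b1]
            lin_maps_comp[OF alg_pair.tensor_lift_lin_maps[OF HH m Hb] lin] _ t])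
         (simp add: alg_pair.tensor_lift_pure[OF HH m' b1] alg_pair.tensor_lift_pure[OF HH m Hb]
           H.antipode_closed alg_hom_mult[OF hom])
    then show "tensor_lift K H' (\<lambda>a b. \<psi> (antipode H a) \<otimes>\<^bsub>H'\<^esub> \<psi> b) (comult H x) =
        counit H x \<odot>\<^bsub>H'\<^esub> \<one>\<^bsub>H'\<^esub>"
      using x by (simp add: \<Delta>cl H.antipode_left H.counit_ops alg_hom_smult[OF hom] alg_hom_one[OF hom])
    have "tensor_lift K H' (\<lambda>a b. \<psi> a \<otimes>\<^bsub>H'\<^esub> antipode H' (\<psi> b)) t =
        tensor_lift K H' (\<lambda>a b. a \<otimes>\<^bsub>H'\<^esub> antipode H' b) (tensor_map K H' H' \<psi> \<psi> t)"
      if t: "t \<in> carrier (tensor K H H)" for t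
      by (rule alg_pair.tensor_lin_maps_eqI[OF HH alg_pair.tensor_lift_lin_maps[OF HH m' b2]
            lin_maps_comp[OF tensor_map_lin_maps[OF HH HH' lin lin] alg_pair.tensor_lift_lin_maps[OF HH' m' Hb']] _ t])
         (simp add: alg_pair.tensor_lift_pure[OF HH m' b2] alg_pair.tensor_lift_pure[OF HH' m' Hb']
           tensor_map_pure[OF HH HH' lin lin] alg_hom_closed[OF hom])
    then show "tensor_lift K H' (\<lambda>a b. \<psi> a \<otimes>\<^bsub>H'\<^esub> antipode H' (\<psi> b)) (comult H x) =
        counit H x \<odot>\<^bsub>H'\<^esub> \<one>\<^bsub>H'\<^esub>"
      using x by (simp add: \<Delta>cl \<Delta> \<epsilon> H'.antipode_right alg_hom_closed[OF hom])
  qed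
qed

section \<open>Hopf quotients by the kernel of a bialgebra map\<close>

lemma hopf_Quot_simps:
  "carrier (hopf_Quot K H I) = carrier (alg_Quot H I)"
  "monoid.mult (hopf_Quot K H I) = monoid.mult (alg_Quot H I)"
  "one (hopf_Quot K H I) = one (alg_Quot H I)"
  "ring.zero (hopf_Quot K H I) = ring.zero (alg_Quot H I)"
  "ring.add (hopf_Quot K H I) = ring.add (alg_Quot H I)"
  "smult (hopf_Quot K H I) = smult (alg_Quot H I)"
  by (simp_all add: hopf_Quot_def Let_def)

text \<open>The comultiplication of \<open>hopf_Quot\<close> takes values in the tensor square of
  \<open>alg_Quot\<close>, while \<open>hopf_iso\<close> refers to the tensor square of
  \<open>hopf_Quot\<close> itself. The two agree because only the algebra fields enter.\<close>

lemma tensor_hopf_Quot: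
  "tensor K (hopf_Quot K H I) (hopf_Quot K H I) = tensor K (alg_Quot H I) (alg_Quot H I)"
  "pure_tensor K (hopf_Quot K H I) (hopf_Quot K H I) = pure_tensor K (alg_Quot H I) (alg_Quot H I)"
proof -
  have F: "monoid_algebra K (hopf_Quot K H I \<times>\<times> hopf_Quot K H I) = monoid_algebra K (alg_Quot H I \<times>\<times> alg_Quot H I)"
    by (simp add: monoid_algebra_def DirProd_def hopf_Quot_simps)
  have I: "tensor_ideal K (hopf_Quot K H I) (hopf_Quot K H I) = tensor_ideal K (alg_Quot H I) (alg_Quot H I)"
    by (simp add: tensor_ideal_def bilinear_relations_def F hopf_Quot_simps)
  show "tensor K (hopf_Quot K H I) (hopf_Quot K H I) = tensor K (alg_Quot H I) (alg_Quot H I)"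
    by (simp add: tensor_def F I)
  show "pure_tensor K (hopf_Quot K H I) (hopf_Quot K H I) = pure_tensor K (alg_Quot H I) (alg_Quot H I)"
    by (simp add: pure_tensor_def fun_eq_iff F I)
qed

lemma alg_iso_hopf_Quot: "alg_iso K A (hopf_Quot K H I) = alg_iso K A (alg_Quot H I)"
  by (simp add: alg_iso_def alg_hom_def ring_hom_def hopf_Quot_simps)

lemma tensor_map_hopf_Quot:
  "tensor_map K (hopf_Quot K H I) (hopf_Quot K H I) \<phi> \<psi> = tensor_map K (alg_Quot H I) (alg_Quot H I) \<phi> \<psi>"
  by (simp add: tensor_map_def tensor_hopf_Quot)

text \<open>First isomorphism theorem. The kernel is not assumed to be a Hopf ideal: the structure
  maps of \<open>H\<close> followed by the projection are shown to depend on \<psi> x only, which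
  gives their well-definedness on cosets.\<close>

lemma hopf_quotient_by_kernel:
  assumes H: "hopf_algebra K H" and H': "hopf_algebra K H'"
    and \<psi>: "\<psi> \<in> bialg_hom K H H'" and surj: "\<psi> ` carrier H = carrier H'"
    and I_def: "I = a_kernel H H' \<psi>"
  shows "\<exists>\<phi>. \<phi> \<in> hopf_iso K H' (hopf_Quot K H I)"
proof -
  interpret H: hopf_algebra K H by fact
  interpret H': hopf_algebra K H' by fact
  have hom: "\<psi> \<in> alg_hom K H H'"
    and \<Delta>: "\<And>x. x \<in> carrier H \<Longrightarrow> comult H' (\<psi> x) = tensor_map K H' H' \<psi> \<psi> (comult H x)"
    and \<epsilon>: "\<And>x. x \<in> carrier H \<Longrightarrow> counit H' (\<psi> x) = counit H x"
    using \<psi> by (auto simp: bialg_hom_def)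
  note cl = alg_hom_closed[OF hom] and lin = alg_hom_lin_maps[OF hom]
  note Ha = hopf_assoc_algebra[OF H] and Ha' = hopf_assoc_algebra[OF H']
  have I: "ideal I H"
    unfolding I_def by (rule alg_hom_a_kernel_ideal[OF hom Ha Ha'])
  interpret J: alg_ideal K H I
    using Ha I by (simp add: alg_ideal_def)
  let ?Q = "alg_Quot H I" and ?R = "hopf_Quot K H I"
  let ?\<pi> = "\<lambda>x. I +>\<^bsub>H\<^esub> x"
  have \<pi>_eq: "?\<pi> x = ?\<pi> y \<longleftrightarrow> \<psi> x = \<psi> y" if "x \<in> carrier H" "y \<in> carrier H" for x y
  proof -
    have "?\<pi> x = ?\<pi> y \<longleftrightarrow> x \<ominus>\<^bsub>H\<^esub> y \<in> a_kernel H H' \<psi>"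
      using J.proj_eq_iff[OF that] I_def by simp
    also have "\<dots> \<longleftrightarrow> \<psi> x \<ominus>\<^bsub>H'\<^esub> \<psi> y = \<zero>\<^bsub>H'\<^esub>"
      using that by (simp add: a_kernel_def' lin_maps_minus[OF lin H.module_axioms H'.module_axioms])
    also have "\<dots> \<longleftrightarrow> \<psi> x = \<psi> y"
      using that cl by simp
    finally show ?thesis .
  qed
  \<comment> \<open>\<phi> is the inverse of the map induced by \<psi>; by \<open>\<pi>_eq\<close>
    the coset does not depend on the chosen preimage.\<close>
  define \<phi> where "\<phi> b = ?\<pi> (SOME x. x \<in> carrier H \<and> \<psi> x = b)" for b
  have \<phi>: "\<phi> (\<psi> x) = ?\<pi> x" if x: "x \<in> carrier H" for x
  proof -
    let ?y = "SOME y. y \<in> carrier H \<and> \<psi> y = \<psi> x"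
    have "?y \<in> carrier H \<and> \<psi> ?y = \<psi> x"
      by (rule someI[of _ x]) (simp add: x)
    then show ?thesis
      unfolding \<phi>_def using \<pi>_eq x by blast
  qed
  note Qs = J.Q_ops J.Q_smult alg_hom_closed[OF J.proj_alg_hom]
  have \<phi>_hom: "\<phi> \<in> alg_hom K H' ?Q"
  proof (rule alg_homI[OF lin_mapsI])
    show "\<phi> x \<in> carrier ?Q" if "x \<in> carrier H'" for x
      using that by (auto simp: surj[symmetric] \<phi> Qs)
    show "\<phi> (x \<oplus>\<^bsub>H'\<^esub> y) = \<phi> x \<oplus>\<^bsub>?Q\<^esub> \<phi> y" if "x \<in> carrier H'" "y \<in> carrier H'" for x y
      using that by (auto simp: surj[symmetric] \<phi> Qs alg_hom_add[OF hom, symmetric])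
    show "\<phi> (x \<otimes>\<^bsub>H'\<^esub> y) = \<phi> x \<otimes>\<^bsub>?Q\<^esub> \<phi> y" if "x \<in> carrier H'" "y \<in> carrier H'" for x y
      using that by (auto simp: surj[symmetric] \<phi> Qs alg_hom_mult[OF hom, symmetric])
    show "\<phi> (c \<odot>\<^bsub>H'\<^esub> x) = c \<odot>\<^bsub>?Q\<^esub> \<phi> x" if "c \<in> carrier K" "x \<in> carrier H'" for c x
      using that by (auto simp: surj[symmetric] \<phi> Qs alg_hom_smult[OF hom, symmetric])
    show "\<phi> \<one>\<^bsub>H'\<^esub> = \<one>\<^bsub>?Q\<^esub>"
      using \<phi>[of "\<one>\<^bsub>H\<^esub>"] by (simp add: alg_hom_one[OF hom] J.Q_ops)
  qed
  have "bij_betw \<phi> (carrier H') (carrier ?Q)"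
    unfolding bij_betw_def
  proof
    show "inj_on \<phi> (carrier H')"
      unfolding surj[symmetric] by (auto simp: inj_on_def \<phi> \<pi>_eq)
    show "\<phi> ` carrier H' = carrier ?Q"
      unfolding surj[symmetric] J.Q_carrier image_image by (auto simp: \<phi>)
  qed
  then have iso: "\<phi> \<in> alg_iso K H' ?R"
    using \<phi>_hom by (simp add: alg_iso_hopf_Quot) (simp add: alg_iso_def)
  note HH = hopf_alg_pair[OF H H] and HH' = hopf_alg_pair[OF H' H']
    and QQ = alg_pairI[OF J.Q_assoc_algebra J.Q_assoc_algebra]
  note plin = alg_hom_lin_maps[OF J.proj_alg_hom] and flin = alg_hom_lin_maps[OF \<phi>_hom]
  \<comment> \<open>This is \<pi> = \<phi> \<psi> on both tensor factors. It serves twice: for the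
    well-definedness of the quotient comultiplication and for its compatibility with \<phi>.\<close>
  have comp: "tensor_map K ?Q ?Q ?\<pi> ?\<pi> t = tensor_map K ?Q ?Q \<phi> \<phi> (tensor_map K H' H' \<psi> \<psi> t)"
    if t: "t \<in> carrier (tensor K H H)" for t
    by (rule alg_pair.tensor_lin_maps_eqI[OF HH tensor_map_lin_maps[OF HH QQ plin plin]
          lin_maps_comp[OF tensor_map_lin_maps[OF HH HH' lin lin] tensor_map_lin_maps[OF HH' QQ flin flin]] _ t])
       (simp add: tensor_map_pure[OF HH QQ plin plin] tensor_map_pure[OF HH HH' lin lin]
         tensor_map_pure[OF HH' QQ flin flin] cl \<phi>)
  have \<Delta>\<pi>: "tensor_map K ?Q ?Q ?\<pi> ?\<pi> (comult H x) = tensor_map K ?Q ?Q \<phi> \<phi> (comult H' (\<psi> x))"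
    if "x \<in> carrier H" for x
    using that by (simp add: comp alg_hom_closed[OF H.comult_hom] \<Delta>)
  have "comult ?R (\<phi> b) = tensor_map K ?R ?R \<phi> \<phi> (comult H' b) \<and>
      counit ?R (\<phi> b) = counit H' b \<and> antipode ?R (\<phi> b) = \<phi> (antipode H' b)"
    if b: "b \<in> carrier H'" for b
  proof -
    obtain x where x: "x \<in> carrier H" and b: "b = \<psi> x"
      using b surj by auto
    have "comult ?R (?\<pi> x) = tensor_map K ?Q ?Q ?\<pi> ?\<pi> (comult H x)"
      unfolding hopf_Quot_def Let_def hopf.simps
      by (rule J.the_elem_image_proj[OF x]) (simp add: \<Delta>\<pi> x \<pi>_eq)
    moreover have "counit ?R (?\<pi> x) = counit H x"
      unfolding hopf_Quot_def Let_def hopf.simps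
      by (rule J.the_elem_image_proj[OF x]) (simp add: \<pi>_eq x \<epsilon>[symmetric])
    \<comment> \<open>The antipode descends because \<psi> (S x) = S' (\<psi> x) is determined by
      \<psi> x.\<close>
    moreover have "antipode ?R (?\<pi> x) = ?\<pi> (antipode H x)"
      unfolding hopf_Quot_def Let_def hopf.simps
      by (rule J.the_elem_image_proj[OF x, of "\<lambda>x. ?\<pi> (antipode H x)"])
         (simp add: \<pi>_eq x H.antipode_closed bialg_hom_antipode[OF H H' \<psi>])
    moreover have "\<phi> (antipode H' b) = ?\<pi> (antipode H x)"
      unfolding b by (simp add: x H.antipode_closed \<phi> bialg_hom_antipode[OF H H' \<psi>, symmetric])
    ultimately show ?thesis
      by (simp add: b \<phi> x \<Delta>\<pi> \<epsilon> tensor_map_hopf_Quot)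
  qed
  then have "\<phi> \<in> hopf_iso K H' ?R"
    using iso by (simp add: hopf_iso_def)
  then show ?thesis by blast
qed

section \<open>The Hopf algebras of a group datum\<close>

context
  fixes K :: "('k, 'l) ring_scheme" and G :: "('g, 'm) monoid_scheme"
    and \<chi> :: "'g \<Rightarrow> 'k" and g :: 'g and \<mu> :: 'k and n :: nat
  assumes K: "field K" and G: "group G" and \<chi>: "\<chi> \<in> carrier G \<rightarrow> carrier K"
    and g: "g \<in> carrier G" and \<mu>: "\<mu> \<in> carrier K" and n: "n = group.ord (units_of K) (\<chi> g)"
begin

lemma datum_relations_closed:
  "datum_relations K G \<chi> g \<mu> \<subseteq> carrier (free_algebra K (insert Skew (Elt ` carrier G)))"
proof -
  interpret G: group G by (rule G)
  interpret F: monoid_alg K "free_monoid (insert Skew (Elt ` carrier G))"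
    by (rule free_monoid_alg[OF K])
  have w: "basis_elem K w \<in> carrier (free_algebra K (insert Skew (Elt ` carrier G)))"
    if "set w \<subseteq> insert Skew (Elt ` carrier G)" for w
    using that by (intro F.basis_closed) (auto simp: free_monoid_def)
  have ws: "set (replicate k Skew) \<subseteq> insert Skew (Elt ` carrier G)" for k
    by auto
  have \<chi>': "\<chi> h \<in> carrier K" if "h \<in> carrier G" for h
    using that \<chi> by auto
  show ?thesis
    unfolding datum_relations_def Let_def
    by (auto intro!: F.F.M.minus_closed F.F.smult_closed F.F.A.one_closed w[OF ws] w \<mu> g \<chi>')
qed

text \<open>Evaluation is linear and every relation is a difference, so its vanishing is an equation
  between images of generators. One direction reads off the relations in a presented algebra, the
  other verifies them for a new target. The scalar \<mu> is left general to cover 1 for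
  \<open>H\<close> and 0 for \<open>Hbar\<close>.\<close>

lemma datum_relations_hold_iff:
  assumes A: "assoc_algebra K A" and \<gamma>: "\<gamma> \<in> insert Skew (Elt ` carrier G) \<rightarrow> carrier A"
  shows "(\<forall>r\<in>datum_relations K G \<chi> g \<mu>. free_eval K A \<gamma> r = \<zero>\<^bsub>A\<^esub>) \<longleftrightarrow>
    (\<forall>h\<in>carrier G. \<forall>h'\<in>carrier G. \<gamma> (Elt h) \<otimes>\<^bsub>A\<^esub> \<gamma> (Elt h') = \<gamma> (Elt (h \<otimes>\<^bsub>G\<^esub> h'))) \<and>
    \<gamma> (Elt \<one>\<^bsub>G\<^esub>) = \<one>\<^bsub>A\<^esub> \<and>
    \<gamma> Skew [^]\<^bsub>A\<^esub> n = \<mu> \<odot>\<^bsub>A\<^esub> (\<gamma> (Elt (g [^]\<^bsub>G\<^esub> n)) \<ominus>\<^bsub>A\<^esub> \<one>\<^bsub>A\<^esub>) \<and>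
    (\<forall>h\<in>carrier G. \<gamma> Skew \<otimes>\<^bsub>A\<^esub> \<gamma> (Elt h) = \<chi> h \<odot>\<^bsub>A\<^esub> (\<gamma> (Elt h) \<otimes>\<^bsub>A\<^esub> \<gamma> Skew))"
proof -
  let ?L = "insert Skew (Elt ` carrier G)"
  interpret G: group G by (rule G)
  interpret A: assoc_algebra K A by (rule A)
  interpret F: monoid_alg K "free_monoid ?L"
    by (rule free_monoid_alg[OF K])
  let ?F = "free_algebra K ?L" and ?w = "basis_elem K"
  note hom = free_eval_alg_hom[OF A \<gamma>] and ev = free_eval_basis[OF A \<gamma>]
  have w: "?w w \<in> carrier ?F" if "set w \<subseteq> ?L" for w
    using that by (intro F.basis_closed) (auto simp: free_monoid_def)
  have minus: "free_eval K A \<gamma> (a \<ominus>\<^bsub>?F\<^esub> b) = free_eval K A \<gamma> a \<ominus>\<^bsub>A\<^esub> free_eval K A \<gamma> b"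
    if "a \<in> carrier ?F" "b \<in> carrier ?F" for a b
    by (rule lin_maps_minus[OF alg_hom_lin_maps[OF hom] F.F_module A.module_axioms that])
  have \<gamma>_closed: "\<gamma> Skew \<in> carrier A" "\<And>h. h \<in> carrier G \<Longrightarrow> \<gamma> (Elt h) \<in> carrier A"
    using \<gamma> by auto
  have \<chi>_closed: "\<chi> h \<in> carrier K" if "h \<in> carrier G" for h
    using that \<chi> by auto
  have ev_Elt: "free_eval K A \<gamma> (?w [Elt h]) = \<gamma> (Elt h)" if "h \<in> carrier G" for h
    using that \<gamma>_closed ev[of "[Elt h]"] by simp
  have r1: "free_eval K A \<gamma> (?w [Elt h, Elt h'] \<ominus>\<^bsub>?F\<^esub> ?w [Elt (h \<otimes>\<^bsub>G\<^esub> h')]) = \<zero>\<^bsub>A\<^esub> \<longleftrightarrow>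
      \<gamma> (Elt h) \<otimes>\<^bsub>A\<^esub> \<gamma> (Elt h') = \<gamma> (Elt (h \<otimes>\<^bsub>G\<^esub> h'))" if "h \<in> carrier G" "h' \<in> carrier G" for h h'
    using that \<gamma>_closed ev[of "[Elt h, Elt h']"] by (simp add: minus w ev_Elt)
  have r2: "free_eval K A \<gamma> (?w [Elt \<one>\<^bsub>G\<^esub>] \<ominus>\<^bsub>?F\<^esub> \<one>\<^bsub>?F\<^esub>) = \<zero>\<^bsub>A\<^esub> \<longleftrightarrow> \<gamma> (Elt \<one>\<^bsub>G\<^esub>) = \<one>\<^bsub>A\<^esub>"
    using \<gamma>_closed by (simp add: minus w ev_Elt alg_hom_one[OF hom])
  have "free_eval K A \<gamma> (?w (replicate n Skew)) = foldr (\<lambda>x a. \<gamma> x \<otimes>\<^bsub>A\<^esub> a) (replicate n Skew) \<one>\<^bsub>A\<^esub>"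
    by (rule ev) auto
  then have "free_eval K A \<gamma> (?w (replicate n Skew)) = \<gamma> Skew [^]\<^bsub>A\<^esub> n"
    by (simp only: A.A.foldr_mult_replicate[of \<gamma> Skew, OF \<gamma>_closed(1)])
  then have r3: "free_eval K A \<gamma> (?w (replicate n Skew) \<ominus>\<^bsub>?F\<^esub>
        (\<mu> \<odot>\<^bsub>?F\<^esub> (?w [Elt (g [^]\<^bsub>G\<^esub> n)] \<ominus>\<^bsub>?F\<^esub> \<one>\<^bsub>?F\<^esub>))) = \<zero>\<^bsub>A\<^esub> \<longleftrightarrow>
      \<gamma> Skew [^]\<^bsub>A\<^esub> n = \<mu> \<odot>\<^bsub>A\<^esub> (\<gamma> (Elt (g [^]\<^bsub>G\<^esub> n)) \<ominus>\<^bsub>A\<^esub> \<one>\<^bsub>A\<^esub>)"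
    using \<gamma>_closed \<mu> g
    by (subst minus) (auto simp: w minus ev_Elt alg_hom_one[OF hom] alg_hom_smult[OF hom] set_replicate_conv_if)
  have r4: "free_eval K A \<gamma> (?w [Skew, Elt h] \<ominus>\<^bsub>?F\<^esub> (\<chi> h \<odot>\<^bsub>?F\<^esub> ?w [Elt h, Skew])) = \<zero>\<^bsub>A\<^esub> \<longleftrightarrow>
      \<gamma> Skew \<otimes>\<^bsub>A\<^esub> \<gamma> (Elt h) = \<chi> h \<odot>\<^bsub>A\<^esub> (\<gamma> (Elt h) \<otimes>\<^bsub>A\<^esub> \<gamma> Skew)" if "h \<in> carrier G" for h
    using that \<gamma>_closed \<chi>_closed ev[of "[Skew, Elt h]"] ev[of "[Elt h, Skew]"]
    by (simp add: minus w alg_hom_smult[OF hom])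
  show ?thesis
    unfolding datum_relations_def Let_def n[symmetric] ball_Un
    using r1 r2 r3 r4 by (simp add: Ball_def) blast
qed

end

text \<open>The parameter \<open>u\<close> names the generator \<open>g^n\<close> of
  \<open>N\<close>, so that \<open>N\<close>, \<open>e\<close> and the relation for
  \<open>y^n\<close> can all be treated through powers of one central element.\<close>

locale quotient_datum =
  fixes K :: "('k, 'l) ring_scheme"
    and G :: "('g, 'm) monoid_scheme"
    and \<chi> :: "'g \<Rightarrow> 'k" and g :: 'g and n r :: nat
    and N :: "'g set"
    and H :: "('k, 'a, 'u) hopf_scheme" and \<iota> :: "'g \<Rightarrow> 'a" and y e :: 'a
    and Hbar :: "('k, 'b, 'v) hopf_scheme" and \<iota>bar :: "'g set \<Rightarrow> 'b" and z :: 'b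
    and u :: 'g
  assumes K: "field K"
    and char_zero: "\<And>m::nat. m > 0 \<Longrightarrow> [m] \<cdot>\<^bsub>K\<^esub> \<one>\<^bsub>K\<^esub> \<noteq> \<zero>\<^bsub>K\<^esub>"
    and G: "group G" and finite_G: "finite (carrier G)"
    and \<chi>: "\<chi> \<in> hom G (units_of K)"
    and g: "g \<in> carrier G" and g_central: "\<And>h. h \<in> carrier G \<Longrightarrow> g \<otimes>\<^bsub>G\<^esub> h = h \<otimes>\<^bsub>G\<^esub> g"
    and n: "n = group.ord (units_of K) (\<chi> g)"
    and ord_g: "group.ord G g = n * r"
    and N_def: "N = (\<lambda>s. g [^]\<^bsub>G\<^esub> (s * n)) ` {..<r}"
    and H_datum: "datum_hopf_algebra K G \<chi> g \<one>\<^bsub>K\<^esub> H \<iota> y"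
    and Hbar_datum: "datum_hopf_algebra K (G Mod N) (induced_char \<chi>) (N #>\<^bsub>G\<^esub> g) \<zero>\<^bsub>K\<^esub> Hbar \<iota>bar z"
    and e_def: "e = inv\<^bsub>K\<^esub> ([r] \<cdot>\<^bsub>K\<^esub> \<one>\<^bsub>K\<^esub>) \<odot>\<^bsub>H\<^esub> (\<Oplus>\<^bsub>H\<^esub>s\<in>{..<r}. \<iota> (g [^]\<^bsub>G\<^esub> (s * n)))"
    and u_def: "u = g [^]\<^bsub>G\<^esub> n"
begin

sublocale K: field K by (rule K)
sublocale G: group G by (rule G)

section \<open>The group \<open>N\<close> and the induced character\<close>

lemma u_closed: "u \<in> carrier G"
  by (simp add: u_def g)

lemma u_pow: "g [^]\<^bsub>G\<^esub> (s * n) = u [^]\<^bsub>G\<^esub> s"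
  by (simp add: u_def G.nat_pow_pow g mult.commute)

text \<open>The order of \<open>g\<close> is nonzero by finiteness and equals n r. Positivity makes
  r invertible in \<open>K\<close> and permits reduction of exponents modulo r.\<close>

lemma r_pos: "r > 0"
proof -
  have "G.ord g \<noteq> 0"
    using G.ord_ge_1[OF finite_G g] by simp
  then show ?thesis
    by (auto simp: ord_g intro: Nat.gr0I)
qed

lemma u_pow_r: "u [^]\<^bsub>G\<^esub> r = \<one>\<^bsub>G\<^esub>"
  using G.pow_ord_eq_1[OF g] by (simp add: u_def G.nat_pow_pow g ord_g)

lemma u_central: "h \<in> carrier G \<Longrightarrow> u [^]\<^bsub>G\<^esub> (s::nat) \<otimes>\<^bsub>G\<^esub> h = h \<otimes>\<^bsub>G\<^esub> u [^]\<^bsub>G\<^esub> s"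
  using G.group_commutes_pow[OF g_central g, of h "n * s"] by (simp add: u_def G.nat_pow_pow g)

text \<open>Since \<open>u^r = 1\<close>, exponents may be reduced modulo r. Without the bound on
  exponents, closure under products is mere addition.\<close>

lemma N_range: "N = range (\<lambda>s::nat. u [^]\<^bsub>G\<^esub> s)"
proof -
  have "u [^]\<^bsub>G\<^esub> s = u [^]\<^bsub>G\<^esub> (s mod r)" for s :: nat
  proof -
    have "u [^]\<^bsub>G\<^esub> s = u [^]\<^bsub>G\<^esub> (r * (s div r) + s mod r)"
      by simp
    also have "\<dots> = u [^]\<^bsub>G\<^esub> (r * (s div r)) \<otimes>\<^bsub>G\<^esub> u [^]\<^bsub>G\<^esub> (s mod r)"
      by (rule G.nat_pow_mult[symmetric, OF u_closed])
    also have "u [^]\<^bsub>G\<^esub> (r * (s div r)) = \<one>\<^bsub>G\<^esub>"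
      unfolding G.nat_pow_pow[OF u_closed, symmetric] u_pow_r by simp
    finally show ?thesis
      by (simp add: u_closed)
  qed
  moreover have "s mod r < r" for s
    using r_pos by simp
  ultimately show ?thesis
    unfolding N_def u_pow by (blast intro: lessThan_iff[THEN iffD2])
qed

lemma N_subgroup: "subgroup N G"
proof (rule G.subgroupI)
  show "N \<subseteq> carrier G" "N \<noteq> {}"
    by (auto simp: N_range u_closed)
  show "a \<otimes>\<^bsub>G\<^esub> b \<in> N" if "a \<in> N" "b \<in> N" for a b
    using that by (auto simp: N_range G.nat_pow_mult u_closed)
  show "inv\<^bsub>G\<^esub> a \<in> N" if a: "a \<in> N" for a
  proof -
    obtain s :: nat where a: "a = u [^]\<^bsub>G\<^esub> s"
      using a by (auto simp: N_range)
    \<comment> \<open>The inverse is written with a natural exponent: (r - 1) s + s is a multiple of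
      r. The truncated subtraction is harmless because r is positive.\<close>
    have "u [^]\<^bsub>G\<^esub> ((r - 1) * s) \<otimes>\<^bsub>G\<^esub> a = u [^]\<^bsub>G\<^esub> ((r - 1) * s + s)"
      unfolding a by (rule G.nat_pow_mult[OF u_closed])
    also have "(r - 1) * s + s = r * s"
      using r_pos by (cases r) simp_all
    also have "u [^]\<^bsub>G\<^esub> (r * s) = \<one>\<^bsub>G\<^esub>"
      unfolding G.nat_pow_pow[OF u_closed, symmetric] u_pow_r by simp
    finally have "inv\<^bsub>G\<^esub> a = u [^]\<^bsub>G\<^esub> ((r - 1) * s)"
      by (intro G.inv_equality) (auto simp: a u_closed)
    then show ?thesis
      by (simp add: N_range)
  qed
qed

lemma N_normal: "N \<lhd> G"
  by (rule G.normalI[OF N_subgroup]) (auto simp: r_coset_def l_coset_def N_range u_central)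

sublocale N: normal N G by (rule N_normal)

abbreviation bar where "bar h \<equiv> N #>\<^bsub>G\<^esub> h"

lemma bar_u: "bar u = N"
proof (rule G.coset_join2[OF u_closed N_subgroup])
  have "u = u [^]\<^bsub>G\<^esub> (1::nat)"
    by (simp add: u_closed)
  then show "u \<in> N"
    unfolding N_range by (rule range_eqI)
qed

lemma bar_ops:
  "h \<in> carrier G \<Longrightarrow> bar h \<in> carrier (G Mod N)"
  "\<lbrakk>h \<in> carrier G; h' \<in> carrier G\<rbrakk> \<Longrightarrow> bar h \<otimes>\<^bsub>G Mod N\<^esub> bar h' = bar (h \<otimes>\<^bsub>G\<^esub> h')"
  "\<one>\<^bsub>G Mod N\<^esub> = bar \<one>\<^bsub>G\<^esub>"
  by (simp_all add: carrier_FactGroup N.rcos_sum G.coset_mult_one N.subset)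

lemma bar_cases: "C \<in> carrier (G Mod N) \<Longrightarrow> (\<And>h. h \<in> carrier G \<Longrightarrow> C = bar h \<Longrightarrow> P) \<Longrightarrow> P"
  by (auto simp: carrier_FactGroup)

lemma \<chi>_closed: "h \<in> carrier G \<Longrightarrow> \<chi> h \<in> carrier K"
  using \<chi> K.Units_closed by (auto simp: hom_def units_of_carrier)

lemma \<chi>_Pi: "\<chi> \<in> carrier G \<rightarrow> carrier K"
  using \<chi>_closed by blast

text \<open>By the choice of n, \<chi>(g) has n-th power 1, so \<chi> is trivial on
  \<open>N\<close>. Hence \<chi> descends to the quotient group, and \<open>y\<close> commutes with
  the images of \<open>N\<close>.\<close>

lemma \<chi>_u: "\<chi> (u [^]\<^bsub>G\<^esub> (s::nat)) = \<one>\<^bsub>K\<^esub>"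
proof -
  interpret U: group "units_of K" by (rule K.units_group)
  have "\<chi> u = \<chi> g [^]\<^bsub>units_of K\<^esub> n"
    unfolding u_def by (rule hom_nat_pow[OF \<chi> g G K.units_group])
  also have "\<dots> = \<one>\<^bsub>units_of K\<^esub>"
    unfolding n using \<chi> g by (intro U.pow_ord_eq_1) (auto simp: hom_def)
  finally have "\<chi> (u [^]\<^bsub>G\<^esub> s) = \<one>\<^bsub>units_of K\<^esub>"
    using hom_nat_pow[OF \<chi> u_closed G K.units_group, of s] by simp
  then show ?thesis
    by (simp add: units_of_one)
qed

lemma induced_char_bar: "h \<in> carrier G \<Longrightarrow> induced_char \<chi> (bar h) = \<chi> h"
proof -
  assume h: "h \<in> carrier G"
  have "\<chi> (u [^]\<^bsub>G\<^esub> (s::nat) \<otimes>\<^bsub>G\<^esub> h) = \<chi> h" for s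
    using \<chi> h u_closed by (simp add: hom_def units_of_mult \<chi>_u \<chi>_closed)
  then have "\<chi> ` bar h = {\<chi> h}"
    by (auto simp: r_coset_def N_range image_iff)
  then show ?thesis
    by (simp add: induced_char_def)
qed

section \<open>The presentations of \<open>H\<close> and \<open>Hbar\<close>\<close>

lemma hopf: "hopf_algebra K H" "hopf_algebra K Hbar"
  using H_datum Hbar_datum by (simp_all add: datum_hopf_algebra_def)

sublocale H: hopf_algebra K H by (rule hopf)
sublocale B: hopf_algebra K Hbar by (rule hopf)

lemmas H_alg = hopf_assoc_algebra[OF hopf(1)] and B_alg = hopf_assoc_algebra[OF hopf(2)]

abbreviation L where "L \<equiv> insert Skew (Elt ` carrier G)"
abbreviation Lbar where "Lbar \<equiv> insert Skew (Elt ` carrier (G Mod N))"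

lemma H_presented: "presented_by K H L (datum_relations K G \<chi> g \<one>\<^bsub>K\<^esub>) (case_gen y \<iota>)"
  using H_datum by (simp add: datum_hopf_algebra_def)

lemma B_presented:
  "presented_by K Hbar Lbar (datum_relations K (G Mod N) (induced_char \<chi>) (bar g) \<zero>\<^bsub>K\<^esub>) (case_gen z \<iota>bar)"
  using Hbar_datum by (simp add: datum_hopf_algebra_def)

lemma H_gens_closed: "y \<in> carrier H" "h \<in> carrier G \<Longrightarrow> \<iota> h \<in> carrier H"
proof -
  have "case_gen y \<iota> \<in> L \<rightarrow> carrier H"
    using H_presented by (simp add: presented_by_def)
  from Pi_mem[OF this, of Skew] Pi_mem[OF this, of "Elt h"]
  show "y \<in> carrier H" "h \<in> carrier G \<Longrightarrow> \<iota> h \<in> carrier H"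
    by simp_all
qed

lemma B_gens_closed: "z \<in> carrier Hbar" "h \<in> carrier G \<Longrightarrow> \<iota>bar (bar h) \<in> carrier Hbar"
proof -
  have "case_gen z \<iota>bar \<in> Lbar \<rightarrow> carrier Hbar"
    using B_presented by (simp add: presented_by_def)
  from Pi_mem[OF this, of Skew] Pi_mem[OF this, of "Elt (bar h)"]
  show "z \<in> carrier Hbar" "h \<in> carrier G \<Longrightarrow> \<iota>bar (bar h) \<in> carrier Hbar"
    by (simp_all add: bar_ops)
qed

lemma H_relations_closed: "datum_relations K G \<chi> g \<one>\<^bsub>K\<^esub> \<subseteq> carrier (free_algebra K L)"
  by (rule datum_relations_closed[OF K G \<chi>_Pi g K.one_closed n])

lemma induced_char_closed: "induced_char \<chi> \<in> carrier (G Mod N) \<rightarrow> carrier K"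
  by (auto elim!: bar_cases simp: induced_char_bar \<chi>_closed)

text \<open>Both data involve the same exponent, because the induced character takes the value
  \<chi>(g) at the class of \<open>g\<close>.\<close>

lemma n_bar: "n = group.ord (units_of K) (induced_char \<chi> (bar g))"
  by (simp add: induced_char_bar g n)

lemma B_relations_closed:
  "datum_relations K (G Mod N) (induced_char \<chi>) (bar g) \<zero>\<^bsub>K\<^esub> \<subseteq> carrier (free_algebra K Lbar)"
  by (rule datum_relations_closed[OF K N.factorgroup_is_group induced_char_closed bar_ops(1)[OF g]
        K.zero_closed n_bar])

lemma H_relations_hold_iff:
  assumes "assoc_algebra K A" "\<gamma> \<in> L \<rightarrow> carrier A"
  shows "(\<forall>r\<in>datum_relations K G \<chi> g \<one>\<^bsub>K\<^esub>. free_eval K A \<gamma> r = \<zero>\<^bsub>A\<^esub>) \<longleftrightarrow>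
    (\<forall>h\<in>carrier G. \<forall>h'\<in>carrier G. \<gamma> (Elt h) \<otimes>\<^bsub>A\<^esub> \<gamma> (Elt h') = \<gamma> (Elt (h \<otimes>\<^bsub>G\<^esub> h'))) \<and>
    \<gamma> (Elt \<one>\<^bsub>G\<^esub>) = \<one>\<^bsub>A\<^esub> \<and>
    \<gamma> Skew [^]\<^bsub>A\<^esub> n = \<gamma> (Elt u) \<ominus>\<^bsub>A\<^esub> \<one>\<^bsub>A\<^esub> \<and>
    (\<forall>h\<in>carrier G. \<gamma> Skew \<otimes>\<^bsub>A\<^esub> \<gamma> (Elt h) = \<chi> h \<odot>\<^bsub>A\<^esub> (\<gamma> (Elt h) \<otimes>\<^bsub>A\<^esub> \<gamma> Skew))"
proof -
  interpret A: assoc_algebra K A by (rule assms)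
  have "\<gamma> (Elt u) \<in> carrier A" using assms u_closed by auto
  then show ?thesis
    unfolding datum_relations_hold_iff[OF K G \<chi>_Pi g K.one_closed n assms] by (simp add: u_def)
qed

lemma B_relations_hold_iff:
  assumes "assoc_algebra K A" "\<gamma> \<in> Lbar \<rightarrow> carrier A"
  shows "(\<forall>r\<in>datum_relations K (G Mod N) (induced_char \<chi>) (bar g) \<zero>\<^bsub>K\<^esub>. free_eval K A \<gamma> r = \<zero>\<^bsub>A\<^esub>) \<longleftrightarrow>
    (\<forall>h\<in>carrier G. \<forall>h'\<in>carrier G. \<gamma> (Elt (bar h)) \<otimes>\<^bsub>A\<^esub> \<gamma> (Elt (bar h')) = \<gamma> (Elt (bar (h \<otimes>\<^bsub>G\<^esub> h')))) \<and>
    \<gamma> (Elt (bar \<one>\<^bsub>G\<^esub>)) = \<one>\<^bsub>A\<^esub> \<and>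
    \<gamma> Skew [^]\<^bsub>A\<^esub> n = \<zero>\<^bsub>A\<^esub> \<and>
    (\<forall>h\<in>carrier G. \<gamma> Skew \<otimes>\<^bsub>A\<^esub> \<gamma> (Elt (bar h)) = \<chi> h \<odot>\<^bsub>A\<^esub> (\<gamma> (Elt (bar h)) \<otimes>\<^bsub>A\<^esub> \<gamma> Skew))"
proof -
  interpret A: assoc_algebra K A by (rule assms)
  interpret Q: group "G Mod N" by (rule N.factorgroup_is_group)
  have all: "(\<forall>C\<in>carrier (G Mod N). P C) \<longleftrightarrow> (\<forall>h\<in>carrier G. P (bar h))" for P
    by (auto simp: carrier_FactGroup)
  \<comment> \<open>The relation for the skew generator becomes \<open>z^n = 0\<close> because it
    carries the scalar 0; the element being scaled must first be known to lie in
    \<open>A\<close>.\<close>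
  have "bar g [^]\<^bsub>G Mod N\<^esub> n \<in> carrier (G Mod N)"
    using bar_ops(1)[OF g] by simp
  then have "\<gamma> (Elt (bar g [^]\<^bsub>G Mod N\<^esub> n)) \<ominus>\<^bsub>A\<^esub> \<one>\<^bsub>A\<^esub> \<in> carrier A"
    using assms(2) by (intro A.M.minus_closed) auto
  then have zero: "\<zero>\<^bsub>K\<^esub> \<odot>\<^bsub>A\<^esub> (\<gamma> (Elt (bar g [^]\<^bsub>G Mod N\<^esub> n)) \<ominus>\<^bsub>A\<^esub> \<one>\<^bsub>A\<^esub>) = \<zero>\<^bsub>A\<^esub>"
    by simp
  show ?thesis
    unfolding datum_relations_hold_iff[OF K N.factorgroup_is_group induced_char_closed
        bar_ops(1)[OF g] K.zero_closed n_bar assms] zero all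
    by (simp add: bar_ops induced_char_bar del: mult_FactGroup one_FactGroup)
qed

lemma H_relations:
  "\<lbrakk>h \<in> carrier G; h' \<in> carrier G\<rbrakk> \<Longrightarrow> \<iota> h \<otimes>\<^bsub>H\<^esub> \<iota> h' = \<iota> (h \<otimes>\<^bsub>G\<^esub> h')"
  "\<iota> \<one>\<^bsub>G\<^esub> = \<one>\<^bsub>H\<^esub>"
  "y [^]\<^bsub>H\<^esub> n = \<iota> u \<ominus>\<^bsub>H\<^esub> \<one>\<^bsub>H\<^esub>"
  "h \<in> carrier G \<Longrightarrow> y \<otimes>\<^bsub>H\<^esub> \<iota> h = \<chi> h \<odot>\<^bsub>H\<^esub> (\<iota> h \<otimes>\<^bsub>H\<^esub> y)"
proof -
  have "case_gen y \<iota> \<in> L \<rightarrow> carrier H"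
    using H_gens_closed by auto
  from H_relations_hold_iff[OF H_alg this] presented_by_relation[OF H_alg H_presented H_relations_closed]
  have rel: "(\<forall>h\<in>carrier G. \<forall>h'\<in>carrier G. \<iota> h \<otimes>\<^bsub>H\<^esub> \<iota> h' = \<iota> (h \<otimes>\<^bsub>G\<^esub> h')) \<and> \<iota> \<one>\<^bsub>G\<^esub> = \<one>\<^bsub>H\<^esub> \<and>
      y [^]\<^bsub>H\<^esub> n = \<iota> u \<ominus>\<^bsub>H\<^esub> \<one>\<^bsub>H\<^esub> \<and> (\<forall>h\<in>carrier G. y \<otimes>\<^bsub>H\<^esub> \<iota> h = \<chi> h \<odot>\<^bsub>H\<^esub> (\<iota> h \<otimes>\<^bsub>H\<^esub> y))"
    by simp
  then show
    "\<lbrakk>h \<in> carrier G; h' \<in> carrier G\<rbrakk> \<Longrightarrow> \<iota> h \<otimes>\<^bsub>H\<^esub> \<iota> h' = \<iota> (h \<otimes>\<^bsub>G\<^esub> h')"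
    "\<iota> \<one>\<^bsub>G\<^esub> = \<one>\<^bsub>H\<^esub>"
    "y [^]\<^bsub>H\<^esub> n = \<iota> u \<ominus>\<^bsub>H\<^esub> \<one>\<^bsub>H\<^esub>"
    "h \<in> carrier G \<Longrightarrow> y \<otimes>\<^bsub>H\<^esub> \<iota> h = \<chi> h \<odot>\<^bsub>H\<^esub> (\<iota> h \<otimes>\<^bsub>H\<^esub> y)"
    by blast+
qed

lemma B_relations:
  "\<lbrakk>h \<in> carrier G; h' \<in> carrier G\<rbrakk> \<Longrightarrow> \<iota>bar (bar h) \<otimes>\<^bsub>Hbar\<^esub> \<iota>bar (bar h') = \<iota>bar (bar (h \<otimes>\<^bsub>G\<^esub> h'))"
  "\<iota>bar (bar \<one>\<^bsub>G\<^esub>) = \<one>\<^bsub>Hbar\<^esub>"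
  "z [^]\<^bsub>Hbar\<^esub> n = \<zero>\<^bsub>Hbar\<^esub>"
  "h \<in> carrier G \<Longrightarrow> z \<otimes>\<^bsub>Hbar\<^esub> \<iota>bar (bar h) = \<chi> h \<odot>\<^bsub>Hbar\<^esub> (\<iota>bar (bar h) \<otimes>\<^bsub>Hbar\<^esub> z)"
proof -
  have "case_gen z \<iota>bar \<in> Lbar \<rightarrow> carrier Hbar"
    using B_gens_closed by (auto elim!: bar_cases)
  from B_relations_hold_iff[OF B_alg this] presented_by_relation[OF B_alg B_presented B_relations_closed]
  have rel: "(\<forall>h\<in>carrier G. \<forall>h'\<in>carrier G.
        \<iota>bar (bar h) \<otimes>\<^bsub>Hbar\<^esub> \<iota>bar (bar h') = \<iota>bar (bar (h \<otimes>\<^bsub>G\<^esub> h'))) \<and> \<iota>bar (bar \<one>\<^bsub>G\<^esub>) = \<one>\<^bsub>Hbar\<^esub> \<and>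
      z [^]\<^bsub>Hbar\<^esub> n = \<zero>\<^bsub>Hbar\<^esub> \<and>
      (\<forall>h\<in>carrier G. z \<otimes>\<^bsub>Hbar\<^esub> \<iota>bar (bar h) = \<chi> h \<odot>\<^bsub>Hbar\<^esub> (\<iota>bar (bar h) \<otimes>\<^bsub>Hbar\<^esub> z))"
    by simp
  then show
    "\<lbrakk>h \<in> carrier G; h' \<in> carrier G\<rbrakk> \<Longrightarrow> \<iota>bar (bar h) \<otimes>\<^bsub>Hbar\<^esub> \<iota>bar (bar h') = \<iota>bar (bar (h \<otimes>\<^bsub>G\<^esub> h'))"
    "\<iota>bar (bar \<one>\<^bsub>G\<^esub>) = \<one>\<^bsub>Hbar\<^esub>"
    "z [^]\<^bsub>Hbar\<^esub> n = \<zero>\<^bsub>Hbar\<^esub>"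
    "h \<in> carrier G \<Longrightarrow> z \<otimes>\<^bsub>Hbar\<^esub> \<iota>bar (bar h) = \<chi> h \<odot>\<^bsub>Hbar\<^esub> (\<iota>bar (bar h) \<otimes>\<^bsub>Hbar\<^esub> z)"
    by blast+
qed

section \<open>The central idempotent \<open>e\<close>\<close>

abbreviation \<sigma> where "\<sigma> \<equiv> (\<Oplus>\<^bsub>H\<^esub>s\<in>{..<r}. \<iota> (u [^]\<^bsub>G\<^esub> s))"

lemma e_eq: "e = inv\<^bsub>K\<^esub> ([r] \<cdot>\<^bsub>K\<^esub> \<one>\<^bsub>K\<^esub>) \<odot>\<^bsub>H\<^esub> \<sigma>"
  by (simp add: e_def u_pow)

lemma \<iota>_pow_closed: "\<iota> (u [^]\<^bsub>G\<^esub> (s::nat)) \<in> carrier H"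
  by (simp add: H_gens_closed u_closed)

lemma \<sigma>_closed: "\<sigma> \<in> carrier H"
  by (rule H.finsum_closed) (simp add: \<iota>_pow_closed)

lemma r_inv: "inv\<^bsub>K\<^esub> ([r] \<cdot>\<^bsub>K\<^esub> \<one>\<^bsub>K\<^esub>) \<in> carrier K"
  "inv\<^bsub>K\<^esub> ([r] \<cdot>\<^bsub>K\<^esub> \<one>\<^bsub>K\<^esub>) \<otimes>\<^bsub>K\<^esub> ([r] \<cdot>\<^bsub>K\<^esub> \<one>\<^bsub>K\<^esub>) = \<one>\<^bsub>K\<^esub>"
proof -
  have "[r] \<cdot>\<^bsub>K\<^esub> \<one>\<^bsub>K\<^esub> \<in> Units K"
    using char_zero[OF r_pos] by (simp add: K.field_Units)
  then show "inv\<^bsub>K\<^esub> ([r] \<cdot>\<^bsub>K\<^esub> \<one>\<^bsub>K\<^esub>) \<in> carrier K"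
    "inv\<^bsub>K\<^esub> ([r] \<cdot>\<^bsub>K\<^esub> \<one>\<^bsub>K\<^esub>) \<otimes>\<^bsub>K\<^esub> ([r] \<cdot>\<^bsub>K\<^esub> \<one>\<^bsub>K\<^esub>) = \<one>\<^bsub>K\<^esub>"
    by simp_all
qed

lemma e_closed: "e \<in> carrier H"
  by (simp add: e_eq \<sigma>_closed r_inv)

text \<open>Multiplication by \<open>u\<close> raises every exponent by one, and
  \<open>u^r = 1\<close> closes the cycle, so the summands are only permuted.\<close>

lemma \<iota>_u_\<sigma>: "\<iota> u \<otimes>\<^bsub>H\<^esub> \<sigma> = \<sigma>"
proof -
  obtain k where k: "r = Suc k"
    using r_pos by (cases r) auto
  let ?f = "\<lambda>s::nat. \<iota> (u [^]\<^bsub>G\<^esub> s)"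
  have f: "?f \<in> S \<rightarrow> carrier H" for S :: "nat set"
    by (simp add: \<iota>_pow_closed)
  have r: "{..<r} = {..k}"
    by (auto simp: k)
  have "\<iota> u \<otimes>\<^bsub>H\<^esub> \<sigma> = (\<Oplus>\<^bsub>H\<^esub>s\<in>{..k}. \<iota> u \<otimes>\<^bsub>H\<^esub> ?f s)"
    unfolding r by (rule H.A.finsum_rdistr) (auto simp: f H_gens_closed u_closed \<iota>_pow_closed)
  also have "\<dots> = (\<Oplus>\<^bsub>H\<^esub>s\<in>{..k}. ?f (Suc s))"
    by (rule H.finsum_cong')
       (auto simp: \<iota>_pow_closed H_gens_closed H_relations u_closed u_central[OF u_closed])
  \<comment> \<open>The sum over exponents 0 to r is split at its first term and at its last term;
    as these two terms are equal, they cancel below.\<close>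
  finally have "\<iota> u \<otimes>\<^bsub>H\<^esub> \<sigma> \<oplus>\<^bsub>H\<^esub> ?f 0 = ?f r \<oplus>\<^bsub>H\<^esub> \<sigma>"
    using H.finsum_Suc[OF f, of k] H.finsum_Suc2[OF f, of k] unfolding r by (simp only: k)
  moreover have "?f r = ?f 0"
    by (simp add: u_pow_r)
  ultimately have "\<iota> u \<otimes>\<^bsub>H\<^esub> \<sigma> \<oplus>\<^bsub>H\<^esub> ?f 0 = \<sigma> \<oplus>\<^bsub>H\<^esub> ?f 0"
    by (simp only: H.M.a_comm[OF \<sigma>_closed \<iota>_pow_closed[of 0]])
  then show ?thesis
    by (rule H.M.add.r_cancel)
       (rule \<iota>_pow_closed \<sigma>_closed H.A.m_closed[OF H_gens_closed(2)[OF u_closed] \<sigma>_closed])+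
qed

text \<open>\<open>N\<close> acts trivially on \<open>e\<close>. This gives idempotence, lets
  \<iota> h e depend only on the coset of \<open>h\<close>, and makes (u - 1) e vanish.\<close>

lemma \<iota>_pow_e: "\<iota> (u [^]\<^bsub>G\<^esub> (s::nat)) \<otimes>\<^bsub>H\<^esub> e = e"
proof (induction s)
  case 0
  then show ?case by (simp add: H_relations e_closed)
next
  case (Suc s)
  have "\<iota> u \<otimes>\<^bsub>H\<^esub> e = e"
    unfolding e_eq by (simp add: H.smult_mult_right r_inv \<sigma>_closed H_gens_closed u_closed \<iota>_u_\<sigma>)
  moreover have "\<iota> (u [^]\<^bsub>G\<^esub> Suc s) \<otimes>\<^bsub>H\<^esub> e = \<iota> (u [^]\<^bsub>G\<^esub> s) \<otimes>\<^bsub>H\<^esub> (\<iota> u \<otimes>\<^bsub>H\<^esub> e)"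
    using u_closed by (simp add: H.A.m_assoc[symmetric] H_gens_closed e_closed H_relations)
  ultimately show ?case
    using Suc by simp
qed

text \<open>Each of the r summands of \<sigma> fixes \<open>e\<close>, so \<sigma> e = r e, and the
  inverse of r in \<open>e\<close> cancels the factor.\<close>

lemma e_idem: "e \<otimes>\<^bsub>H\<^esub> e = e"
proof -
  have "\<sigma> \<otimes>\<^bsub>H\<^esub> e = (\<Oplus>\<^bsub>H\<^esub>s\<in>{..<r}. e)"
    by (subst H.A.finsum_ldistr) (auto simp: e_closed \<iota>_pow_closed \<iota>_pow_e)
  then have "\<sigma> \<otimes>\<^bsub>H\<^esub> e = ([r] \<cdot>\<^bsub>K\<^esub> \<one>\<^bsub>K\<^esub>) \<odot>\<^bsub>H\<^esub> e"
    by (simp add: H.finsum_const_smult e_closed)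
  then have "inv\<^bsub>K\<^esub> ([r] \<cdot>\<^bsub>K\<^esub> \<one>\<^bsub>K\<^esub>) \<odot>\<^bsub>H\<^esub> \<sigma> \<otimes>\<^bsub>H\<^esub> e = e"
    by (simp add: H.smult_mult_left r_inv \<sigma>_closed e_closed H.smult_assoc1[symmetric])
  then show ?thesis
    by (simp add: e_eq)
qed

text \<open>As a combination of the \<iota>(u^s), \<open>e\<close> commutes with whatever commutes
  with all of these: with \<open>y\<close> because \<chi>(u^s) = 1, and with \<iota> h because
  \<open>u\<close> is central. The generators suffice.\<close>

lemma e_central: "x \<in> carrier H \<Longrightarrow> e \<otimes>\<^bsub>H\<^esub> x = x \<otimes>\<^bsub>H\<^esub> e"
proof -
  have comm: "e \<otimes>\<^bsub>H\<^esub> x = x \<otimes>\<^bsub>H\<^esub> e"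
    if x: "x \<in> carrier H" and pow: "\<And>s::nat. \<iota> (u [^]\<^bsub>G\<^esub> s) \<otimes>\<^bsub>H\<^esub> x = x \<otimes>\<^bsub>H\<^esub> \<iota> (u [^]\<^bsub>G\<^esub> s)" for x
  proof -
    have "\<sigma> \<otimes>\<^bsub>H\<^esub> x = x \<otimes>\<^bsub>H\<^esub> \<sigma>"
      using x by (simp add: H.A.finsum_ldistr H.A.finsum_rdistr \<iota>_pow_closed pow)
    then show ?thesis
      using x by (simp add: e_eq H.smult_mult_left H.smult_mult_right r_inv \<sigma>_closed)
  qed
  have y: "e \<otimes>\<^bsub>H\<^esub> y = y \<otimes>\<^bsub>H\<^esub> e"
    by (rule comm) (simp_all add: H_gens_closed H_relations u_closed \<chi>_u)
  have \<iota>: "e \<otimes>\<^bsub>H\<^esub> \<iota> h = \<iota> h \<otimes>\<^bsub>H\<^esub> e" if "h \<in> carrier G" for h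
    by (rule comm) (simp_all add: that H_gens_closed H_relations u_closed u_central)
  assume x: "x \<in> carrier H"
  show ?thesis
    using H_alg H_presented x
  proof (induction x rule: presented_by_induct)
    case one
    then show ?case by (simp add: e_closed)
  next
    case (gen l x)
    then have "e \<otimes>\<^bsub>H\<^esub> case_gen y \<iota> l = case_gen y \<iota> l \<otimes>\<^bsub>H\<^esub> e"
      using y \<iota> by auto
    then show ?case
      using gen e_closed by (metis H.A.m_assoc)
  next
    case (add x y)
    then show ?case by (simp add: H.A.l_distr H.A.r_distr e_closed)
  next
    case (smult c x)
    then show ?case by (simp add: H.smult_mult_left H.smult_mult_right e_closed)
  qed
qed

sublocale E: central_idempotent K H e
  by unfold_locales (simp_all add: e_closed e_idem e_central)

section \<open>The homomorphisms between \<open>H\<close>, \<open>Hbar\<close> and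
  \<open>He\<close>\<close>

lemma obtain_projection:
  obtains \<psi> where "\<psi> \<in> bialg_hom K H Hbar" "\<psi> y = z" "\<And>h. h \<in> carrier G \<Longrightarrow> \<psi> (\<iota> h) = \<iota>bar (bar h)"
proof -
  let ?\<delta> = "case_gen z (\<lambda>h. \<iota>bar (bar h))"
  have \<delta>: "?\<delta> \<in> L \<rightarrow> carrier Hbar"
    using B_gens_closed by auto
  \<comment> \<open>The right-hand side of \<open>y^n = u - 1\<close> becomes 0 because
    \<open>u\<close> lies in \<open>N\<close>; this matches \<open>z^n = 0\<close>.\<close>
  have "\<iota>bar (bar u) \<ominus>\<^bsub>Hbar\<^esub> \<one>\<^bsub>Hbar\<^esub> = \<zero>\<^bsub>Hbar\<^esub>"
    using B_relations(2) bar_ops(3) by (simp add: bar_u)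
  then have "\<forall>r\<in>datum_relations K G \<chi> g \<one>\<^bsub>K\<^esub>. free_eval K Hbar ?\<delta> r = \<zero>\<^bsub>Hbar\<^esub>"
    by (subst H_relations_hold_iff[OF B_alg \<delta>]) (simp add: B_relations)
  then obtain \<psi> where hom: "\<psi> \<in> alg_hom K H Hbar" and \<psi>: "\<And>l. l \<in> L \<Longrightarrow> \<psi> (case_gen y \<iota> l) = ?\<delta> l"
    using presented_by_hom[OF H_alg H_presented H_relations_closed B_alg \<delta>] by blast
  have \<psi>y: "\<psi> y = z"
    using \<psi>[of Skew] by simp
  have \<psi>\<iota>: "\<psi> (\<iota> h) = \<iota>bar (bar h)" if "h \<in> carrier G" for h
    using \<psi>[of "Elt h"] that by simp
  note HH = hopf_alg_pair[OF hopf(1) hopf(1)] and BB = hopf_alg_pair[OF hopf(2) hopf(2)]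
  note lin = alg_hom_lin_maps[OF hom]
  note tm = tensor_map_alg_hom[OF HH BB hom hom]
  note pure_closed = alg_pair.pure_closed[OF HH] and tp = tensor_map_pure[OF HH BB lin lin]
  have \<Delta>: "comult Hbar (\<psi> x) = tensor_map K Hbar Hbar \<psi> \<psi> (comult H x)" if x: "x \<in> carrier H" for x
  proof (rule presented_by_hom_eqI[OF H_alg H_presented tensor_algebra[OF BB]
        alg_hom_comp[OF hom B.comult_hom] alg_hom_comp[OF H.comult_hom tm] _ x])
    fix l assume "l \<in> L"
    then show "comult Hbar (\<psi> (case_gen y \<iota> l)) = tensor_map K Hbar Hbar \<psi> \<psi> (comult H (case_gen y \<iota> l))"
    proof
      assume l: "l = Skew"
      have "comult H y = pure_tensor K H H y (\<iota> g) \<oplus>\<^bsub>tensor K H H\<^esub> pure_tensor K H H \<one>\<^bsub>H\<^esub> y"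
        and "comult Hbar z = pure_tensor K Hbar Hbar z (\<iota>bar (bar g))
            \<oplus>\<^bsub>tensor K Hbar Hbar\<^esub> pure_tensor K Hbar Hbar \<one>\<^bsub>Hbar\<^esub> z"
        using H_datum Hbar_datum by (simp_all add: datum_hopf_algebra_def)
      then show ?thesis
        by (simp add: l \<psi>y \<psi>\<iota> g H_gens_closed pure_closed alg_hom_add[OF tm] tp alg_hom_one[OF hom])
    next
      assume "l \<in> Elt ` carrier G"
      then obtain h where h: "h \<in> carrier G" and l: "l = Elt h" by blast
      have "comult H (\<iota> h) = pure_tensor K H H (\<iota> h) (\<iota> h)"
        "comult Hbar (\<iota>bar (bar h)) = pure_tensor K Hbar Hbar (\<iota>bar (bar h)) (\<iota>bar (bar h))"
        using H_datum Hbar_datum h bar_ops(1)[OF h] by (simp_all add: datum_hopf_algebra_def)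
      then show ?thesis
        by (simp add: l \<psi>\<iota> h H_gens_closed tp)
    qed
  qed
  \<comment> \<open>As a record, \<open>K\<close> carries no scalar multiplication, so counits are
    not of the form \<open>alg_hom\<close>; the comparison on generators is therefore carried out by
    a direct induction.\<close>
  have "counit Hbar (\<psi> x) = counit H x" if "x \<in> carrier H" for x
    using H_alg H_presented that
  proof (induction x rule: presented_by_induct)
    case one
    then show ?case by (simp add: alg_hom_one[OF hom] H.counit_ops B.counit_ops)
  next
    case (gen l x)
    have "counit Hbar (\<psi> (case_gen y \<iota> l)) = counit H (case_gen y \<iota> l)"
      using H_datum Hbar_datum gen(1) bar_ops(1) by (auto simp: datum_hopf_algebra_def \<psi>y \<psi>\<iota>)
    then show ?case
      using gen by (simp add: alg_hom_mult[OF hom] alg_hom_closed[OF hom] H.counit_ops B.counit_ops)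
  next
    case (add x y)
    then show ?case
      by (simp add: alg_hom_add[OF hom] alg_hom_closed[OF hom] H.counit_ops B.counit_ops)
  next
    case (smult c x)
    then show ?case
      by (simp add: alg_hom_smult[OF hom] alg_hom_closed[OF hom] H.counit_smult B.counit_smult)
  qed
  then have "\<psi> \<in> bialg_hom K H Hbar"
    using hom \<Delta> by (simp add: bialg_hom_def)
  then show thesis
    using \<psi>y \<psi>\<iota> by (rule that)
qed

lemma obtain_section:
  obtains \<theta> where "\<theta> \<in> alg_hom K Hbar E.C" "\<theta> z = y \<otimes>\<^bsub>H\<^esub> e"
    "\<And>h. h \<in> carrier G \<Longrightarrow> \<theta> (\<iota>bar (bar h)) = \<iota> h \<otimes>\<^bsub>H\<^esub> e"
proof -
  \<comment> \<open>A representative of the coset is chosen; two representatives differ by a power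
    of \<open>u\<close>, which \<open>e\<close> absorbs.\<close>
  define j where "j C = \<iota> (SOME h. h \<in> C) \<otimes>\<^bsub>H\<^esub> e" for C
  have j: "j (bar h) = \<iota> h \<otimes>\<^bsub>H\<^esub> e" if h: "h \<in> carrier G" for h
  proof -
    have "(SOME h'. h' \<in> bar h) \<in> bar h"
      by (rule someI[of _ h]) (rule G.rcos_self[OF h N_subgroup])
    then obtain s :: nat where s: "(SOME h'. h' \<in> bar h) = u [^]\<^bsub>G\<^esub> s \<otimes>\<^bsub>G\<^esub> h"
      by (auto simp: r_coset_def N_range)
    have "\<iota> (u [^]\<^bsub>G\<^esub> s \<otimes>\<^bsub>G\<^esub> h) \<otimes>\<^bsub>H\<^esub> e = \<iota> h \<otimes>\<^bsub>H\<^esub> (\<iota> (u [^]\<^bsub>G\<^esub> s) \<otimes>\<^bsub>H\<^esub> e)"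
      using h by (simp add: u_central H.A.m_assoc[symmetric] H_gens_closed e_closed u_closed H_relations)
    then show ?thesis
      by (simp add: j_def s \<iota>_pow_e)
  qed
  let ?\<delta> = "case_gen (y \<otimes>\<^bsub>H\<^esub> e) j"
  have \<delta>: "?\<delta> \<in> Lbar \<rightarrow> carrier E.C"
    using H_gens_closed by (auto elim!: bar_cases simp: j E.mult_e_closed)
  \<comment> \<open>The n-th power of y e is \<open>y^n\<close> e = (u - 1) e = e - e.\<close>
  have "(y \<otimes>\<^bsub>H\<^esub> e) [^]\<^bsub>E.C\<^esub> n = \<zero>\<^bsub>E.C\<^esub>"
  proof -
    have "(\<iota> u \<ominus>\<^bsub>H\<^esub> \<one>\<^bsub>H\<^esub>) \<otimes>\<^bsub>H\<^esub> e = e \<ominus>\<^bsub>H\<^esub> e"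
      using \<iota>_pow_e[of 1] u_closed
      by (simp add: H.M.minus_eq H.A.l_distr H.A.l_minus H_gens_closed e_closed)
    then show ?thesis
      by (simp add: E.C_nat_pow H_gens_closed H_relations E.C_simps e_closed)
  qed
  then have "\<forall>r\<in>datum_relations K (G Mod N) (induced_char \<chi>) (bar g) \<zero>\<^bsub>K\<^esub>. free_eval K E.C ?\<delta> r = \<zero>\<^bsub>E.C\<^esub>"
    by (subst B_relations_hold_iff[OF E.C_assoc_algebra \<delta>])
       (simp add: j E.C_simps E.mult_e_mult_e H_gens_closed H_relations e_closed H.smult_mult_left \<chi>_closed)
  then obtain \<theta> where hom: "\<theta> \<in> alg_hom K Hbar E.C" and \<theta>: "\<And>l. l \<in> Lbar \<Longrightarrow> \<theta> (case_gen z \<iota>bar l) = ?\<delta> l"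
    using presented_by_hom[OF B_alg B_presented B_relations_closed E.C_assoc_algebra \<delta>] by blast
  have \<theta>z: "\<theta> z = y \<otimes>\<^bsub>H\<^esub> e"
    using \<theta>[of Skew] by simp
  have "\<theta> (\<iota>bar (bar h)) = \<iota> h \<otimes>\<^bsub>H\<^esub> e" if "h \<in> carrier G" for h
    using \<theta>[of "Elt (bar h)"] bar_ops(1)[OF that] that by (simp add: j)
  with hom \<theta>z show thesis
    by (rule that)
qed

lemma quotient_and_corner:
  "(\<exists>\<phi>. \<phi> \<in> hopf_iso K Hbar
      (hopf_Quot K H ((\<lambda>x. x \<otimes>\<^bsub>H\<^esub> (\<one>\<^bsub>H\<^esub> \<ominus>\<^bsub>H\<^esub> e)) ` carrier H)))
    \<and> (\<exists>\<phi>. \<phi> \<in> alg_iso K Hbar (corner_alg H e))"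
proof -
  obtain \<psi> where \<psi>: "\<psi> \<in> bialg_hom K H Hbar" and \<psi>y: "\<psi> y = z"
    and \<psi>\<iota>: "\<And>h. h \<in> carrier G \<Longrightarrow> \<psi> (\<iota> h) = \<iota>bar (bar h)"
    using obtain_projection by blast
  have hom: "\<psi> \<in> alg_hom K H Hbar"
    using \<psi> by (simp add: bialg_hom_def)
  obtain \<theta> where \<theta>: "\<theta> \<in> alg_hom K Hbar E.C" and \<theta>z: "\<theta> z = y \<otimes>\<^bsub>H\<^esub> e"
    and \<theta>\<iota>: "\<And>h. h \<in> carrier G \<Longrightarrow> \<theta> (\<iota>bar (bar h)) = \<iota> h \<otimes>\<^bsub>H\<^esub> e"
    using obtain_section by blast
  have C_sub: "x \<in> carrier E.C \<Longrightarrow> x \<in> carrier H" for x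
    by (simp add: E.C_carrier)
  note \<psi>_closed = alg_hom_closed[OF hom] and \<theta>_closed = alg_hom_closed[OF \<theta>]
  \<comment> \<open>Both sides are algebra maps from \<open>H\<close> to \<open>He\<close>, and they
    agree on \<open>y\<close> and on the group elements.\<close>
  have \<theta>\<psi>: "\<theta> (\<psi> x) = x \<otimes>\<^bsub>H\<^esub> e" if "x \<in> carrier H" for x
    by (rule presented_by_hom_eqI[OF H_alg H_presented E.C_assoc_algebra alg_hom_comp[OF hom \<theta>]
          E.mult_e_alg_hom _ that]) (auto simp: \<psi>y \<psi>\<iota> \<theta>z \<theta>\<iota>)
  \<comment> \<open>Every u^s maps to 1, so \<sigma> maps to r times 1, and the inverse of r in
    \<open>e\<close> cancels.\<close>
  have \<psi>e: "\<psi> e = \<one>\<^bsub>Hbar\<^esub>"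
  proof -
    have "\<psi> \<sigma> = (\<Oplus>\<^bsub>Hbar\<^esub>s\<in>{..<r}. \<psi> (\<iota> (u [^]\<^bsub>G\<^esub> s)))"
      by (rule lin_maps_finsum[OF alg_hom_lin_maps[OF hom] H.module_axioms B.module_axioms])
         (simp_all add: \<iota>_pow_closed)
    also have "\<dots> = (\<Oplus>\<^bsub>Hbar\<^esub>s\<in>{..<r}. \<one>\<^bsub>Hbar\<^esub>)"
    proof (rule B.finsum_cong')
      fix s :: nat
      have "u [^]\<^bsub>G\<^esub> s \<in> N" by (auto simp: N_range)
      then have "bar (u [^]\<^bsub>G\<^esub> s) = N"
        using G.coset_join2[OF _ N_subgroup] u_closed by simp
      then show "\<psi> (\<iota> (u [^]\<^bsub>G\<^esub> s)) = \<one>\<^bsub>Hbar\<^esub>"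
        using B_relations(2) bar_ops(3) u_closed by (simp add: \<psi>\<iota>)
    qed auto
    finally have "\<psi> \<sigma> = ([r] \<cdot>\<^bsub>K\<^esub> \<one>\<^bsub>K\<^esub>) \<odot>\<^bsub>Hbar\<^esub> \<one>\<^bsub>Hbar\<^esub>"
      by (simp add: B.finsum_const_smult)
    then show ?thesis
      by (simp add: e_eq alg_hom_smult[OF hom] r_inv \<sigma>_closed B.smult_assoc1[symmetric])
  qed
  \<comment> \<open>On the corner, whose unit is \<open>e\<close>, \<psi> preserves units exactly
    because \<psi> e = 1. Then \<psi> \<theta> is an algebra endomorphism of \<open>Hbar\<close>,
    and it can be compared with the identity on generators.\<close>
  have "\<psi> \<in> alg_hom K E.C Hbar"
    by (rule alg_homI[OF lin_mapsI])
       (simp_all add: E.C_simps C_sub \<psi>_closed alg_hom_add[OF hom] alg_hom_mult[OF hom]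
         alg_hom_smult[OF hom] \<psi>e)
  note \<psi>\<theta>_hom = alg_hom_comp[OF \<theta> this]
  have \<psi>\<theta>: "\<psi> (\<theta> x) = x" if x: "x \<in> carrier Hbar" for x
  proof -
    have "\<psi> (\<theta> x) = id x"
    proof (rule presented_by_hom_eqI[OF B_alg B_presented B_alg \<psi>\<theta>_hom alg_hom_id _ x])
      fix l assume "l \<in> Lbar"
      then show "\<psi> (\<theta> (case_gen z \<iota>bar l)) = id (case_gen z \<iota>bar l)"
        by (auto elim!: bar_cases simp: \<theta>z \<theta>\<iota> alg_hom_mult[OF hom] H_gens_closed e_closed \<psi>e \<psi>y \<psi>\<iota>
            B_gens_closed)
    qed
    then show ?thesis by simp
  qed
  \<comment> \<open>The inverse is \<psi> restricted to the corner, where x e = x.\<close>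
  have "bij_betw \<theta> (carrier Hbar) (carrier E.C)"
    by (rule bij_betw_byWitness[of _ \<psi>])
       (auto simp: \<psi>\<theta> \<theta>_closed \<psi>_closed C_sub \<theta>\<psi>, simp add: E.C_carrier)
  then have "\<theta> \<in> alg_iso K Hbar E.C"
    using \<theta> by (simp add: alg_iso_def)
  moreover have "\<psi> ` carrier H = carrier Hbar"
    using \<psi>_closed \<psi>\<theta> \<theta>_closed C_sub by (metis image_eqI image_subsetI subsetI subset_antisym)
  \<comment> \<open>If x e = 0 then \<psi> x = \<psi> (x e) = 0; if \<psi> x = 0 then x e = \<theta>
    (\<psi> x) = 0.\<close>
  moreover have "(\<lambda>x. x \<otimes>\<^bsub>H\<^esub> (\<one>\<^bsub>H\<^esub> \<ominus>\<^bsub>H\<^esub> e)) ` carrier H = a_kernel H Hbar \<psi>"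
    unfolding E.annihilator_eq a_kernel_def'
  proof (intro Collect_cong conj_cong refl)
    fix x assume x: "x \<in> carrier H"
    have "\<psi> (x \<otimes>\<^bsub>H\<^esub> e) = \<psi> x"
      using x by (simp add: alg_hom_mult[OF hom] e_closed \<psi>e \<psi>_closed)
    then show "x \<otimes>\<^bsub>H\<^esub> e = \<zero>\<^bsub>H\<^esub> \<longleftrightarrow> \<psi> x = \<zero>\<^bsub>Hbar\<^esub>"
      using \<theta>\<psi>[OF x] alg_hom_zero[OF hom H_alg B_alg] alg_hom_zero[OF \<theta> B_alg E.C_assoc_algebra]
      by (auto simp: E.C_simps)
  qed
  ultimately show ?thesis
    using hopf_quotient_by_kernel[OF hopf \<psi>] by blast
qed

end

theorem proposition2p3:
  fixes K :: "('k, 'l) ring_scheme"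
    and G :: "('g, 'm) monoid_scheme"
    and \<chi> :: "'g \<Rightarrow> 'k" and g :: 'g and n r :: nat
    and N :: "'g set"
    and H :: "('k, 'a, 'u) hopf_scheme" and \<iota> :: "'g \<Rightarrow> 'a" and y e :: 'a
    and Hbar :: "('k, 'b, 'v) hopf_scheme" and \<iota>bar :: "'g set \<Rightarrow> 'b" and z :: 'b
  assumes "algebraically_closed K"
    and "\<And>m::nat. m > 0 \<Longrightarrow> [m] \<cdot>\<^bsub>K\<^esub> \<one>\<^bsub>K\<^esub> \<noteq> \<zero>\<^bsub>K\<^esub>"
    and "group G" and "finite (carrier G)"
    and "\<chi> \<in> hom G (units_of K)"
    and "g \<in> carrier G" and "\<And>h. h \<in> carrier G \<Longrightarrow> g \<otimes>\<^bsub>G\<^esub> h = h \<otimes>\<^bsub>G\<^esub> g"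
    and "n = group.ord (units_of K) (\<chi> g)" and "n \<ge> 2"
    and "\<And>h. h \<in> carrier G \<Longrightarrow> \<chi> h [^]\<^bsub>K\<^esub> n = \<one>\<^bsub>K\<^esub>"
    and "g [^]\<^bsub>G\<^esub> n \<noteq> \<one>\<^bsub>G\<^esub>"
    and "group.ord G g = n * r"
    and "N = (\<lambda>s. g [^]\<^bsub>G\<^esub> (s * n)) ` {..<r}"
    and "datum_hopf_algebra K G \<chi> g \<one>\<^bsub>K\<^esub> H \<iota> y"
    and "datum_hopf_algebra K (G Mod N) (induced_char \<chi>) (N #>\<^bsub>G\<^esub> g) \<zero>\<^bsub>K\<^esub> Hbar \<iota>bar z"
    and "e = inv\<^bsub>K\<^esub> ([r] \<cdot>\<^bsub>K\<^esub> \<one>\<^bsub>K\<^esub>) \<odot>\<^bsub>H\<^esub> (\<Oplus>\<^bsub>H\<^esub>s\<in>{..<r}. \<iota> (g [^]\<^bsub>G\<^esub> (s * n)))"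
  shows "(\<exists>\<phi>. \<phi> \<in> hopf_iso K Hbar
                (hopf_Quot K H ((\<lambda>x. x \<otimes>\<^bsub>H\<^esub> (\<one>\<^bsub>H\<^esub> \<ominus>\<^bsub>H\<^esub> e)) ` carrier H)))
       \<and> (\<exists>\<phi>. \<phi> \<in> alg_iso K Hbar (corner_alg H e))"
proof -
  interpret algebraically_closed K by fact
  \<comment> \<open>Here \<open>u\<close> becomes \<open>g^n\<close>, so its defining equation holds
    by reflexivity.\<close>
  have "quotient_datum K G \<chi> g n r N H \<iota> y e Hbar \<iota>bar z (g [^]\<^bsub>G\<^esub> n)"
    by (rule quotient_datum.intro[OF field_axioms]) (fact assms | rule refl)+
  then show ?thesis
    by (rule quotient_datum.quotient_and_corner)
qed

end
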